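(* For each real $\varepsilon>0$, there is some real $\lambda>0$ such that, for all integers $n\geq 1$ and $d\geq 0$ with $d\leq \lambda n$, every $d$-regular graph $G$ on $n$ vertices contains a spanning subgraph $H$ such that, for every integer $k$ with $0\leq k\leq d$, $$(1-\varepsilon)\frac{n}{d+1}\;\leq\; \#\{v\in V(H): d_H(v)=k\}\;\leq\; (1+\varepsilon)\frac{n}{d+1}.$$
   Context: Graphs are finite and simple. A spanning subgraph $H$ of $G$ is a graph with $V(H)=V(G)$ and $E(H)\subset E(G)$. $d_H(v)$ denotes the degree of the vertex $v$ in $H$, and $\#S$ denotes the cardinality of a finite set $S$. *)

theory Defs
  imports Complex_Main "Graph_Theory.Digraph_Component"
begin

text \<open>
  A finite simple graph is a \<^term>\<open>pair_graph\<close>: a finite vertex set with a symmetric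
  irreflexive set of ordered pairs, an undirected edge \<open>{u, v}\<close> being the two arcs \<open>(u, v)\<close>
  and \<open>(v, u)\<close>. The arcs leaving \<open>v\<close> thus correspond to the edges at \<open>v\<close>, so
  \<^const>\<open>out_degree\<close> is the degree. \<^const>\<open>spanning\<close> alone does not make the
  subgraph symmetric; it is to be combined with \<^term>\<open>pair_graph\<close> for the subgraph.
\<close>

definition regular_graph :: "nat \<Rightarrow> 'a pair_pre_digraph \<Rightarrow> bool" where
  "regular_graph d G \<longleftrightarrow> (\<forall>v \<in> pverts G. out_degree (with_proj G) v = d)"

end

theory Submission
  imports Defs "HOL-Library.FuncSet" "HOL-Combinatorics.Transposition" "HOL-Real_Asymp.Real_Asymp"
begin

text \<open>
Write \<open>\<mu> = n/(d+1)\<close>. The idea behind the theorem is the threshold rule: give the vertices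
independent uniform labels \<open>x\<^sub>v \<in> [0,1]\<close> and keep an edge \<open>uv\<close> iff
\<open>x\<^sub>u + x\<^sub>v \<ge> 1\<close>. The degree of \<open>v\<close> is then the rank of \<open>1 - x\<^sub>v\<close> among \<open>d + 1\<close> independent
uniform values, so it is exactly uniform on \<open>{0,\<dots>,d}\<close> (\<open>avg_thr\<close>). Vertices at distance at
least three are independent, so for \<open>n\<close> large compared with \<open>d\<^sup>4\<close> Chebyshev's inequality gives
\<open>(1 \<plusminus> \<epsilon>) \<mu>\<close> vertices of each degree (\<open>sparse_regular_labels\<close>).

Otherwise \<open>\<mu>\<close> may be a constant while \<open>d\<close> is large, and the number of vertices of one given
threshold degree is no longer concentrated. The degrees are then corrected. With \<open>q\<close> a small
power of \<open>d\<close>, the vertices are split at random into a bulk \<open>A\<close> and two small sets \<open>P\<close> and \<open>B\<close>, of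
density \<open>1/q\<close> and \<open>1/q\<^sup>2\<close>. Edges inside \<open>A\<close> follow the threshold rule. The edges from \<open>A\<close> to \<open>B\<close>
are control edges: if \<open>v \<in> A\<close> has degree \<open>b\<close> without them, it can choose any final degree
between \<open>b\<close> and \<open>b + |N(v) \<inter> B|\<close>, independently of all other vertices of \<open>A\<close>. So it suffices to
assign to the vertices of \<open>A\<close> evenly distributed targets inside these windows.

For vertices of small label the window leaves only one direction, upwards, and targets exist as
soon as for every \<open>k\<close> at least about \<open>k \<mu>\<close> vertices have threshold degree below \<open>k\<close>. This is a
statement about cumulative counts, whose relative fluctuations decrease with \<open>k\<close>, and therefore
it holds for all \<open>k\<close> at once already when \<open>\<mu>\<close> exceeds a constant (\<open>low_counts\<close>). Vertices of
large label are the mirror image. The remaining vertices get targets in the order of their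
labels; stretching the two extreme groups over slightly more levels than they would occupy by
themselves (the factor \<open>1 + \<gamma>\<close> in \<open>L0\<close>) shifts these targets into the interior of the windows
(\<open>mid_window\<close>).

The vertices of \<open>P\<close> and \<open>B\<close> are few, so it is enough that no degree is taken by more than
\<open>\<epsilon> \<mu> / 8\<close> vertices of either set. Each \<open>w \<in> P\<close> takes a uniformly random number of edges to \<open>A\<close>, each \<open>w \<in> B\<close>
a uniformly random number of edges to \<open>P\<close>. The rest of the degree of \<open>w\<close> does not depend on the
random numbers of its own set: the vertices of \<open>P\<close> receive edges chosen by \<open>B\<close>, and those of
\<open>B\<close> receive control edges, which are determined by the choices of \<open>P\<close>. So within each set the
degrees are independent and spread out, and a Chernoff bound excludes clumps (\<open>clump_bound\<close>).
The vertices of \<open>P\<close> prefer neighbours of large label, so that \<open>v \<in> A\<close> is chosen by a fraction of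
about \<open>x\<^sub>v\<close> of its neighbours in \<open>P\<close>, as under the threshold rule.
\<close>

section \<open>Averages over finite product spaces\<close>

text \<open>
Expectation over a function \<open>f\<close> whose values \<open>f a \<in> C a\<close> are independent and uniform, written as a
finite sum so that existence statements need no measure theory. The probability of \<open>P\<close> is
\<open>avg A C (\<lambda>f. of_bool (P f))\<close>.
\<close>

definition avg :: "'a set \<Rightarrow> ('a \<Rightarrow> 'c set) \<Rightarrow> (('a \<Rightarrow> 'c) \<Rightarrow> real) \<Rightarrow> real" where
  "avg A C F = (\<Sum>f\<in>Pi\<^sub>E A C. F f) / (\<Prod>a\<in>A. real (card (C a)))"

definition proper :: "'a set \<Rightarrow> ('a \<Rightarrow> 'c set) \<Rightarrow> bool" where
  "proper A C \<longleftrightarrow> finite A \<and> (\<forall>a\<in>A. finite (C a) \<and> C a \<noteq> {})"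

definition dep_on :: "'a set \<Rightarrow> (('a \<Rightarrow> 'c) \<Rightarrow> 'b) \<Rightarrow> bool" where
  "dep_on S F \<longleftrightarrow> (\<forall>f g. (\<forall>a\<in>S. f a = g a) \<longrightarrow> F f = F g)"

definition freq :: "('a \<Rightarrow> 'c set) \<Rightarrow> ('a \<Rightarrow> 'c \<Rightarrow> bool) \<Rightarrow> 'a \<Rightarrow> real" where
  "freq C Q a = real (card {c \<in> C a. Q a c}) / real (card (C a))"

lemma proper_finite: "proper A C \<Longrightarrow> finite A"
  by (simp add: proper_def)

lemma proper_subset: "proper A C \<Longrightarrow> B \<subseteq> A \<Longrightarrow> proper B C"
  by (meson finite_subset proper_def subsetD)

lemma proper_card_pos: "proper A C \<Longrightarrow> (\<Prod>a\<in>A. real (card (C a))) > 0"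
  by (auto simp: proper_def card_gt_0_iff intro!: prod_pos)

lemma proper_card: "proper A C \<Longrightarrow> (\<Prod>a\<in>A. real (card (C a))) = real (card (Pi\<^sub>E A C))"
  by (simp add: card_PiE proper_finite)

lemma avg_const [simp]: "proper A C \<Longrightarrow> avg A C (\<lambda>f. c) = c"
  using proper_card_pos[of A C] by (simp add: avg_def proper_card)

lemma avg_add: "avg A C (\<lambda>f. F f + G f) = avg A C F + avg A C G"
  by (simp add: avg_def sum.distrib add_divide_distrib)

lemma avg_diff: "avg A C (\<lambda>f. F f - G f) = avg A C F - avg A C G"
  by (simp add: avg_def sum_subtractf diff_divide_distrib)

lemma avg_cmult: "avg A C (\<lambda>f. c * F f) = c * avg A C F"
  by (simp add: avg_def sum_distrib_left)

lemma avg_sum: "avg A C (\<lambda>f. \<Sum>i\<in>I. F i f) = (\<Sum>i\<in>I. avg A C (F i))"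
  unfolding avg_def by (subst sum.swap) (simp add: sum_divide_distrib)

lemma avg_mono: "(\<And>f. f \<in> Pi\<^sub>E A C \<Longrightarrow> F f \<le> G f) \<Longrightarrow> avg A C F \<le> avg A C G"
  unfolding avg_def by (intro divide_right_mono sum_mono prod_nonneg) auto

lemma avg_cong: "(\<And>f. f \<in> Pi\<^sub>E A C \<Longrightarrow> F f = G f) \<Longrightarrow> avg A C F = avg A C G"
  unfolding avg_def by (intro arg_cong2[where f="(/)"] sum.cong) auto

lemma avg_nonneg: "(\<And>f. f \<in> Pi\<^sub>E A C \<Longrightarrow> F f \<ge> 0) \<Longrightarrow> avg A C F \<ge> 0"
  unfolding avg_def by (intro divide_nonneg_nonneg sum_nonneg prod_nonneg) auto

lemma avg_le_const:
  assumes "proper A C" "\<And>f. f \<in> Pi\<^sub>E A C \<Longrightarrow> F f \<le> c"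
  shows "avg A C F \<le> c"
proof -
  have "avg A C F \<le> avg A C (\<lambda>f. c)" by (rule avg_mono) (rule assms)
  thus ?thesis using assms by simp
qed

lemma avg_exists:
  assumes "proper A C" "avg A C F < c"
  shows "\<exists>f\<in>Pi\<^sub>E A C. F f < c"
proof (rule ccontr)
  assume "\<not> ?thesis"
  hence "avg A C (\<lambda>f. c) \<le> avg A C F" by (intro avg_mono) auto
  thus False using assms by simp
qed

lemma avg_union_bound:
  assumes "finite I"
  shows "avg A C (\<lambda>f. of_bool (\<exists>i\<in>I. P i f)) \<le> (\<Sum>i\<in>I. avg A C (\<lambda>f. of_bool (P i f)))"
proof -
  have "of_bool (\<exists>i\<in>I. P i f) \<le> (\<Sum>i\<in>I. of_bool (P i f) :: real)" for f
  proof (cases "\<exists>i\<in>I. P i f")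
    case True
    then obtain i where i: "i \<in> I" "P i f" by auto
    have "(of_bool (P i f) :: real) \<le> (\<Sum>i\<in>I. of_bool (P i f))"
      by (rule member_le_sum) (use i assms in auto)
    thus ?thesis using i by auto
  qed (auto intro: sum_nonneg)
  thus ?thesis unfolding avg_sum[symmetric] by (intro avg_mono)
qed

lemma avg_disj:
  "avg A C (\<lambda>f. of_bool (P f \<or> Q f)) \<le> avg A C (\<lambda>f. of_bool (P f)) + avg A C (\<lambda>f. of_bool (Q f))"
  unfolding avg_add[symmetric] by (rule avg_mono) auto

lemma avg_markov:
  assumes "t > 0" "\<And>f. f \<in> Pi\<^sub>E A C \<Longrightarrow> F f \<ge> 0"
  shows "avg A C (\<lambda>f. of_bool (F f \<ge> t)) \<le> avg A C F / t"
proof -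
  have "avg A C (\<lambda>f. of_bool (F f \<ge> t)) \<le> avg A C (\<lambda>f. (1/t) * F f)"
    using assms by (intro avg_mono) (auto simp: field_simps)
  thus ?thesis by (simp only: avg_cmult) simp
qed

lemma avg_chebyshev:
  assumes "t > 0"
  shows "avg A C (\<lambda>f. of_bool (\<bar>X f - m\<bar> \<ge> t)) \<le> avg A C (\<lambda>f. (X f - m)^2) / t^2"
proof -
  have "avg A C (\<lambda>f. of_bool (\<bar>X f - m\<bar> \<ge> t)) \<le> avg A C (\<lambda>f. of_bool ((X f - m)^2 \<ge> t^2))"
    using assms by (intro avg_mono) (auto simp flip: abs_le_square_iff)
  also have "\<dots> \<le> avg A C (\<lambda>f. (X f - m)^2) / t^2"
    by (rule avg_markov) (use assms in auto)
  finally show ?thesis .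
qed

lemma avg_prod:
  assumes "proper A C"
  shows "avg A C (\<lambda>f. \<Prod>a\<in>A. g a (f a)) = (\<Prod>a\<in>A. (\<Sum>c\<in>C a. g a c) / real (card (C a)))"
  using assms unfolding avg_def proper_def
  by (subst prod_dividef) (simp add: prod_sum_PiE)

lemma dep_onD: "dep_on S F \<Longrightarrow> (\<And>a. a \<in> S \<Longrightarrow> f a = g a) \<Longrightarrow> F f = F g"
  by (auto simp: dep_on_def)

text \<open>
Fubini: the coordinates in \<open>A\<close> can be fixed before those in \<open>B\<close> are averaged. All independence
statements below come from this.
\<close>

lemma avg_split:
  assumes "A \<inter> B = {}" "finite A" "finite B"
  shows "avg (A \<union> B) C F = avg A C (\<lambda>f. avg B C (\<lambda>g. F (\<lambda>a. if a \<in> A then f a else g a)))"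
proof -
  let ?m = "\<lambda>(f, g) a. if a \<in> A then f a else g a"
  have bij: "bij_betw ?m (Pi\<^sub>E A C \<times> Pi\<^sub>E B C) (Pi\<^sub>E (A \<union> B) C)"
  proof (rule bij_betwI[where g="\<lambda>h. (restrict h A, restrict h B)"])
    show "?m \<in> Pi\<^sub>E A C \<times> Pi\<^sub>E B C \<rightarrow> Pi\<^sub>E (A \<union> B) C"
      by (auto simp: PiE_def extensional_def)
    show "(\<lambda>h. (restrict h A, restrict h B)) \<in> Pi\<^sub>E (A \<union> B) C \<rightarrow> Pi\<^sub>E A C \<times> Pi\<^sub>E B C"
      by (auto simp: PiE_def extensional_def)
    show "(restrict (?m x) A, restrict (?m x) B) = x" if "x \<in> Pi\<^sub>E A C \<times> Pi\<^sub>E B C" for x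
    proof -
      obtain f g where x: "x = (f, g)" by force
      have "restrict (?m x) A = f" "restrict (?m x) B = g"
        using that assms(1) unfolding x by (auto simp: PiE_def extensional_def fun_eq_iff restrict_def)
      thus ?thesis using x by simp
    qed
    show "?m (restrict h A, restrict h B) = h" if "h \<in> Pi\<^sub>E (A \<union> B) C" for h
      using that by (auto simp: PiE_def extensional_def fun_eq_iff restrict_def)
  qed
  have "(\<Sum>h\<in>Pi\<^sub>E (A \<union> B) C. F h) = (\<Sum>x\<in>Pi\<^sub>E A C \<times> Pi\<^sub>E B C. F (?m x))"
    by (rule sum.reindex_bij_betw[OF bij, symmetric])
  also have "\<dots> = (\<Sum>f\<in>Pi\<^sub>E A C. \<Sum>g\<in>Pi\<^sub>E B C. F (\<lambda>a. if a \<in> A then f a else g a))"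
    by (subst sum.cartesian_product) (simp add: case_prod_beta)
  finally show ?thesis
    unfolding avg_def using assms
    by (simp add: prod.union_disjoint sum_divide_distrib mult.commute)
qed

lemma avg_local:
  assumes "proper A C" "S \<subseteq> A" "dep_on S F"
  shows "avg A C F = avg S C F"
proof -
  have A: "A = S \<union> (A - S)" using assms(2) by auto
  have fin: "finite S" "finite (A - S)"
    using assms by (auto simp: proper_def intro: finite_subset)
  have "avg A C F = avg S C (\<lambda>f. avg (A - S) C (\<lambda>g. F (\<lambda>a. if a \<in> S then f a else g a)))"
    by (subst A, rule avg_split) (use fin in auto)
  also have "\<dots> = avg S C (\<lambda>f. avg (A - S) C (\<lambda>g. F f))"
    by (intro avg_cong dep_onD[OF assms(3)]) auto
  also have "\<dots> = avg S C F"
    using proper_subset[OF assms(1), of "A - S"] by simp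
  finally show ?thesis .
qed

lemma avg_indep:
  assumes "proper A C" "S \<subseteq> A" "T \<subseteq> A" "S \<inter> T = {}" "dep_on S F" "dep_on T G"
  shows "avg A C (\<lambda>f. F f * G f) = avg A C F * avg A C G"
proof -
  have fin: "finite S" "finite T" using assms by (auto simp: proper_def intro: finite_subset)
  have "dep_on (S \<union> T) (\<lambda>f. F f * G f)"
    unfolding dep_on_def
  proof (intro allI impI)
    fix f g :: "'a \<Rightarrow> 'b" assume "\<forall>a\<in>S \<union> T. f a = g a"
    hence "F f = F g" "G f = G g" by (auto intro: dep_onD[OF assms(5)] dep_onD[OF assms(6)])
    thus "F f * G f = F g * G g" by simp
  qed
  hence "avg A C (\<lambda>f. F f * G f) = avg (S \<union> T) C (\<lambda>f. F f * G f)"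
    by (intro avg_local assms) (use assms in auto)
  also have "\<dots> = avg S C (\<lambda>f. avg T C (\<lambda>g. F (\<lambda>a. if a \<in> S then f a else g a) * G (\<lambda>a. if a \<in> S then f a else g a)))"
    by (rule avg_split) (use fin assms in auto)
  also have "\<dots> = avg S C (\<lambda>f. avg T C (\<lambda>g. F f * G g))"
  proof (intro avg_cong arg_cong2[where f="(*)"])
    fix f g
    show "F (\<lambda>a. if a \<in> S then f a else g a) = F f" by (rule dep_onD[OF assms(5)]) auto
    show "G (\<lambda>a. if a \<in> S then f a else g a) = G g"
      by (rule dep_onD[OF assms(6)]) (use assms(4) in auto)
  qed
  also have "\<dots> = avg S C (\<lambda>f. avg T C G * F f)"
    by (simp only: avg_cmult mult.commute)
  also have "\<dots> = avg T C G * avg S C F" by (rule avg_cmult)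
  also have "\<dots> = avg A C F * avg A C G"
    using avg_local[OF assms(1,2,5)] avg_local[OF assms(1,3,6)] by simp
  finally show ?thesis .
qed

lemma avg_reindex:
  assumes "bij_betw \<phi> (Pi\<^sub>E A C) (Pi\<^sub>E A C)"
  shows "avg A C (\<lambda>f. F (\<phi> f)) = avg A C F"
  unfolding avg_def using sum.reindex_bij_betw[OF assms, of F] by simp

lemma freq_range: "proper A C \<Longrightarrow> a \<in> A \<Longrightarrow> 0 \<le> freq C Q a \<and> freq C Q a \<le> 1"
  unfolding freq_def proper_def
  by (auto simp: divide_le_eq card_gt_0_iff intro!: card_mono)

lemma avg_coord:
  assumes "proper A C" "a \<in> A"
  shows "avg A C (\<lambda>f. g (f a)) = (\<Sum>c\<in>C a. g c) / real (card (C a))"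
proof -
  have "avg A C (\<lambda>f. g (f a)) = avg {a} C (\<lambda>f. g (f a))"
    by (rule avg_local) (use assms in \<open>auto simp: dep_on_def\<close>)
  also have "\<dots> = avg {a} C (\<lambda>f. \<Prod>b\<in>{a}. g (f b))" by simp
  also have "\<dots> = (\<Sum>c\<in>C a. g c) / real (card (C a))"
    by (subst avg_prod) (use assms in \<open>auto simp: proper_def\<close>)
  finally show ?thesis .
qed

lemma avg_coord_freq:
  assumes "proper A C" "a \<in> A"
  shows "avg A C (\<lambda>f. of_bool (Q a (f a))) = freq C Q a"
  using assms by (subst avg_coord) (auto simp: freq_def proper_def Int_def)

section \<open>Sums of independent indicators\<close>

text \<open>
The exponential moment factorises over the coordinates, and \<open>1 + (e\<^sup>\<theta> - 1) p \<le> exp ((e\<^sup>\<theta> - 1) p)\<close>.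
The sign of \<open>\<theta>\<close> is arbitrary, so the bound serves both tails.
\<close>

lemma avg_exp_count:
  fixes \<theta> :: real
  assumes "proper A C" "S \<subseteq> A"
  shows "avg A C (\<lambda>f. exp (\<theta> * (\<Sum>a\<in>S. of_bool (Q a (f a))))) \<le> exp ((exp \<theta> - 1) * (\<Sum>a\<in>S. freq C Q a))"
proof -
  have pS: "proper S C" using assms proper_subset by blast
  have finS: "finite S" using pS by (rule proper_finite)
  have "avg A C (\<lambda>f. exp (\<theta> * (\<Sum>a\<in>S. of_bool (Q a (f a))))) =
        avg S C (\<lambda>f. exp (\<theta> * (\<Sum>a\<in>S. of_bool (Q a (f a)))))"
    by (rule avg_local[OF assms]) (auto simp: dep_on_def cong: sum.cong)
  also have "\<dots> = avg S C (\<lambda>f. \<Prod>a\<in>S. exp (\<theta> * of_bool (Q a (f a))))"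
    by (simp only: sum_distrib_left exp_sum[OF finS])
  also have "\<dots> = (\<Prod>a\<in>S. (\<Sum>c\<in>C a. exp (\<theta> * of_bool (Q a c))) / real (card (C a)))"
    by (rule avg_prod[OF pS])
  also have "\<dots> = (\<Prod>a\<in>S. 1 + (exp \<theta> - 1) * freq C Q a)"
  proof (rule prod.cong[OF refl])
    fix a assume a: "a \<in> S"
    have fin: "finite (C a)" "C a \<noteq> {}" using pS a by (auto simp: proper_def)
    have "(\<Sum>c\<in>C a. exp (\<theta> * of_bool (Q a c))) = (\<Sum>c\<in>C a. 1 + (exp \<theta> - 1) * of_bool (Q a c))"
      by (rule sum.cong) auto
    also have "\<dots> = real (card (C a)) + (exp \<theta> - 1) * real (card {c\<in>C a. Q a c})"
      using fin by (simp add: sum.distrib flip: sum_distrib_left) (simp add: Int_def)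
    finally show "(\<Sum>c\<in>C a. exp (\<theta> * of_bool (Q a c))) / real (card (C a)) = 1 + (exp \<theta> - 1) * freq C Q a"
      using fin by (simp add: freq_def field_simps)
  qed
  also have "\<dots> \<le> (\<Prod>a\<in>S. exp ((exp \<theta> - 1) * freq C Q a))"
  proof (rule prod_mono, intro conjI)
    fix a assume a: "a \<in> S"
    have "0 \<le> freq C Q a" "freq C Q a \<le> 1" using freq_range[OF pS a] by auto
    hence "0 \<le> (1 - freq C Q a) + exp \<theta> * freq C Q a" by simp
    thus "0 \<le> 1 + (exp \<theta> - 1) * freq C Q a" by (simp add: algebra_simps)
    show "1 + (exp \<theta> - 1) * freq C Q a \<le> exp ((exp \<theta> - 1) * freq C Q a)"
      by (rule exp_ge_add_one_self)
  qed
  also have "\<dots> = exp ((exp \<theta> - 1) * (\<Sum>a\<in>S. freq C Q a))"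
    by (simp add: sum_distrib_left exp_sum finS)
  finally show ?thesis .
qed

lemma count_upper_tail:
  fixes \<theta> :: real
  assumes "proper A C" "S \<subseteq> A" "\<theta> \<ge> 0" "(\<Sum>a\<in>S. freq C Q a) \<le> p"
  shows "avg A C (\<lambda>f. of_bool ((\<Sum>a\<in>S. of_bool (Q a (f a))) \<ge> j)) \<le> exp (- \<theta> * j + (exp \<theta> - 1) * p)"
proof -
  have "avg A C (\<lambda>f. of_bool ((\<Sum>a\<in>S. of_bool (Q a (f a))) \<ge> j))
     \<le> avg A C (\<lambda>f. exp (- \<theta> * j) * exp (\<theta> * (\<Sum>a\<in>S. of_bool (Q a (f a)))))"
  proof (rule avg_mono)
    fix f
    have "1 \<le> exp (- \<theta> * j + \<theta> * X)" if "X \<ge> j" for X :: real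
      using that assms(3) by (simp add: mult_left_mono)
    thus "of_bool ((\<Sum>a\<in>S. of_bool (Q a (f a))) \<ge> j)
         \<le> exp (- \<theta> * j) * exp (\<theta> * (\<Sum>a\<in>S. of_bool (Q a (f a))))"
      by (auto simp flip: exp_add)
  qed
  also have "\<dots> \<le> exp (- \<theta> * j) * exp ((exp \<theta> - 1) * (\<Sum>a\<in>S. freq C Q a))"
    unfolding avg_cmult by (intro mult_left_mono avg_exp_count assms) auto
  also have "\<dots> \<le> exp (- \<theta> * j) * exp ((exp \<theta> - 1) * p)"
    using assms by (auto intro!: mult_left_mono)
  finally show ?thesis by (simp only: exp_add)
qed

lemma count_lower_tail:
  fixes \<theta> :: real
  assumes "proper A C" "S \<subseteq> A" "\<theta> \<ge> 0" "(\<Sum>a\<in>S. freq C Q a) \<ge> p"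
  shows "avg A C (\<lambda>f. of_bool ((\<Sum>a\<in>S. of_bool (Q a (f a))) \<le> j)) \<le> exp (\<theta> * j + (exp (- \<theta>) - 1) * p)"
proof -
  have "avg A C (\<lambda>f. of_bool ((\<Sum>a\<in>S. of_bool (Q a (f a))) \<le> j))
     \<le> avg A C (\<lambda>f. exp (\<theta> * j) * exp ((- \<theta>) * (\<Sum>a\<in>S. of_bool (Q a (f a)))))"
  proof (rule avg_mono)
    fix f
    have "1 \<le> exp (\<theta> * j + (- \<theta>) * X)" if "X \<le> j" for X :: real
      using that assms(3) by (simp add: mult_left_mono)
    thus "of_bool ((\<Sum>a\<in>S. of_bool (Q a (f a))) \<le> j)
         \<le> exp (\<theta> * j) * exp ((- \<theta>) * (\<Sum>a\<in>S. of_bool (Q a (f a))))"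
      by (auto simp flip: exp_add)
  qed
  also have "\<dots> \<le> exp (\<theta> * j) * exp ((exp (- \<theta>) - 1) * (\<Sum>a\<in>S. freq C Q a))"
    unfolding avg_cmult by (intro mult_left_mono avg_exp_count assms) auto
  also have "\<dots> \<le> exp (\<theta> * j) * exp ((exp (- \<theta>) - 1) * p)"
  proof -
    have "exp (- \<theta>) - 1 \<le> 0" using assms(3) by simp
    hence "(exp (- \<theta>) - 1) * (\<Sum>a\<in>S. freq C Q a) \<le> (exp (- \<theta>) - 1) * p"
      using assms(4) by (intro mult_left_mono_neg)
    thus ?thesis by (auto intro!: mult_left_mono)
  qed
  finally show ?thesis by (simp only: exp_add)
qed

lemma exp_neg_bound: "(x::real) \<ge> 0 \<Longrightarrow> exp (- x) \<le> 1 - x + x^2"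
proof -
  assume x: "x \<ge> 0"
  have "1 + x \<le> exp x" by (rule exp_ge_add_one_self)
  moreover have "(1 - x + x^2) * (1 + x) = 1 + x^3" by (simp add: algebra_simps power2_eq_square power3_eq_cube)
  moreover have "1 - x + x^2 \<ge> 0"
  proof -
    have "1 - x + x^2 = (x - 1/2)^2 + 3/4" by (simp add: power2_eq_square algebra_simps)
    thus ?thesis by simp
  qed
  moreover have "x^3 \<ge> 0" using x by simp
  ultimately have "1 \<le> (1 - x + x^2) * exp x"
    using mult_left_mono[of "1+x" "exp x" "1 - x + x^2"] by linarith
  thus ?thesis by (simp add: exp_minus field_simps)
qed

text \<open>
Both tails with the choice \<open>\<theta> = t / (2 D)\<close>, using \<open>e\<^sup>\<theta> - 1 \<le> \<theta> + \<theta>\<^sup>2\<close> and its counterpart for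
\<open>-\<theta>\<close>.
\<close>

lemma count_deviation:
  assumes "proper A C" "S \<subseteq> A" "(\<Sum>a\<in>S. freq C Q a) \<le> D" "0 \<le> t" "t \<le> 2 * D" "D > 0"
  shows "avg A C (\<lambda>f. of_bool (\<bar>(\<Sum>a\<in>S. of_bool (Q a (f a))) - (\<Sum>a\<in>S. freq C Q a)\<bar> \<ge> t)) \<le> 2 * exp (- (t^2) / (4 * D))"
proof -
  define p where "p = (\<Sum>a\<in>S. freq C Q a)"
  define X where "X = (\<lambda>f. (\<Sum>a\<in>S. of_bool (Q a (f a))) :: real)"
  define \<theta> where "\<theta> = t / (2 * D)"
  have p0: "p \<ge> 0" unfolding p_def
    by (intro sum_nonneg) (use freq_range[OF assms(1)] assms(2) in blast)
  have \<theta>: "\<theta> \<ge> 0" "\<theta> \<le> 1" using assms by (auto simp: \<theta>_def field_simps)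
  have pD: "\<theta>^2 * p \<le> \<theta>^2 * D" using assms(3) by (intro mult_left_mono) (auto simp: p_def)
  have e: "- \<theta> * t + \<theta>^2 * D = - (t^2) / (4 * D)"
    using assms(6) by (simp add: \<theta>_def power2_eq_square field_simps)
  have "avg A C (\<lambda>f. of_bool (X f \<ge> p + t)) \<le> exp (- \<theta> * (p + t) + (exp \<theta> - 1) * p)"
    unfolding X_def by (rule count_upper_tail) (use assms \<theta> in \<open>auto simp: p_def\<close>)
  also have "\<dots> \<le> exp (- \<theta> * t + \<theta>^2 * D)"
  proof -
    have "(exp \<theta> - 1) * p \<le> (\<theta> + \<theta>^2) * p"
      using exp_bound[of \<theta>] \<theta> p0 by (intro mult_right_mono) auto
    thus ?thesis using pD by (simp add: algebra_simps)
  qed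
  finally have U: "avg A C (\<lambda>f. of_bool (X f \<ge> p + t)) \<le> exp (- (t^2) / (4 * D))" by (simp only: e)
  have "avg A C (\<lambda>f. of_bool (X f \<le> p - t)) \<le> exp (\<theta> * (p - t) + (exp (-\<theta>) - 1) * p)"
    unfolding X_def by (rule count_lower_tail) (use assms \<theta> in \<open>auto simp: p_def\<close>)
  also have "\<dots> \<le> exp (- \<theta> * t + \<theta>^2 * D)"
  proof -
    have "(exp (-\<theta>) - 1) * p \<le> (- \<theta> + \<theta>^2) * p"
      using exp_neg_bound[of \<theta>] \<theta> p0 by (intro mult_right_mono) auto
    thus ?thesis using pD by (simp add: algebra_simps)
  qed
  finally have L: "avg A C (\<lambda>f. of_bool (X f \<le> p - t)) \<le> exp (- (t^2) / (4 * D))" by (simp only: e)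
  have "avg A C (\<lambda>f. of_bool (\<bar>X f - p\<bar> \<ge> t)) \<le> avg A C (\<lambda>f. of_bool (X f \<ge> p + t \<or> X f \<le> p - t))"
    by (rule avg_mono) (auto simp: abs_if split: if_splits)
  also have "\<dots> \<le> avg A C (\<lambda>f. of_bool (X f \<ge> p + t)) + avg A C (\<lambda>f. of_bool (X f \<le> p - t))"
    by (rule avg_disj)
  finally show ?thesis using U L by (simp add: X_def p_def)
qed

section \<open>Threshold degrees of random labels\<close>

text \<open>
The degree of \<open>u\<close> into \<open>Z\<close> under the threshold rule for labels in \<open>{..<NN}\<close>. The offset \<open>\<tau>\<close> is 0
or 1; reflecting all labels at the middle of \<open>{..<NN}\<close> turns the number of non-neighbours for
\<open>\<tau> = 0\<close> into the threshold degree for \<open>\<tau> = 1\<close>.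
\<close>

definition thr :: "nat \<Rightarrow> nat \<Rightarrow> ('a \<Rightarrow> nat) \<Rightarrow> 'a set \<Rightarrow> 'a \<Rightarrow> nat" where
  "thr NN \<tau> f Z u = card {w \<in> Z. NN \<le> f w + f u + \<tau>}"

abbreviation labels :: "nat \<Rightarrow> 'a \<Rightarrow> nat set" where
  "labels NN \<equiv> \<lambda>_. {..<NN}"

lemma proper_labels: "finite A \<Longrightarrow> NN > 0 \<Longrightarrow> proper A (labels NN)"
  by (auto simp: proper_def)

lemma finite_max_point:
  fixes f :: "'a \<Rightarrow> nat"
  assumes "finite U" "U \<noteq> {}"
  obtains w where "w \<in> U" "\<And>v. v \<in> U \<Longrightarrow> f v \<le> f w"
proof -
  have "Max (f ` U) \<in> f ` U" using assms by (intro Max_in) auto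
  then obtain w where w: "w \<in> U" "f w = Max (f ` U)" by (metis imageE)
  have "f v \<le> f w" if "v \<in> U" for v
    unfolding w(2) by (rule Max_ge) (use that assms in auto)
  with w(1) show ?thesis using that by blast
qed

lemma finite_min_point:
  fixes f :: "'a \<Rightarrow> nat"
  assumes "finite U" "U \<noteq> {}"
  obtains w where "w \<in> U" "\<And>v. v \<in> U \<Longrightarrow> f w \<le> f v"
proof -
  have "Min (f ` U) \<in> f ` U" using assms by (intro Min_in) auto
  then obtain w where w: "w \<in> U" "f w = Min (f ` U)" by (metis imageE)
  have "f w \<le> f v" if "v \<in> U" for v
    unfolding w(2) by (rule Min_le) (use that assms in auto)
  with w(1) show ?thesis using that by blast
qed

text \<open>
The \<open>k\<close> largest values have this property. With ties there may be more than \<open>k\<close> such elements, which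
is why the matching upper bound counts weakly larger values.
\<close>

lemma card_few_above_ge:
  fixes f :: "'a \<Rightarrow> nat"
  assumes "finite W" "k \<le> card W"
  shows "k \<le> card {w \<in> W. card {v \<in> W. f v > f w} < k}"
proof -
  \<comment> \<open>a maximal element without the property has at least k larger ones, and all of these have it\<close>
  define U where "U = {w \<in> W. k \<le> card {v \<in> W. f v > f w}}"
  define X where "X = {w \<in> W. card {v \<in> W. f v > f w} < k}"
  have UX: "W = U \<union> X" by (auto simp: U_def X_def)
  have fin: "finite U" "finite X" using assms by (auto simp: U_def X_def)
  have "k \<le> card X"
  proof (cases "U = {}")
    case True
    thus ?thesis using assms UX by simp
  next
    case False
    obtain w where w: "w \<in> U" "\<And>v. v \<in> U \<Longrightarrow> f v \<le> f w"
      using finite_max_point[OF fin(1) False, of f] by blast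
    have "{v \<in> W. f v > f w} \<subseteq> X"
    proof
      fix v assume v: "v \<in> {v \<in> W. f v > f w}"
      hence "v \<notin> U" using w(2)[of v] by fastforce
      thus "v \<in> X" using v UX by blast
    qed
    hence "card {v \<in> W. f v > f w} \<le> card X"
      by (rule card_mono[OF fin(2)])
    moreover have "k \<le> card {v \<in> W. f v > f w}" using w(1) unfolding U_def by blast
    ultimately show ?thesis by linarith
  qed
  thus ?thesis by (simp only: X_def)
qed

lemma card_few_not_below_le:
  fixes f :: "'a \<Rightarrow> nat"
  assumes "finite W"
  shows "card {w \<in> W. card {v \<in> W - {w}. f v \<ge> f w} < k} \<le> k"
proof -
  define X where "X = {w \<in> W. card {v \<in> W - {w}. f v \<ge> f w} < k}"
  have fin: "finite X" using assms by (auto simp: X_def)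
  have "card X \<le> k"
  proof (cases "X = {}")
    case True
    thus ?thesis by simp
  next
    case False
    obtain w where w: "w \<in> X" "\<And>v. v \<in> X \<Longrightarrow> f w \<le> f v"
      using finite_min_point[OF fin False, of f] by blast
    have "X - {w} \<subseteq> {v \<in> W - {w}. f v \<ge> f w}"
    proof
      fix v assume v: "v \<in> X - {w}"
      hence "f w \<le> f v" "v \<in> W" using w(2)[of v] by (auto simp: X_def)
      thus "v \<in> {v \<in> W - {w}. f v \<ge> f w}" using v by blast
    qed
    hence "card (X - {w}) \<le> card {v \<in> W - {w}. f v \<ge> f w}"
      by (intro card_mono) (use assms in auto)
    moreover have "card {v \<in> W - {w}. f v \<ge> f w} < k" using w(1) unfolding X_def by blast
    moreover have "card X = Suc (card (X - {w}))" by (rule card.remove[OF fin w(1)])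
    ultimately show ?thesis by linarith
  qed
  thus ?thesis by (simp only: X_def)
qed

lemma avg_transpose:
  assumes "finite W" "NN > 0" "u \<in> W" "w \<in> W"
  shows "avg W (labels NN) (\<lambda>f. F (\<lambda>x. f (Transposition.transpose u w x))) = avg W (labels NN) F"
proof (rule avg_reindex)
  have *: "(\<lambda>x. f (Transposition.transpose u w x)) \<in> Pi\<^sub>E W (labels NN)" if "f \<in> Pi\<^sub>E W (labels NN)" for f
    using that assms(3,4) by (auto simp: PiE_def extensional_def Transposition.transpose_def Pi_def)
  show "bij_betw (\<lambda>f x. f (Transposition.transpose u w x)) (Pi\<^sub>E W (labels NN)) (Pi\<^sub>E W (labels NN))"
    by (rule bij_betwI[where g="\<lambda>f x. f (Transposition.transpose u w x)"]) (use * in auto)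
qed

lemma avg_reflect_at:
  assumes "finite W" "u \<in> W"
  shows "avg W (labels NN) (\<lambda>f. F (f(u := NN - 1 - f u))) = avg W (labels NN) F"
proof (rule avg_reindex)
  have *: "f(u := NN - 1 - f u) \<in> Pi\<^sub>E W (labels NN)" if "f \<in> Pi\<^sub>E W (labels NN)" for f
  proof -
    have "f u < NN" using that assms by auto
    thus ?thesis using that assms by (auto simp: PiE_def extensional_def Pi_def)
  qed
  have **: "NN - 1 - (NN - 1 - f u) = f u" if "f \<in> Pi\<^sub>E W (labels NN)" for f
  proof -
    have "f u < NN" using that assms by auto
    thus ?thesis by simp
  qed
  show "bij_betw (\<lambda>f. f(u := NN - 1 - f u)) (Pi\<^sub>E W (labels NN)) (Pi\<^sub>E W (labels NN))"
    by (rule bij_betwI[where g="\<lambda>f. f(u := NN - 1 - f u)"]) (use * ** in auto)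
qed

lemma avg_tie:
  assumes "finite W" "NN > 0" "u \<in> W" "w \<in> W" "u \<noteq> w"
  shows "avg W (labels NN) (\<lambda>f. of_bool (f w = f u)) = 1 / real NN"
proof -
  have p: "proper W (labels NN)" using assms proper_labels by blast
  have "avg W (labels NN) (\<lambda>f. of_bool (f w = f u)) =
        avg W (labels NN) (\<lambda>f. \<Sum>c<NN. of_bool (f w = c) * of_bool (f u = c))"
  proof (rule avg_cong)
    fix f assume f: "f \<in> Pi\<^sub>E W (labels NN)"
    hence "f w < NN" using assms by auto
    have "(\<Sum>c<NN. of_bool (f w = c) * of_bool (f u = c) :: real) = (\<Sum>c<NN. if f w = c then of_bool (f u = c) else 0)"
      by (rule sum.cong) auto
    thus "of_bool (f w = f u) = (\<Sum>c<NN. of_bool (f w = c) * of_bool (f u = c) :: real)"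
      using \<open>f w < NN\<close> by (simp add: eq_commute)
  qed
  also have "\<dots> = (\<Sum>c<NN. avg W (labels NN) (\<lambda>f. of_bool (f w = c)) * avg W (labels NN) (\<lambda>f. of_bool (f u = c)))"
    unfolding avg_sum
    by (intro sum.cong refl avg_indep[OF p, of "{w}" "{u}"]) (use assms in \<open>auto simp: dep_on_def\<close>)
  also have "\<dots> = (\<Sum>c<NN. (1 / real NN) * (1 / real NN))"
  proof (intro sum.cong refl)
    fix c assume "c \<in> {..<NN}"
    have "avg W (labels NN) (\<lambda>f. of_bool (f v = c)) = 1 / real NN" if "v \<in> W" for v
    proof -
      have "avg W (labels NN) (\<lambda>f. of_bool (f v = c)) = (\<Sum>x<NN. of_bool (x = c)) / real (card {..<NN})"
        by (rule avg_coord[OF p that, of "\<lambda>x. of_bool (x = c)"])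
      also have "(\<Sum>x<NN. of_bool (x = c)) = (\<Sum>x<NN. if x = c then 1 else 0 :: real)"
        by (rule sum.cong) auto
      finally show ?thesis using \<open>c \<in> {..<NN}\<close> by simp
    qed
    thus "avg W (labels NN) (\<lambda>f. of_bool (f w = c)) * avg W (labels NN) (\<lambda>f. of_bool (f u = c)) = (1 / real NN) * (1 / real NN)"
      using assms by simp
  qed
  also have "\<dots> = 1 / real NN" using assms by simp
  finally show ?thesis .
qed

text \<open>
All elements of \<open>W\<close> play the same role, so the probability for a single one is the average number of
elements with the property, divided by the size of \<open>W\<close>.
\<close>

lemma avg_rank:
  assumes "finite W" "NN > 0" "u \<in> W" "k \<le> card W"
  shows "avg W (labels NN) (\<lambda>f. of_bool (card {v \<in> W. f v > f u} < k)) \<ge> real k / real (card W)"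
    and "avg W (labels NN) (\<lambda>f. of_bool (card {v \<in> W - {u}. f v \<ge> f u} < k)) \<le> real k / real (card W)"
proof -
  have p: "proper W (labels NN)" using assms proper_labels by blast
  have cW: "card W > 0" using assms card_gt_0_iff by blast
  let ?t = "\<lambda>w. Transposition.transpose u w"
  have sym1: "avg W (labels NN) (\<lambda>f. of_bool (card {v \<in> W. f v > f w} < k)) =
              avg W (labels NN) (\<lambda>f. of_bool (card {v \<in> W. f v > f u} < k))" if w: "w \<in> W" for w
  proof -
    have "card {v \<in> W. f (?t w v) > f (?t w u)} = card {v \<in> W. f v > f w}" for f :: "'a \<Rightarrow> nat"
      by (rule bij_betw_same_card[of "?t w"], rule bij_betwI[where g="?t w"])
         (use w assms(3) in \<open>auto simp: Transposition.transpose_def\<close>)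
    thus ?thesis
      by (subst (2) avg_transpose[OF assms(1,2,3) w, symmetric]) simp
  qed
  have sym2: "avg W (labels NN) (\<lambda>f. of_bool (card {v \<in> W - {w}. f v \<ge> f w} < k)) =
              avg W (labels NN) (\<lambda>f. of_bool (card {v \<in> W - {u}. f v \<ge> f u} < k))" if w: "w \<in> W" for w
  proof -
    have "card {v \<in> W - {u}. f (?t w v) \<ge> f (?t w u)} = card {v \<in> W - {w}. f v \<ge> f w}" for f :: "'a \<Rightarrow> nat"
      by (rule bij_betw_same_card[of "?t w"], rule bij_betwI[where g="?t w"])
         (use w assms(3) in \<open>auto simp: Transposition.transpose_def split: if_splits\<close>)
    thus ?thesis
      by (subst (2) avg_transpose[OF assms(1,2,3) w, symmetric]) simp
  qed
  have count: "(\<Sum>w\<in>W. of_bool (P w)) = real (card {w\<in>W. P w})" for P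
    using assms(1) by (simp add: Int_def)
  have "real k = avg W (labels NN) (\<lambda>f. real k)" using p by simp
  also have "\<dots> \<le> avg W (labels NN) (\<lambda>f. \<Sum>w\<in>W. of_bool (card {v \<in> W. f v > f w} < k))"
    unfolding count by (rule avg_mono) (use card_few_above_ge[OF assms(1,4)] in simp)
  also have "\<dots> = real (card W) * avg W (labels NN) (\<lambda>f. of_bool (card {v \<in> W. f v > f u} < k))"
    unfolding avg_sum using sym1 by simp
  finally show "avg W (labels NN) (\<lambda>f. of_bool (card {v \<in> W. f v > f u} < k)) \<ge> real k / real (card W)"
    using cW by (simp add: divide_le_eq mult.commute)
  have "real (card W) * avg W (labels NN) (\<lambda>f. of_bool (card {v \<in> W - {u}. f v \<ge> f u} < k)) =
        avg W (labels NN) (\<lambda>f. \<Sum>w\<in>W. of_bool (card {v \<in> W - {w}. f v \<ge> f w} < k))"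
    unfolding avg_sum using sym2 by simp
  also have "\<dots> \<le> avg W (labels NN) (\<lambda>f. real k)"
    unfolding count by (rule avg_mono) (use card_few_not_below_le[OF assms(1)] in simp)
  also have "\<dots> = real k" using p by simp
  finally show "avg W (labels NN) (\<lambda>f. of_bool (card {v \<in> W - {u}. f v \<ge> f u} < k)) \<le> real k / real (card W)"
    using cW by (simp add: le_divide_eq mult.commute)
qed

lemma thr_dep_on: "dep_on (insert u Z) (\<lambda>f. of_bool (P (thr NN \<tau> f Z u)))"
  unfolding dep_on_def thr_def
  by (intro allI impI arg_cong[where f="\<lambda>x. of_bool (P (card x))"]) auto

text \<open>
Reflecting the label of \<open>u\<close> turns its threshold degree into its rank among the labels of
\<open>insert u Z\<close>. The error term is the probability of a tie.
\<close>

lemma avg_thr: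
  assumes "finite A" "insert u Z \<subseteq> A" "u \<notin> Z" "NN > 0" "\<tau> \<le> 1" "k \<le> card Z + 1"
  shows "\<bar>avg A (labels NN) (\<lambda>f. of_bool (thr NN \<tau> f Z u < k)) - real k / (real (card Z) + 1)\<bar> \<le> real (card Z) / real NN"
proof -
  define W where "W = insert u Z"
  have finZ: "finite Z" using assms by (auto intro: finite_subset)
  have finW: "finite W" and uW: "u \<in> W" and cW: "card W = card Z + 1"
    using finZ assms by (auto simp: W_def)
  have p: "proper W (labels NN)" using finW assms proper_labels by blast
  have Zeq: "Z = W - {u}" using assms by (auto simp: W_def)
  let ?S = "avg W (labels NN) (\<lambda>f. of_bool (card {v \<in> W. f v > f u} < k))"
  let ?G = "avg W (labels NN) (\<lambda>f. of_bool (card {v \<in> W - {u}. f v \<ge> f u} < k))"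
  let ?T = "avg W (labels NN) (\<lambda>f. of_bool (thr NN \<tau> f Z u < k))"
  have T: "avg A (labels NN) (\<lambda>f. of_bool (thr NN \<tau> f Z u < k)) = ?T"
    unfolding W_def by (rule avg_local) (use assms in \<open>auto intro: proper_labels thr_dep_on\<close>)
  define R where "R = (\<lambda>f::'a\<Rightarrow>nat. {v \<in> Z. f v + \<tau> \<ge> f u + 1})"
  \<comment> \<open>by reflecting the label of u, R f is the set of neighbours counted by the threshold rule\<close>
  have T2: "?T = avg W (labels NN) (\<lambda>f. of_bool (card (R f) < k))"
  proof -
    have "?T = avg W (labels NN) (\<lambda>f. of_bool (thr NN \<tau> (f(u := NN - 1 - f u)) Z u < k))"
      by (rule avg_reflect_at[OF finW uW, symmetric])
    also have "\<dots> = avg W (labels NN) (\<lambda>f. of_bool (card (R f) < k))"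
    proof (rule avg_cong)
      fix f assume "f \<in> Pi\<^sub>E W (labels NN)"
      hence "f u < NN" using uW by auto
      hence "{w \<in> Z. NN \<le> (f(u := NN - 1 - f u)) w + (f(u := NN - 1 - f u)) u + \<tau>} = R f"
        using assms(3) by (auto simp: R_def)
      thus "of_bool (thr NN \<tau> (f(u := NN - 1 - f u)) Z u < k) = (of_bool (card (R f) < k) :: real)"
        by (simp add: thr_def)
    qed
    finally show ?thesis .
  qed
  have sub1: "{v \<in> W. f v > f u} \<subseteq> R f" for f by (auto simp: R_def W_def)
  have sub2: "R f \<subseteq> {v \<in> W - {u}. f v \<ge> f u}" for f using assms by (auto simp: R_def W_def)
  have fR: "finite (R f)" for f using finZ by (simp add: R_def)
  have c1: "card {v \<in> W. f v > f u} \<le> card (R f)" for f by (rule card_mono[OF fR sub1])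
  have c2: "card (R f) \<le> card {v \<in> W - {u}. f v \<ge> f u}" for f
    by (rule card_mono[OF _ sub2]) (use finW in auto)
  have "?T \<le> ?S" unfolding T2 using c1 by (intro avg_mono) (auto intro: le_less_trans)
  moreover have "?G \<le> ?T" unfolding T2 using c2 by (intro avg_mono) (auto intro: le_less_trans)
  moreover have "?S \<le> ?G + real (card Z) / real NN"
  proof -
    have "?S \<le> avg W (labels NN) (\<lambda>f. of_bool (card {v \<in> W - {u}. f v \<ge> f u} < k) + of_bool (\<exists>w\<in>Z. f w = f u))"
    proof (rule avg_mono)
      fix f :: "'a \<Rightarrow> nat"
      show "of_bool (card {v \<in> W. f v > f u} < k) \<le>
         (of_bool (card {v \<in> W - {u}. f v \<ge> f u} < k) + of_bool (\<exists>w\<in>Z. f w = f u) :: real)"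
      proof (cases "\<exists>w\<in>Z. f w = f u")
        case False
        hence "{v \<in> W - {u}. f v \<ge> f u} = {v \<in> W. f v > f u}" unfolding W_def using le_neq_implies_less by fastforce
        thus ?thesis by simp
      qed simp
    qed
    also have "\<dots> \<le> ?G + (\<Sum>w\<in>Z. avg W (labels NN) (\<lambda>f. of_bool (f w = f u)))"
      unfolding avg_add using avg_union_bound[OF finZ] by (intro add_left_mono)
    also have "(\<Sum>w\<in>Z. avg W (labels NN) (\<lambda>f. of_bool (f w = f u))) = (\<Sum>w\<in>Z. 1 / real NN)"
      by (intro sum.cong refl avg_tie finW assms uW) (use assms in \<open>auto simp: W_def\<close>)
    finally show ?thesis by simp
  qed
  ultimately show ?thesis
    using avg_rank[OF finW assms(4) uW, of k] assms(6) T
    by (simp add: cW abs_le_iff add.commute)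
qed

lemma avg_thr_upper:
  assumes "finite A" "insert u Z \<subseteq> A" "u \<notin> Z" "NN > 0" "\<tau> \<le> 1"
  shows "avg A (labels NN) (\<lambda>f. of_bool (thr NN \<tau> f Z u < k)) \<le> real k / (real (card Z) + 1) + real (card Z) / real NN"
proof (cases "k \<le> card Z + 1")
  case True
  show ?thesis using avg_thr[OF assms True] by linarith
next
  case False
  have "avg A (labels NN) (\<lambda>f. of_bool (thr NN \<tau> f Z u < k)) \<le> 1"
    by (rule avg_le_const[OF proper_labels]) (use assms in auto)
  also have "1 \<le> real k / (real (card Z) + 1)" using False by (simp add: le_divide_eq)
  also have "\<dots> \<le> real k / (real (card Z) + 1) + real (card Z) / real NN" by simp
  finally show ?thesis .
qed

lemma avg_thr_pair:
  assumes "finite A" "insert u Z \<subseteq> A" "u \<notin> Z" "insert u' Z' \<subseteq> A" "u' \<notin> Z'"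
    "insert u Z \<inter> insert u' Z' = {}" "NN > 0" "\<tau> \<le> 1"
  shows "avg A (labels NN) (\<lambda>f. of_bool (thr NN \<tau> f Z u < k \<and> thr NN \<tau> f Z' u' < k)) \<le>
     (real k / (real (card Z) + 1) + real (card Z) / real NN) * (real k / (real (card Z') + 1) + real (card Z') / real NN)"
proof -
  have p: "proper A (labels NN)" using assms proper_labels by blast
  have "avg A (labels NN) (\<lambda>f. of_bool (thr NN \<tau> f Z u < k \<and> thr NN \<tau> f Z' u' < k)) =
        avg A (labels NN) (\<lambda>f. of_bool (thr NN \<tau> f Z u < k) * of_bool (thr NN \<tau> f Z' u' < k))"
    by (rule avg_cong) auto
  also have "\<dots> = avg A (labels NN) (\<lambda>f. of_bool (thr NN \<tau> f Z u < k)) * avg A (labels NN) (\<lambda>f. of_bool (thr NN \<tau> f Z' u' < k))"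
    by (rule avg_indep[OF p assms(2,4,6)]) (rule thr_dep_on)+
  also have "\<dots> \<le> (real k / (real (card Z) + 1) + real (card Z) / real NN) * (real k / (real (card Z') + 1) + real (card Z') / real NN)"
    by (intro mult_mono avg_thr_upper assms avg_nonneg) auto
  finally show ?thesis .
qed

lemma thr_mono: "finite Z' \<Longrightarrow> Z \<subseteq> Z' \<Longrightarrow> thr NN \<tau> f Z u \<le> thr NN \<tau> f Z' u"
  unfolding thr_def by (intro card_mono) auto

section \<open>Pairs of vertices of small threshold degree\<close>

lemma shifted_reciprocal_bound:
  fixes D e :: real
  assumes "0 < D" "0 \<le> e" "e \<le> 3/2 * D"
  shows "1 / (D - e/2) \<le> 1/D * (1 + 2*e/D)"
proof -
  have pos: "D - e/2 > 0" using assms by simp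
  have "D * D \<le> (D + 2*e) * (D - e/2)"
  proof -
    have "e * e \<le> 3/2 * D * e" using assms by (intro mult_right_mono) auto
    thus ?thesis by (simp add: algebra_simps)
  qed
  hence "1 / (D - e/2) \<le> (D + 2*e) / (D*D)"
    using pos assms by (simp add: divide_simps mult.commute)
  also have "\<dots> = 1/D * (1 + 2*e/D)" using assms by (simp add: field_simps)
  finally show ?thesis .
qed

text \<open>
A graph on \<open>A\<close> whose degrees lie between \<open>d/2\<close> and \<open>d\<close>, with so many labels that ties are negligible.
\<close>

locale dense_nbhds =
  fixes A :: "'a set" and N :: "'a \<Rightarrow> 'a set" and d NN :: nat
  assumes finA: "finite A"
    and N_sub: "u \<in> A \<Longrightarrow> N u \<subseteq> A - {u}"
    and N_sym: "u \<in> A \<Longrightarrow> w \<in> N u \<Longrightarrow> u \<in> N w"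
    and deg_le: "u \<in> A \<Longrightarrow> card (N u) \<le> d"
    and deg_ge: "u \<in> A \<Longrightarrow> d \<le> 2 * card (N u)"
    and d8: "d \<ge> 8"
    and NNd: "NN \<ge> d^4"
begin

lemma NN_pos: "NN > 0"
proof -
  have "d^4 > 0" using d8 by simp
  thus ?thesis using NNd by linarith
qed

lemma pA: "proper A (labels NN)"
  using finA NN_pos by (rule proper_labels)

lemma finN: "u \<in> A \<Longrightarrow> finite (N u)"
  using finA N_sub finite_subset by (metis Diff_subset)

lemma deg_real: "u \<in> A \<Longrightarrow> real (card (N u)) \<le> real d \<and> real d \<le> 2 * real (card (N u))"
  using deg_le[of u] deg_ge[of u] by linarith

lemma tie_small: "real z \<le> real d \<Longrightarrow> real z / real NN \<le> 1 / real d^3"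
proof -
  assume z: "real z \<le> real d"
  have "real z * real d^3 \<le> real d * real d^3" using z by (intro mult_right_mono) auto
  also have "\<dots> = real (d^4)" by (simp add: power_numeral_reduce)
  also have "\<dots> \<le> real NN" using NNd by (simp only: of_nat_le_iff)
  finally show ?thesis using NN_pos d8 by (simp add: field_simps)
qed

text \<open>
A threshold degree can only decrease when neighbours are ignored. Distributing the common
neighbours of \<open>u\<close> and \<open>u'\<close> evenly between the two vertices makes the two events independent, and
costs a relative error proportional to the codegree. The bound is therefore nontrivial even for
twins, and it is close to the product for a typical pair.
\<close>

lemma joint_low:
  assumes u: "u \<in> A" "u' \<in> A" "u \<noteq> u'" and \<tau>: "\<tau> \<le> 1" and k: "k \<ge> 1"
  shows "avg A (labels NN) (\<lambda>f. of_bool (thr NN \<tau> f (N u) u < k \<and> thr NN \<tau> f (N u') u' < k))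
    \<le> (real k / card (N u)) * (real k / card (N u')) + 180 * real k^2 * (real (card (N u \<inter> N u')) + 1) / real d^3"
proof -
  define c where "c = card (N u \<inter> N u')"
  have "c div 2 \<le> card (N u \<inter> N u')" by (simp add: c_def)
  then obtain H where H: "H \<subseteq> N u \<inter> N u'" "card H = c div 2"
    by (rule obtain_subset_with_card_n) blast
  \<comment> \<open>u gives up the half H of the common neighbours, u' gives up the other half\<close>
  define Z where "Z = N u - {u'} - H"
  define Z' where "Z' = N u' - {u} - (N u \<inter> N u' - H)"
  have fZ: "finite Z" "finite Z'" using finN u by (auto simp: Z_def Z'_def)
  have fH: "finite H" by (rule finite_subset[OF H(1)]) (use finN u in auto)
  have sub: "insert u Z \<subseteq> A" "insert u' Z' \<subseteq> A" using N_sub u by (auto simp: Z_def Z'_def)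
  have notin: "u \<notin> Z" "u' \<notin> Z'" using N_sub u by (auto simp: Z_def Z'_def)
  have disj: "insert u Z \<inter> insert u' Z' = {}" using u notin by (auto simp: Z_def Z'_def)
  have "avg A (labels NN) (\<lambda>f. of_bool (thr NN \<tau> f (N u) u < k \<and> thr NN \<tau> f (N u') u' < k))
      \<le> avg A (labels NN) (\<lambda>f. of_bool (thr NN \<tau> f Z u < k \<and> thr NN \<tau> f Z' u' < k))"
  proof (rule avg_mono)
    fix f :: "'a \<Rightarrow> nat"
    have "thr NN \<tau> f Z u \<le> thr NN \<tau> f (N u) u" "thr NN \<tau> f Z' u' \<le> thr NN \<tau> f (N u') u'"
      by (rule thr_mono; use finN u in \<open>auto simp: Z_def Z'_def\<close>)+
    thus "of_bool (thr NN \<tau> f (N u) u < k \<and> thr NN \<tau> f (N u') u' < k)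
       \<le> (of_bool (thr NN \<tau> f Z u < k \<and> thr NN \<tau> f Z' u' < k) :: real)" by auto
  qed
  also have "\<dots> \<le> (real k / (real (card Z) + 1) + real (card Z) / real NN) * (real k / (real (card Z') + 1) + real (card Z') / real NN)"
    by (rule avg_thr_pair[OF finA sub(1) notin(1) sub(2) notin(2) disj NN_pos \<tau>])
  also have "\<dots> \<le> (real k / card (N u)) * (real k / card (N u')) + 180 * real k^2 * (real c + 1) / real d^3"
  proof -
    define D where "D = real (card (N u))"
    define D' where "D' = real (card (N u'))"
    define e where "e = real c + 1"
    define dd where "dd = real d"
    define a where "a = real k / (real (card Z) + 1)"
    define a' where "a' = real k / (real (card Z') + 1)"
    define r where "r = e / dd"
    have dd8: "dd \<ge> 8" using d8 by (simp add: dd_def)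
    have Dd: "D \<le> dd" "D' \<le> dd" "dd \<le> 2 * D" "dd \<le> 2 * D'"
      using deg_real u by (auto simp: D_def D'_def dd_def)
    have cD: "c \<le> card (N u)" "c \<le> card (N u')" unfolding c_def by (intro card_mono finN u; blast)+
    have eD: "1 \<le> e" "e \<le> 3/2 * D" "e \<le> 3/2 * D'" using cD Dd dd8 by (auto simp: e_def D_def D'_def)
    have "card (N u) \<le> card (Z \<union> {u'} \<union> H)" by (rule card_mono) (use fZ fH in \<open>auto simp: Z_def\<close>)
    also have "\<dots> \<le> card Z + 1 + c div 2"
      using card_Un_le[of "Z \<union> {u'}" H] card_Un_le[of Z "{u'}"] H(2) by simp
    finally have zD: "D - e/2 \<le> real (card Z) + 1"
      unfolding D_def e_def by (simp add: field_simps)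
    have "card (N u') \<le> card (Z' \<union> {u} \<union> (N u \<inter> N u' - H))" by (rule card_mono) (use fZ finN u in \<open>auto simp: Z'_def\<close>)
    also have "\<dots> \<le> card Z' + 1 + (c - c div 2)"
      using card_Un_le[of "Z' \<union> {u}" "N u \<inter> N u' - H"] card_Un_le[of Z' "{u}"]
        card_Diff_subset[OF fH H(1)] H(2) by (simp add: c_def)
    finally have zD': "D' - e/2 \<le> real (card Z') + 1"
      unfolding D'_def e_def by (simp add: field_simps)
    have bnd: "real k / z \<le> real k / E * (1 + 4*r) \<and> real k / z \<le> 8 * real k / dd"
      if "E - e/2 \<le> z" "e \<le> 3/2 * E" "dd \<le> 2 * E" for z E
    proof -
      have E: "E > 0" using that dd8 by linarith
      have pz: "E - e/2 > 0" using that E by linarith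
      have "1/z \<le> 1/(E - e/2)" using that pz by (intro divide_left_mono mult_pos_pos) auto
      also have "\<dots> \<le> 1/E * (1 + 2*e/E)" by (rule shifted_reciprocal_bound) (use E that eD in auto)
      also have "\<dots> \<le> 1/E * (1 + 4*r)"
      proof -
        have "2 * e / E \<le> 2 * e / (dd/2)" using that eD dd8 E by (intro divide_left_mono) auto
        thus ?thesis using E by (intro mult_left_mono) (auto simp: r_def)
      qed
      finally have 1: "1/z \<le> 1/E * (1 + 4*r)" .
      have "dd/8 \<le> z" using that by linarith
      hence "1/z \<le> 1/(dd/8)" using dd8 by (intro divide_left_mono mult_pos_pos) auto
      hence 2: "1/z \<le> 8/dd" by simp
      show ?thesis using mult_left_mono[OF 1, of "real k"] mult_left_mono[OF 2, of "real k"] by (simp add: mult.commute)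
    qed
    have A1: "a \<le> real k / D * (1 + 4*r)" "a \<le> 8 * real k / dd" using bnd[OF zD eD(2) Dd(3)] by (auto simp: a_def)
    have A2: "a' \<le> real k / D' * (1 + 4*r)" "a' \<le> 8 * real k / dd" using bnd[OF zD' eD(3) Dd(4)] by (auto simp: a'_def)
    have nn: "a \<ge> 0" "a' \<ge> 0" "r \<ge> 0" "D > 0" "D' > 0" using Dd dd8 eD by (auto simp: a_def a'_def r_def)
    have r2: "r \<le> 2" using eD Dd dd8 by (simp add: r_def divide_le_eq)
    define t where "t = 1 / dd^3"
    have t01: "0 \<le> t" "t \<le> 1" using dd8 by (auto simp: t_def)
    have zle: "card Z \<le> card (N u)" "card Z' \<le> card (N u')" by (intro card_mono finN u; auto simp: Z_def Z'_def)+
    have t1: "real (card Z) / real NN \<le> t" unfolding t_def dd_def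
      by (rule tie_small) (use zle deg_le[OF u(1)] in simp)
    have t2: "real (card Z') / real NN \<le> t" unfolding t_def dd_def
      by (rule tie_small) (use zle deg_le[OF u(2)] in simp)
    have k1: "real k \<ge> 1" using k by simp
    have "(a + real (card Z) / real NN) * (a' + real (card Z') / real NN) \<le> (a + t) * (a' + t)"
      using t1 t2 nn t01 by (intro mult_mono) auto
    also have "\<dots> = a * a' + (a + a') * t + t * t" by (simp add: algebra_simps)
    also have "a * a' \<le> (real k / D * (1 + 4*r)) * (real k / D' * (1 + 4*r))"
      by (intro mult_mono A1 A2) (use nn in auto)
    also have "\<dots> = real k / D * (real k / D') * (1 + 4*r)^2" by (simp add: power2_eq_square)
    also have "\<dots> \<le> real k / D * (real k / D') * (1 + 40*r)"
    proof (intro mult_left_mono)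
      have "r * r \<le> 2 * r" using nn r2 by (intro mult_right_mono) auto
      thus "(1 + 4*r)^2 \<le> 1 + 40*r" by (simp add: power2_eq_square algebra_simps)
    qed (use nn in auto)
    also have "\<dots> = real k / D * (real k / D') + real k / D * (real k / D') * (40*r)" by (simp add: algebra_simps)
    also have "real k / D * (real k / D') * (40*r) \<le> (2 * real k / dd) * (2 * real k / dd) * (40*r)"
    proof (intro mult_right_mono mult_mono)
      show "real k / D \<le> 2 * real k / dd" "real k / D' \<le> 2 * real k / dd"
        using Dd dd8 nn mult_left_mono[OF Dd(3), of "real k"] mult_left_mono[OF Dd(4), of "real k"]
        by (auto simp: field_simps)
    qed (use nn dd8 in auto)
    also have "\<dots> = 160 * real k^2 * e / dd^3" by (simp add: r_def power2_eq_square power3_eq_cube)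
    also have "(a + a') * t \<le> (16 * real k) * t"
    proof -
      have "8 * real k / dd \<le> 8 * real k" using dd8 k1 by (simp add: divide_le_eq)
      thus ?thesis using A1 A2 t01 by (intro mult_right_mono) auto
    qed
    also have "(16 * real k) * t \<le> 16 * real k^2 * e / dd^3"
    proof -
      have "real k * 1 \<le> real k * (real k * e)" using k1 eD mult_mono[of 1 "real k" 1 e] by (intro mult_left_mono) auto
      thus ?thesis using dd8 by (auto simp: t_def power2_eq_square divide_right_mono)
    qed
    also have "t * t \<le> 1 * real k^2 * e / dd^3"
    proof -
      have "t * t \<le> 1 * t" using t01 by (intro mult_right_mono) auto
      moreover have "1 \<le> real k^2 * e" using mult_mono[of 1 "real k^2" 1 e] k1 eD by auto
      hence "1 * t \<le> (real k^2 * e) * t" using t01 by (intro mult_right_mono) auto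
      ultimately show ?thesis by (simp add: t_def)
    qed
    finally have F: "(a + real (card Z) / real NN) * (a' + real (card Z') / real NN)
       \<le> real k / D * (real k / D') + 160 * real k^2 * e / dd^3 + 16 * real k^2 * e / dd^3 + 1 * real k^2 * e / dd^3"
      by linarith
    have "0 \<le> real k^2 * e / dd^3" using eD dd8 by simp
    hence "160 * real k^2 * e / dd^3 + 16 * real k^2 * e / dd^3 + 1 * real k^2 * e / dd^3 \<le> 180 * real k^2 * e / dd^3"
      by (simp add: mult.assoc flip: times_divide_eq_right)
    with F show ?thesis unfolding a_def a'_def D_def D'_def e_def dd_def by linarith
  qed
  finally show ?thesis by (simp add: c_def)
qed

lemma sum_codegree: "(\<Sum>u\<in>A. \<Sum>u'\<in>A. card (N u \<inter> N u')) \<le> card A * d^2"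
proof -
  have "(\<Sum>u'\<in>A. card (N u \<inter> N u')) \<le> d^2" if u: "u \<in> A" for u
  proof -
    have "(\<Sum>u'\<in>A. card (N u \<inter> N u')) = (\<Sum>u'\<in>A. \<Sum>w\<in>N u. of_bool (w \<in> N u'))"
      by (intro sum.cong refl) (use finN[OF u] in \<open>simp add: Int_def\<close>)
    also have "\<dots> = (\<Sum>w\<in>N u. \<Sum>u'\<in>A. of_bool (w \<in> N u'))" by (rule sum.swap)
    also have "\<dots> \<le> (\<Sum>w\<in>N u. d)"
    proof (rule sum_mono)
      fix w assume w: "w \<in> N u"
      hence wA: "w \<in> A" using N_sub[OF u] by auto
      have "(\<Sum>u'\<in>A. of_bool (w \<in> N u')) = card {u'\<in>A. w \<in> N u'}" using finA by (simp add: Int_def)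
      also have "\<dots> \<le> card (N w)" by (intro card_mono finN wA) (use N_sym in auto)
      also have "\<dots> \<le> d" using deg_le wA by blast
      finally show "(\<Sum>u'\<in>A. of_bool (w \<in> N u')) \<le> d" .
    qed
    also have "\<dots> \<le> d^2" using deg_le[OF u] by (simp add: power2_eq_square)
    finally show ?thesis .
  qed
  hence "(\<Sum>u\<in>A. \<Sum>u'\<in>A. card (N u \<inter> N u')) \<le> (\<Sum>u\<in>A. d^2)" by (intro sum_mono)
  thus ?thesis by simp
qed

text \<open>
By \<open>joint_low\<close> the covariances are bounded by codegrees, whose sum over all pairs is at most
\<open>|A| d\<^sup>2\<close>. The outcome is a relative variance of order \<open>d/|A| + 1/d\<close>.
\<close>

lemma second_moment_low:
  assumes \<tau>: "\<tau> \<le> 1" and k: "1 \<le> k" "2 * k \<le> d"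
  defines "X \<equiv> \<lambda>f. (\<Sum>u\<in>A. of_bool (thr NN \<tau> f (N u) u < k) :: real)"
  defines "m \<equiv> (\<Sum>u\<in>A. real k / real (card (N u)))"
  shows "avg A (labels NN) (\<lambda>f. (X f - m)^2)
     \<le> 183 * real k^2 * real (card A) / real d + 200 * real k^2 * real (card A)^2 / real d^3"
proof -
  define a where "a = real (card A)"
  define dd where "dd = real d"
  define p where "p = (\<lambda>u. avg A (labels NN) (\<lambda>f. of_bool (thr NN \<tau> f (N u) u < k)))"
  define K where "K = real k"
  have dd8: "dd \<ge> 8" and K1: "K \<ge> 1" and Kd: "2 * K \<le> dd" and a0: "a \<ge> 0"
    using d8 k by (simp_all add: dd_def K_def a_def)
  have D: "D \<le> dd" "dd \<le> 2 * D" "D > 0" if "u \<in> A" "D = real (card (N u))" for u D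
    using deg_real[OF that(1)] that(2) d8 by (auto simp: dd_def)
  have pbounds: "p u \<le> K / card (N u) + 1/dd^3 \<and> p u \<ge> K / card (N u) - 5 * K / dd^2" if u: "u \<in> A" for u
  proof -
    define D where "D = real (card (N u))"
    note Du = D[OF u D_def]
    have kD: "k \<le> card (N u) + 1" using k deg_ge[OF u] by linarith
    have "\<bar>p u - K / (D + 1)\<bar> \<le> real (card (N u)) / real NN"
      unfolding p_def K_def D_def
      by (rule avg_thr) (use finA N_sub[OF u] u NN_pos \<tau> kD in auto)
    also have "\<dots> \<le> 1/dd^3" unfolding dd_def by (rule tie_small) (use deg_le[OF u] in simp)
    finally have 1: "\<bar>p u - K / (D + 1)\<bar> \<le> 1/dd^3" .
    have "K / (D+1) \<le> K / D" using Du K1 by (intro divide_left_mono) auto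
    moreover have "K / D - K / (D+1) \<le> 4 * K / dd^2"
    proof -
      have "dd^2 \<le> 4 * (D * (D+1))"
      proof -
        have "dd * dd \<le> (2*D) * (2*D)" using Du dd8 by (intro mult_mono) auto
        thus ?thesis using Du by (simp add: power2_eq_square algebra_simps)
      qed
      have "K / D - K / (D+1) = K / (D * (D+1))" using Du by (simp add: field_simps)
      also have "\<dots> = 4 * K / (4 * (D * (D+1)))" by simp
      also have "\<dots> \<le> 4 * K / dd^2" using \<open>dd^2 \<le> _\<close> K1 dd8 Du by (intro divide_left_mono) auto
      finally show ?thesis .
    qed
    moreover have "1/dd^3 \<le> K / dd^2"
    proof -
      have "1/dd^3 \<le> 1/dd^2" using dd8 by (intro divide_left_mono power_increasing) auto
      also have "\<dots> \<le> K / dd^2" using K1 by (intro divide_right_mono) auto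
      finally show ?thesis .
    qed
    ultimately show ?thesis using 1 unfolding D_def[symmetric] by (simp add: abs_le_iff)
  qed
  have EX: "avg A (labels NN) X = (\<Sum>u\<in>A. p u)" unfolding X_def avg_sum p_def ..
  have term_le: "K / card (N u) \<le> 2 * K / dd" if "u \<in> A" for u
  proof -
    note Du = D[OF that refl]
    have "K / card (N u) = 2 * K / (2 * card (N u))" by simp
    also have "\<dots> \<le> 2 * K / dd" using Du dd8 K1 by (intro divide_left_mono) auto
    finally show ?thesis .
  qed
  have m_le: "m \<le> 2 * K * a / dd"
  proof -
    have "m \<le> (\<Sum>u\<in>A. 2 * K / dd)" unfolding m_def K_def[symmetric] by (intro sum_mono term_le)
    thus ?thesis by (simp add: a_def mult.commute)
  qed
  have m0: "m \<ge> 0" unfolding m_def by (intro sum_nonneg) auto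
  have small: "1/dd^3 \<le> K / dd"
  proof -
    have "1/dd^3 \<le> 1/dd" using dd8 self_le_power[of dd 3] by (intro divide_left_mono) auto
    also have "\<dots> \<le> K / dd" using K1 dd8 by (intro divide_right_mono) auto
    finally show ?thesis .
  qed
  have EX_le: "avg A (labels NN) X \<le> 3 * K * a / dd"
  proof -
    have "p u \<le> 3 * K / dd" if "u \<in> A" for u
    proof -
      have "p u \<le> 2 * K / dd + K / dd" using pbounds[OF that] term_le[OF that] small by linarith
      thus ?thesis by (simp add: field_simps)
    qed
    hence "(\<Sum>u\<in>A. p u) \<le> (\<Sum>u\<in>A. 3 * K / dd)" by (intro sum_mono)
    thus ?thesis by (simp add: EX a_def mult.commute)
  qed
  have EX_ge: "avg A (labels NN) X \<ge> m - 5 * K * a / dd^2"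
  proof -
    have "m - 5 * K * a / dd^2 = (\<Sum>u\<in>A. K / card (N u) - 5 * K / dd^2)"
      unfolding m_def K_def[symmetric] sum_subtractf by (simp add: a_def mult.commute)
    also have "\<dots> \<le> (\<Sum>u\<in>A. p u)" by (intro sum_mono) (use pbounds in auto)
    finally show ?thesis by (simp add: EX)
  qed
  have XX: "X f * X f = X f + (\<Sum>u\<in>A. \<Sum>u'\<in>A-{u}. of_bool (thr NN \<tau> f (N u) u < k \<and> thr NN \<tau> f (N u') u' < k))" for f
  proof -
    have "X f * X f = (\<Sum>u\<in>A. \<Sum>u'\<in>A. of_bool (thr NN \<tau> f (N u) u < k) * of_bool (thr NN \<tau> f (N u') u' < k))"
      unfolding X_def by (rule sum_product)
    also have "\<dots> = (\<Sum>u\<in>A. of_bool (thr NN \<tau> f (N u) u < k) + (\<Sum>u'\<in>A-{u}. of_bool (thr NN \<tau> f (N u) u < k \<and> thr NN \<tau> f (N u') u' < k)))"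
      by (intro sum.cong refl, subst sum.remove[OF finA], assumption) (auto intro!: sum.cong)
    finally show ?thesis unfolding sum.distrib X_def .
  qed
  have EXX: "avg A (labels NN) (\<lambda>f. X f * X f) \<le> 3 * K * a / dd + m * m + 180 * K^2 * (a / dd + a^2 / dd^3)"
  proof -
    have "avg A (labels NN) (\<lambda>f. X f * X f) = avg A (labels NN) X +
       (\<Sum>u\<in>A. \<Sum>u'\<in>A-{u}. avg A (labels NN) (\<lambda>f. of_bool (thr NN \<tau> f (N u) u < k \<and> thr NN \<tau> f (N u') u' < k)))"
      unfolding XX avg_add avg_sum ..
    also have "(\<Sum>u\<in>A. \<Sum>u'\<in>A-{u}. avg A (labels NN) (\<lambda>f. of_bool (thr NN \<tau> f (N u) u < k \<and> thr NN \<tau> f (N u') u' < k)))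
       \<le> (\<Sum>u\<in>A. \<Sum>u'\<in>A-{u}. (K / card (N u)) * (K / card (N u')) + 180 * K^2 * (real (card (N u \<inter> N u')) + 1) / dd^3)"
      unfolding K_def dd_def by (intro sum_mono joint_low) (use \<tau> k in auto)
    also have "\<dots> \<le> (\<Sum>u\<in>A. \<Sum>u'\<in>A. (K / card (N u)) * (K / card (N u')) + 180 * K^2 * (real (card (N u \<inter> N u')) + 1) / dd^3)"
      by (intro sum_mono sum_mono2 finA add_nonneg_nonneg) (use K1 dd8 in auto)
    also have "\<dots> = m * m + 180 * K^2 / dd^3 * (real (\<Sum>u\<in>A. \<Sum>u'\<in>A. card (N u \<inter> N u')) + a^2)"
      unfolding sum.distrib m_def K_def[symmetric] sum_product
      by (simp add: sum.distrib sum_distrib_left[symmetric] sum_divide_distrib[symmetric] a_def power2_eq_square)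
    also have "\<dots> \<le> m * m + 180 * K^2 / dd^3 * (a * dd^2 + a^2)"
    proof -
      have "real (\<Sum>u\<in>A. \<Sum>u'\<in>A. card (N u \<inter> N u')) \<le> real (card A * d^2)"
        using sum_codegree by (simp only: of_nat_le_iff)
      also have "\<dots> = a * dd^2" by (simp add: a_def dd_def)
      finally show ?thesis using dd8 by (intro add_left_mono mult_left_mono add_right_mono) auto
    qed
    also have "\<dots> = m * m + 180 * K^2 * (a / dd + a^2 / dd^3)"
      using dd8 by (simp add: power2_eq_square power3_eq_cube field_simps)
    finally show ?thesis using EX_le by linarith
  qed
  have "avg A (labels NN) (\<lambda>f. (X f - m)^2) = avg A (labels NN) (\<lambda>f. X f * X f + (m * m - (2 * m) * X f))"
    by (rule avg_cong) (simp add: power2_eq_square algebra_simps)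
  also have "\<dots> = avg A (labels NN) (\<lambda>f. X f * X f) + (m * m - 2 * m * avg A (labels NN) X)"
    unfolding avg_add avg_diff avg_cmult using pA by simp
  also have "\<dots> \<le> 3 * K * a / dd + 180 * K^2 * (a / dd + a^2 / dd^3) + 20 * K^2 * a^2 / dd^3"
  proof -
    have "2 * m * (m - 5 * K * a / dd^2) \<le> 2 * m * avg A (labels NN) X"
      using EX_ge m0 by (intro mult_left_mono) auto
    moreover have "2 * m * (5 * K * a / dd^2) \<le> 2 * (2 * K * a / dd) * (5 * K * a / dd^2)"
      using m_le K1 a0 by (intro mult_right_mono mult_left_mono) auto
    moreover have "2 * (2 * K * a / dd) * (5 * K * a / dd^2) = 20 * K^2 * a^2 / dd^3"
      by (simp add: power2_eq_square power3_eq_cube algebra_simps)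
    moreover have "2 * m * (m - 5 * K * a / dd^2) = 2 * (m * m) - 2 * m * (5 * K * a / dd^2)"
      by (simp only: right_diff_distrib mult.assoc)
    moreover have "180 * K^2 * (a / dd + a^2 / dd^3) \<ge> 0" using a0 dd8 by simp
    ultimately show ?thesis using EXX by linarith
  qed
  also have "\<dots> \<le> 183 * K^2 * a / dd + 200 * K^2 * a^2 / dd^3"
  proof -
    have "3 * K * a / dd \<le> 3 * K^2 * a / dd"
      using K1 a0 dd8 self_le_power[of K 2] by (intro divide_right_mono mult_right_mono mult_left_mono) auto
    moreover have "180 * K^2 * (a / dd + a^2 / dd^3) = 180 * K^2 * a / dd + 180 * K^2 * a^2 / dd^3"
      by (simp add: distrib_left)
    moreover have "3 * K^2 * a / dd + 180 * K^2 * a / dd = 183 * K^2 * a / dd"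
      "180 * K^2 * a^2 / dd^3 + 20 * K^2 * a^2 / dd^3 = 200 * K^2 * a^2 / dd^3"
      by (simp_all add: add_divide_distrib[symmetric])
    ultimately show ?thesis by linarith
  qed
  finally show ?thesis by (simp add: K_def a_def dd_def)
qed

end

section \<open>Cumulative counts of threshold degrees\<close>

lemma exp_sq_bound: "0 \<le> (x::real) \<Longrightarrow> x \<le> 1 \<Longrightarrow> exp x - 1 \<le> x + x^2"
  using exp_bound[of x] by simp

lemma sum_powers_tail:
  fixes r :: real
  assumes "0 \<le> r" "r < 1"
  shows "(\<Sum>k\<in>{K..n}. r ^ k) \<le> r ^ K / (1 - r)"
proof (cases "K \<le> n")
  case True
  have "(\<Sum>k\<in>{K..n}. r ^ k) = (r ^ K - r ^ Suc n) / (1 - r)"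
    using sum_gp[of r K n] assms True by simp
  also have "\<dots> \<le> r ^ K / (1 - r)" using assms by (intro divide_right_mono) auto
  finally show ?thesis .
next
  case False
  thus ?thesis using assms by simp
qed

lemma card_less_real_bounds:
  fixes y :: real
  assumes "0 \<le> y" "y \<le> real n"
  shows "real (card {c \<in> {..<n}. real c < y}) \<ge> y" "real (card {c \<in> {..<n}. real c < y}) \<le> y + 1"
proof -
  define m where "m = nat \<lceil>y\<rceil>"
  have m: "y \<le> real m" "real m < y + 1" using assms by (auto simp: m_def) linarith+
  have "{c \<in> {..<n}. real c < y} = {..<m}"
  proof safe
    fix c assume "c < n" "real c < y"
    thus "c < m" using m by linarith
  next
    fix c assume "c < m"
    hence "int c < \<lceil>y\<rceil>" by (simp add: m_def zless_nat_conj)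
    hence c: "real c < y" by (simp add: less_ceiling_iff)
    thus "real c < y" .
    show "c < n" using c assms by linarith
  qed
  thus "real (card {c \<in> {..<n}. real c < y}) \<ge> y" "real (card {c \<in> {..<n}. real c < y}) \<le> y + 1"
    using m by auto
qed

context dense_nbhds
begin

text \<open>
Conditioned on the label \<open>c\<close> of \<open>u\<close>, the threshold degree is a sum of independent indicators with
mean at most \<open>(1 - \<eta>/8) k\<close>.
\<close>

lemma high_given_label:
  fixes \<eta> :: real
  assumes u: "u \<in> A" and \<tau>: "\<tau> \<le> 1" and \<eta>: "0 < \<eta>" "\<eta> \<le> 1" and k: "8 \<le> \<eta> * real k"
    and c: "c < NN" "real c * real d < (1 - \<eta>/4) * real k * real NN"
  shows "avg A (labels NN) (\<lambda>f. of_bool (f u = c \<and> k \<le> thr NN \<tau> f (N u) u)) \<le> exp (- (real k * \<eta>^2) / 256) / real NN"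
proof -
  let ?Q = "\<lambda>w x. NN \<le> x + c + \<tau>"
  have fq: "freq (labels NN) ?Q w \<le> (real c + 1) / real NN" for w :: 'a
  proof -
    have "{x \<in> {..<NN}. NN \<le> x + c + \<tau>} \<subseteq> {NN - (c+1)..<NN}" using \<tau> by auto
    hence "card {x \<in> {..<NN}. NN \<le> x + c + \<tau>} \<le> card {NN - (c+1)..<NN}" by (intro card_mono) auto
    also have "\<dots> \<le> c + 1" by simp
    finally have "real (card {x \<in> {..<NN}. NN \<le> x + c + \<tau>}) \<le> real c + 1" by simp
    thus ?thesis unfolding freq_def by (simp add: divide_right_mono)
  qed
  have "(\<Sum>w\<in>N u. freq (labels NN) ?Q w) \<le> real (card (N u)) * ((real c + 1) / real NN)"
    using sum_bounded_above[of "N u" "freq (labels NN) ?Q" "(real c + 1) / real NN"] fq by simp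
  also have "\<dots> \<le> real d * ((real c + 1) / real NN)"
    using deg_real[OF u] by (intro mult_right_mono) auto
  also have "\<dots> = real c * real d / real NN + real d / real NN" by (simp add: add_divide_distrib algebra_simps)
  also have "\<dots> \<le> (1 - \<eta>/4) * real k + 1"
  proof (intro add_mono)
    show "real c * real d / real NN \<le> (1 - \<eta>/4) * real k" using c NN_pos by (simp add: divide_le_eq)
    have "1 / real d^3 \<le> 1" using d8 by simp
    thus "real d / real NN \<le> 1" using tie_small[of d] by simp
  qed
  also have "\<dots> \<le> (1 - \<eta>/8) * real k" using k by (simp add: algebra_simps)
  finally have sumf: "(\<Sum>w\<in>N u. freq (labels NN) ?Q w) \<le> (1 - \<eta>/8) * real k" .
  \<comment> \<open>the minimum of the exponent - \<eta>/8 * \<theta> + \<theta>^2 below\<close>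
  define \<theta> where "\<theta> = \<eta>/16"
  have \<theta>: "0 \<le> \<theta>" "\<theta> \<le> 1" using \<eta> by (auto simp: \<theta>_def)
  have Nu: "N u \<subseteq> A" "u \<notin> N u" using N_sub[OF u] by auto
  have "avg A (labels NN) (\<lambda>f. of_bool (f u = c \<and> k \<le> thr NN \<tau> f (N u) u)) =
        avg A (labels NN) (\<lambda>f. of_bool (f u = c) * of_bool ((\<Sum>w\<in>N u. of_bool (?Q w (f w))) \<ge> real k))"
  proof (rule avg_cong)
    fix f :: "'a \<Rightarrow> nat"
    have "(\<Sum>w\<in>N u. of_bool (?Q w (f w)) :: real) = real (thr NN \<tau> f (N u) u)" if "f u = c"
      unfolding thr_def using finN[OF u] that by (simp add: Int_def)
    thus "of_bool (f u = c \<and> k \<le> thr NN \<tau> f (N u) u) =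
        of_bool (f u = c) * (of_bool ((\<Sum>w\<in>N u. of_bool (?Q w (f w))) \<ge> real k) :: real)" by auto
  qed
  also have "\<dots> = avg A (labels NN) (\<lambda>f. of_bool (f u = c)) * avg A (labels NN) (\<lambda>f. of_bool ((\<Sum>w\<in>N u. of_bool (?Q w (f w))) \<ge> real k))"
  proof (rule avg_indep[OF pA, of "{u}" "N u"])
    show "dep_on (N u) (\<lambda>f. of_bool ((\<Sum>w\<in>N u. of_bool (?Q w (f w))) \<ge> real k) :: real)"
      unfolding dep_on_def
    proof (intro allI impI)
      fix f g :: "'a \<Rightarrow> nat" assume "\<forall>a\<in>N u. f a = g a"
      hence "(\<Sum>w\<in>N u. of_bool (?Q w (f w)) :: real) = (\<Sum>w\<in>N u. of_bool (?Q w (g w)))"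
        by (intro sum.cong) auto
      thus "(of_bool ((\<Sum>w\<in>N u. of_bool (?Q w (f w))) \<ge> real k) :: real) = of_bool ((\<Sum>w\<in>N u. of_bool (?Q w (g w))) \<ge> real k)"
        by simp
    qed
  qed (use u Nu in \<open>auto simp: dep_on_def\<close>)
  also have "avg A (labels NN) (\<lambda>f. of_bool (f u = c)) = 1 / real NN"
  proof -
    have "avg A (labels NN) (\<lambda>f. of_bool (f u = c)) = freq (labels NN) (\<lambda>a x. x = c) u"
      by (rule avg_coord_freq[OF pA u, of "\<lambda>a x. x = c"])
    moreover have "{x \<in> {..<NN}. x = c} = {c}" using c by auto
    ultimately show ?thesis by (simp add: freq_def)
  qed
  also have "avg A (labels NN) (\<lambda>f. of_bool ((\<Sum>w\<in>N u. of_bool (?Q w (f w))) \<ge> real k))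
       \<le> exp (- \<theta> * real k + (exp \<theta> - 1) * ((1 - \<eta>/8) * real k))"
    by (rule count_upper_tail[OF pA Nu(1) \<theta>(1) sumf])
  also have "\<dots> \<le> exp (- (real k * \<eta>^2) / 256)"
  proof -
    have "(exp \<theta> - 1) * ((1 - \<eta>/8) * real k) \<le> (\<theta> + \<theta>^2) * ((1 - \<eta>/8) * real k)"
      using exp_sq_bound[OF \<theta>] \<eta> by (intro mult_right_mono) auto
    also have "\<dots> = \<theta> * real k - \<eta>/8 * \<theta> * real k + \<theta>^2 * real k - \<eta>/8 * \<theta>^2 * real k"
      by (simp add: algebra_simps)
    also have "\<dots> \<le> \<theta> * real k - \<eta>/8 * \<theta> * real k + \<theta>^2 * real k" using \<eta> by simp
    finally have "- \<theta> * real k + (exp \<theta> - 1) * ((1 - \<eta>/8) * real k) \<le> - (\<eta>/8 * \<theta> * real k) + \<theta>^2 * real k" by simp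
    also have "\<dots> = - (real k * \<eta>^2) / 256" by (simp add: \<theta>_def power2_eq_square)
    finally show ?thesis by simp
  qed
  finally show ?thesis by (simp add: mult_left_mono divide_right_mono)
qed

text \<open>
For large \<open>k\<close>, almost all of the vertices with labels below \<open>(1 - \<eta>/4) k NN/d\<close> have threshold degree
below \<open>k\<close>: their number has a Chernoff lower tail, and the expected number of exceptions is small
enough for Markov's inequality. The bound is geometric in \<open>k\<close>, so it can be summed over all levels.
\<close>

lemma low_count_large_level:
  fixes \<eta> :: real
  assumes \<tau>: "\<tau> \<le> 1" and \<eta>: "0 < \<eta>" "\<eta> \<le> 1" and k: "8 \<le> \<eta> * real k" "1 \<le> k" "k \<le> d" and Ad: "d \<le> card A"
  shows "avg A (labels NN) (\<lambda>f. of_bool (real (card {u \<in> A. thr NN \<tau> f (N u) u < k \<and>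
            real (f u) * real d < (1 - \<eta>/4) * real k * real NN}) < (1 - \<eta>) * real k * real (card A) / real d))
     \<le> 9 / \<eta> * exp (- (\<eta>^2) / 256) ^ k"
proof -
  let ?Q = "\<lambda>x::nat. real x * real d < (1 - \<eta>/4) * real k * real NN"
  define p0 where "p0 = (1 - \<eta>/4) * real k / real d"
  define P where "P = real (card A) * p0"
  define E where "E = exp (- (real k * \<eta>^2) / 256)"
  have dpos: "real d > 0" using d8 by simp
  have p0: "p0 > 0" using \<eta> k dpos by (simp add: p0_def)
  define y where "y = (1 - \<eta>/4) * real k * real NN / real d"
  have y0: "y \<ge> 0" using \<eta> by (simp add: y_def)
  have yN: "y \<le> real NN"
  proof -
    have "(1 - \<eta>/4) * real k \<le> 1 * real d" using \<eta> k by (intro mult_mono) auto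
    hence "(1 - \<eta>/4) * real k * real NN \<le> real d * real NN" by (intro mult_right_mono) auto
    thus ?thesis using dpos by (simp add: y_def divide_le_eq mult.commute)
  qed
  have Qy: "{x \<in> {..<NN}. ?Q x} = {x \<in> {..<NN}. real x < y}"
    using dpos by (simp add: y_def less_divide_eq)
  have cQ: "real (card {x \<in> {..<NN}. ?Q x}) \<ge> y" "real (card {x \<in> {..<NN}. ?Q x}) \<le> y + 1"
    unfolding Qy using card_less_real_bounds[OF y0 yN] by auto
  have yp: "y = p0 * real NN" by (simp add: y_def p0_def)
  have fq: "freq (labels NN) (\<lambda>a. ?Q) u \<ge> p0" for u :: 'a
    unfolding freq_def using cQ(1) NN_pos by (simp add: yp le_divide_eq)
  have y1: "1 \<le> y"
  proof -
    have "real d^4 \<le> real NN" using NNd by (simp flip: of_nat_power)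
    moreover have "real d * 1 \<le> real d * real d^3" using d8 by (intro mult_left_mono) auto
    ultimately have "real d \<le> real NN" by (simp add: power_numeral_reduce)
    moreover have "1 \<le> (1 - \<eta>/4) * real k" using k \<eta> 
    proof -
      have "8 \<le> 1 * real k" using k(1) \<eta> mult_right_mono[of \<eta> 1 "real k"] by linarith
      moreover have "(3/4) * real k \<le> (1 - \<eta>/4) * real k" using \<eta> by (intro mult_right_mono) auto
      ultimately show ?thesis by linarith
    qed
    ultimately have "1 * real d \<le> (1 - \<eta>/4) * real k * real NN" by (intro mult_mono) auto
    thus ?thesis using dpos by (simp add: y_def le_divide_eq)
  qed
  have P_ge: "P \<ge> real k / 2"
  proof -
    have "1/2 * real k \<le> (1 - \<eta>/4) * real k" using \<eta> by (intro mult_right_mono) auto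
    hence "real k / 2 \<le> (1 - \<eta>/4) * real k" by simp
    also have "\<dots> \<le> (1 - \<eta>/4) * real k * (real (card A) / real d)"
    proof -
      have "1 \<le> real (card A) / real d" using Ad dpos by (simp add: le_divide_eq)
      hence "(1 - \<eta>/4) * real k * 1 \<le> (1 - \<eta>/4) * real k * (real (card A) / real d)"
        using \<eta> by (intro mult_left_mono) auto
      thus ?thesis by simp
    qed
    finally show ?thesis by (simp add: P_def p0_def mult.commute)
  qed
  \<comment> \<open>the minimum of the exponent - \<eta>/4 * \<theta> + \<theta>^2 below\<close>
  define \<theta> where "\<theta> = \<eta>/8"
  have \<theta>: "0 \<le> \<theta>" using \<eta> by (simp add: \<theta>_def)
  have "avg A (labels NN) (\<lambda>f. of_bool ((\<Sum>u\<in>A. of_bool (?Q (f u))) \<le> (1 - \<eta>/4) * P))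
     \<le> exp (\<theta> * ((1 - \<eta>/4) * P) + (exp (- \<theta>) - 1) * P)"
  proof (rule count_lower_tail[OF pA order.refl \<theta>])
    show "P \<le> (\<Sum>a\<in>A. freq (labels NN) (\<lambda>a. ?Q) a)"
      using sum_bounded_below[of A p0 "freq (labels NN) (\<lambda>a. ?Q)"] fq by (simp add: P_def)
  qed
  also have "\<dots> \<le> exp (- (real k * \<eta>^2) / 128)"
  proof -
    have "(exp (- \<theta>) - 1) * P \<le> (- \<theta> + \<theta>^2) * P"
      using exp_neg_bound[OF \<theta>] P_ge by (intro mult_right_mono) auto
    hence "\<theta> * ((1 - \<eta>/4) * P) + (exp (- \<theta>) - 1) * P \<le> (- (\<eta>/4 * \<theta>) + \<theta>^2) * P" by (simp add: algebra_simps)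
    also have "\<dots> = - (\<eta>^2 / 64) * P" by (simp add: \<theta>_def power2_eq_square)
    also have "\<dots> \<le> - (\<eta>^2 / 64) * (real k / 2)" using P_ge by (intro mult_left_mono_neg) auto
    finally show ?thesis by (simp add: mult.commute)
  qed
  also have "\<dots> \<le> E" unfolding E_def by simp
  finally have F1: "avg A (labels NN) (\<lambda>f. of_bool ((\<Sum>u\<in>A. of_bool (?Q (f u))) \<le> (1 - \<eta>/4) * P)) \<le> E" .
  define Y where "Y = (\<lambda>f. \<Sum>u\<in>A. of_bool (?Q (f u) \<and> k \<le> thr NN \<tau> f (N u) u) :: real)"
  have "avg A (labels NN) Y \<le> (\<Sum>u\<in>A. 2 * p0 * E)"
    unfolding Y_def avg_sum
  proof (rule sum_mono)
    fix u assume u: "u \<in> A"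
    have "avg A (labels NN) (\<lambda>f. of_bool (?Q (f u) \<and> k \<le> thr NN \<tau> f (N u) u))
       \<le> avg A (labels NN) (\<lambda>f. of_bool (\<exists>c\<in>{x\<in>{..<NN}. ?Q x}. f u = c \<and> k \<le> thr NN \<tau> f (N u) u))"
      by (rule avg_mono) (use u in auto)
    also have "\<dots> \<le> (\<Sum>c\<in>{x\<in>{..<NN}. ?Q x}. avg A (labels NN) (\<lambda>f. of_bool (f u = c \<and> k \<le> thr NN \<tau> f (N u) u)))"
      by (rule avg_union_bound) simp
    also have "\<dots> \<le> (\<Sum>c\<in>{x\<in>{..<NN}. ?Q x}. E / real NN)"
      unfolding E_def by (intro sum_mono high_given_label u \<tau> \<eta> k) auto
    also have "\<dots> = real (card {x\<in>{..<NN}. ?Q x}) / real NN * E" by simp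
    also have "\<dots> \<le> (2 * y) / real NN * E"
      using cQ(2) y1 NN_pos by (intro mult_right_mono divide_right_mono) (auto simp: E_def)
    finally show "avg A (labels NN) (\<lambda>f. of_bool (?Q (f u) \<and> k \<le> thr NN \<tau> f (N u) u)) \<le> 2 * p0 * E"
      using NN_pos by (simp add: yp)
  qed
  hence EY: "avg A (labels NN) Y \<le> 2 * P * E" by (simp add: P_def mult_ac)
  have Ppos: "P > 0" using P_ge k by linarith
  have "avg A (labels NN) (\<lambda>f. of_bool (Y f \<ge> \<eta>/4 * P)) \<le> avg A (labels NN) Y / (\<eta>/4 * P)"
    by (rule avg_markov) (use Ppos \<eta> in \<open>auto simp: Y_def intro!: sum_nonneg\<close>)
  also have "\<dots> \<le> 2 * P * E / (\<eta>/4 * P)" using EY Ppos \<eta> by (intro divide_right_mono) auto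
  also have "\<dots> = 8 / \<eta> * E" using Ppos \<eta> by simp
  finally have F2: "avg A (labels NN) (\<lambda>f. of_bool (Y f \<ge> \<eta>/4 * P)) \<le> 8 / \<eta> * E" .
  have imp: "(\<Sum>u\<in>A. of_bool (?Q (f u))) \<le> (1 - \<eta>/4) * P \<or> Y f \<ge> \<eta>/4 * P"
    if less: "real (card {u \<in> A. thr NN \<tau> f (N u) u < k \<and> ?Q (f u)}) < (1 - \<eta>) * real k * real (card A) / real d" for f
  proof (rule ccontr)
    assume neg: "\<not> ?thesis"
    have "(\<Sum>u\<in>A. of_bool (?Q (f u)) :: real) = (\<Sum>u\<in>A. of_bool (thr NN \<tau> f (N u) u < k \<and> ?Q (f u)) + of_bool (?Q (f u) \<and> k \<le> thr NN \<tau> f (N u) u))"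
      by (rule sum.cong) auto
    also have "\<dots> = real (card {u \<in> A. thr NN \<tau> f (N u) u < k \<and> ?Q (f u)}) + Y f"
      unfolding sum.distrib Y_def using finA by (simp add: Int_def)
    finally have "real (card {u \<in> A. thr NN \<tau> f (N u) u < k \<and> ?Q (f u)}) > (1 - \<eta>/4) * P - \<eta>/4 * P" using neg by linarith
    moreover have "(1 - \<eta>/4) * P - \<eta>/4 * P \<ge> (1 - \<eta>) * real k * real (card A) / real d"
    proof -
      have "(1 - \<eta>) \<le> (1 - \<eta>/2) * (1 - \<eta>/4)" using \<eta> by (simp add: algebra_simps)
      hence "(1 - \<eta>) * (real k * real (card A) / real d) \<le> (1 - \<eta>/2) * (1 - \<eta>/4) * (real k * real (card A) / real d)"
        by (intro mult_right_mono) auto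
      moreover have "(1 - \<eta>/4) * P - \<eta>/4 * P = (1 - \<eta>/2) * P" by (simp add: algebra_simps)
      ultimately show ?thesis by (simp add: P_def p0_def mult_ac)
    qed
    ultimately show False using less by linarith
  qed
  have "avg A (labels NN) (\<lambda>f. of_bool (real (card {u \<in> A. thr NN \<tau> f (N u) u < k \<and> ?Q (f u)}) < (1 - \<eta>) * real k * real (card A) / real d))
    \<le> avg A (labels NN) (\<lambda>f. of_bool ((\<Sum>u\<in>A. of_bool (?Q (f u))) \<le> (1 - \<eta>/4) * P \<or> Y f \<ge> \<eta>/4 * P))"
    by (rule avg_mono) (use imp in auto)
  also have "\<dots> \<le> E + 8 / \<eta> * E" by (rule order.trans[OF avg_disj add_mono[OF F1 F2]])
  also have "\<dots> \<le> 9 / \<eta> * E"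
  proof -
    have "1 \<le> 1 / \<eta>" using \<eta> by simp
    hence "1 * E \<le> 1 / \<eta> * E" by (intro mult_right_mono) (auto simp: E_def)
    thus ?thesis by (simp add: add_divide_distrib[symmetric])
  qed
  also have "E = exp (- (\<eta>^2) / 256) ^ k" by (simp add: E_def exp_of_nat_mult[symmetric])
  finally show ?thesis .
qed

lemma low_count_small_level:
  fixes \<eta> :: real
  assumes \<tau>: "\<tau> \<le> 1" and \<eta>: "0 < \<eta>" and k: "1 \<le> k" "2 * k \<le> d" and A0: "card A > 0"
  shows "avg A (labels NN) (\<lambda>f. of_bool (real (card {u \<in> A. thr NN \<tau> f (N u) u < k}) < (1 - \<eta>) * real k * real (card A) / real d))
     \<le> 183 * real d / (\<eta>^2 * real (card A)) + 200 / (\<eta>^2 * real d)"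
proof -
  define X where "X = (\<lambda>f. (\<Sum>u\<in>A. of_bool (thr NN \<tau> f (N u) u < k) :: real))"
  define m where "m = (\<Sum>u\<in>A. real k / real (card (N u)))"
  define a where "a = real (card A)"
  define dd where "dd = real d"
  define t where "t = \<eta> * real k * a / dd"
  have pos: "a > 0" "dd > 0" "real k > 0" using A0 d8 k by (auto simp: a_def dd_def)
  have t0: "t > 0" using pos \<eta> by (simp add: t_def)
  have m_ge: "m \<ge> real k * a / dd"
  proof -
    have "(\<Sum>u\<in>A. real k / dd) \<le> m" unfolding m_def
    proof (rule sum_mono)
      fix u assume "u \<in> A"
      thus "real k / dd \<le> real k / real (card (N u))"
        using deg_real[of u] pos by (intro divide_left_mono mult_pos_pos) (auto simp: dd_def)
    qed
    thus ?thesis by (simp add: a_def mult.commute)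
  qed
  have "avg A (labels NN) (\<lambda>f. of_bool (real (card {u \<in> A. thr NN \<tau> f (N u) u < k}) < (1 - \<eta>) * real k * a / dd))
      \<le> avg A (labels NN) (\<lambda>f. of_bool (\<bar>X f - m\<bar> \<ge> t))"
  proof (rule avg_mono)
    fix f :: "'a \<Rightarrow> nat"
    have "X f = real (card {u \<in> A. thr NN \<tau> f (N u) u < k})" unfolding X_def using finA by (simp add: Int_def)
    moreover have "(1 - \<eta>) * real k * a / dd = real k * a / dd - t" by (simp add: t_def left_diff_distrib diff_divide_distrib)
    ultimately show "of_bool (real (card {u \<in> A. thr NN \<tau> f (N u) u < k}) < (1 - \<eta>) * real k * a / dd) \<le> (of_bool (\<bar>X f - m\<bar> \<ge> t) :: real)"
      using m_ge by auto
  qed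
  also have "\<dots> \<le> avg A (labels NN) (\<lambda>f. (X f - m)^2) / t^2" by (rule avg_chebyshev[OF t0])
  also have "\<dots> \<le> (183 * real k^2 * a / dd + 200 * real k^2 * a^2 / dd^3) / t^2"
    unfolding X_def m_def a_def dd_def by (intro divide_right_mono second_moment_low \<tau> k) auto
  also have "\<dots> = 183 * dd / (\<eta>^2 * a) + 200 / (\<eta>^2 * dd)"
    using pos \<eta> by (simp add: t_def field_simps power2_eq_square power3_eq_cube)
  finally show ?thesis by (simp add: a_def dd_def)
qed

text \<open>
Finitely many levels \<open>k < K\<close> are covered by Chebyshev's inequality, the others by the geometric
bounds. The additional condition on the label for \<open>k \<ge> K\<close> records that the counted vertices have
small labels.
\<close>

lemma low_counts:
  fixes \<eta> :: real
  defines "r \<equiv> exp (- (\<eta>^2) / 256)"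
  assumes \<tau>: "\<tau> \<le> 1" and \<eta>: "0 < \<eta>" "\<eta> \<le> 1" and K: "8 \<le> \<eta> * real K" "2 * K \<le> d" and Ad: "d \<le> card A"
  shows "avg A (labels NN) (\<lambda>f. of_bool (\<exists>k\<in>{1..d}. real (card {u \<in> A. thr NN \<tau> f (N u) u < k \<and>
            (k < K \<or> real (f u) * real d < (1 - \<eta>/4) * real k * real NN)}) < (1 - \<eta>) * real k * real (card A) / real d))
     \<le> real K * (183 * real d / (\<eta>^2 * real (card A)) + 200 / (\<eta>^2 * real d)) + 9 / \<eta> * (r ^ K / (1 - r))"
    (is "avg A _ (\<lambda>f. of_bool (\<exists>k\<in>_. ?P k f)) \<le> _")
proof -
  define s where "s = 183 * real d / (\<eta>^2 * real (card A)) + 200 / (\<eta>^2 * real d)"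
  have s0: "s \<ge> 0" by (simp add: s_def)
  have r: "0 \<le> r" "r < 1" using \<eta> by (auto simp: r_def)
  have split: "{1..d} = {1..<K} \<union> {K..d}" if "K \<ge> 1" using K that by auto
  have K1: "K \<ge> 1" using K by (cases K) auto
  have "avg A (labels NN) (\<lambda>f. of_bool (\<exists>k\<in>{1..d}. ?P k f)) \<le> (\<Sum>k\<in>{1..d}. avg A (labels NN) (\<lambda>f. of_bool (?P k f)))"
    by (rule avg_union_bound) simp
  also have "\<dots> = (\<Sum>k\<in>{1..<K}. avg A (labels NN) (\<lambda>f. of_bool (?P k f))) + (\<Sum>k\<in>{K..d}. avg A (labels NN) (\<lambda>f. of_bool (?P k f)))"
    unfolding split[OF K1] by (rule sum.union_disjoint) auto
  also have "(\<Sum>k\<in>{1..<K}. avg A (labels NN) (\<lambda>f. of_bool (?P k f))) \<le> (\<Sum>k\<in>{1..<K}. s)"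
  proof (rule sum_mono)
    fix k assume k: "k \<in> {1..<K}"
    have "avg A (labels NN) (\<lambda>f. of_bool (?P k f)) =
      avg A (labels NN) (\<lambda>f. of_bool (real (card {u \<in> A. thr NN \<tau> f (N u) u < k}) < (1 - \<eta>) * real k * real (card A) / real d))"
      using k by simp
    also have "\<dots> \<le> s" unfolding s_def
      by (rule low_count_small_level) (use \<tau> \<eta> k K Ad d8 in auto)
    finally show "avg A (labels NN) (\<lambda>f. of_bool (?P k f)) \<le> s" .
  qed
  also have "\<dots> \<le> real K * s" using s0 by (simp add: mult_right_mono)
  also have "(\<Sum>k\<in>{K..d}. avg A (labels NN) (\<lambda>f. of_bool (?P k f))) \<le> (\<Sum>k\<in>{K..d}. 9 / \<eta> * r ^ k)"
  proof (rule sum_mono)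
    fix k assume k: "k \<in> {K..d}"
    have "8 \<le> \<eta> * real k"
    proof -
      have "\<eta> * real K \<le> \<eta> * real k" using k \<eta> by (intro mult_left_mono) auto
      thus ?thesis using K(1) by linarith
    qed
    hence "avg A (labels NN) (\<lambda>f. of_bool (real (card {u \<in> A. thr NN \<tau> f (N u) u < k \<and>
            real (f u) * real d < (1 - \<eta>/4) * real k * real NN}) < (1 - \<eta>) * real k * real (card A) / real d))
     \<le> 9 / \<eta> * r ^ k" unfolding r_def
      by (intro low_count_large_level \<tau> \<eta> Ad) (use k K1 in auto)
    moreover have "\<not> k < K" using k by simp
    ultimately show "avg A (labels NN) (\<lambda>f. of_bool (?P k f)) \<le> 9 / \<eta> * r ^ k" by simp
  qed
  also have "\<dots> = 9 / \<eta> * (\<Sum>k\<in>{K..d}. r ^ k)" by (simp add: sum_distrib_left)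
  also have "\<dots> \<le> 9 / \<eta> * (r ^ K / (1 - r))"
    using sum_powers_tail[OF r] \<eta> by (intro mult_left_mono) auto
  finally show ?thesis unfolding s_def by simp
qed

end

section \<open>Regular graphs of small degree\<close>

locale regular_nbhds =
  fixes V :: "'a set" and N :: "'a \<Rightarrow> 'a set" and d :: nat
  assumes finV: "finite V"
    and N_sub: "v \<in> V \<Longrightarrow> N v \<subseteq> V - {v}"
    and N_sym: "v \<in> V \<Longrightarrow> w \<in> N v \<Longrightarrow> v \<in> N w"
    and N_card: "v \<in> V \<Longrightarrow> card (N v) = d"
begin

lemma finN: "v \<in> V \<Longrightarrow> finite (N v)"
  using finV N_sub finite_subset by (metis Diff_subset)

lemma card_near: "v \<in> V \<Longrightarrow> card {v'\<in>V. insert v (N v) \<inter> insert v' (N v') \<noteq> {}} \<le> (d+1)^2"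
proof -
  assume v: "v \<in> V"
  let ?B = "\<lambda>w. insert w (N w)"
  have sub: "{v'\<in>V. ?B v \<inter> ?B v' \<noteq> {}} \<subseteq> (\<Union>w\<in>?B v. ?B w)"
  proof
    fix v' assume "v' \<in> {v'\<in>V. ?B v \<inter> ?B v' \<noteq> {}}"
    then obtain w where w: "v' \<in> V" "w \<in> ?B v" "w \<in> ?B v'" by blast
    have "v' \<in> ?B w" using w(1,3) N_sym by auto
    thus "v' \<in> (\<Union>w\<in>?B v. ?B w)" using w(2) by blast
  qed
  have BV: "w \<in> V" if "w \<in> ?B v" for w using that v N_sub by auto
  have cB: "card (?B w) \<le> d + 1" "finite (?B w)" if "w \<in> V" for w
    using N_card[OF that] finN[OF that] by (simp_all add: card_insert_if)
  have "card {v'\<in>V. ?B v \<inter> ?B v' \<noteq> {}} \<le> card (\<Union>w\<in>?B v. ?B w)"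
    by (rule card_mono[OF finite_UN_I[OF cB(2)[OF v] cB(2)[OF BV]] sub])
  also have "\<dots> \<le> (\<Sum>w\<in>?B v. card (?B w))" by (rule card_UN_le[OF cB(2)[OF v]])
  also have "\<dots> \<le> (\<Sum>w\<in>?B v. d + 1)" by (intro sum_mono cB BV)
  also have "\<dots> = card (?B v) * (d+1)" by simp
  also have "\<dots> \<le> (d+1) * (d+1)" by (rule mult_le_mono1[OF cB(1)[OF v]])
  finally show ?thesis by (simp add: power2_eq_square)
qed

lemma sparse_regular_labels:
  fixes \<epsilon> :: real
  assumes \<epsilon>: "\<epsilon> > 0" and n: "\<epsilon>^2 * real (card V) > 7 * (real d + 1)^4" "d + 1 \<le> card V"
  shows "\<exists>NN f. \<forall>k\<le>d. \<bar>real (card {v\<in>V. thr NN 0 f (N v) v = k}) - real (card V) / (real d + 1)\<bar> < \<epsilon> * (real (card V) / (real d + 1))"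
proof -
  define n where "n = real (card V)"
  \<comment> \<open>so many labels that a tie at a vertex has probability at most 1/(2n)\<close>
  define NN where "NN = 2 * (d + 1) * card V"
  define p where "p = 1 / (real d + 1)"
  define X where "X = (\<lambda>k f. (\<Sum>v\<in>V. of_bool (thr NN 0 f (N v) v = k) :: real))"
  have n1: "n \<ge> 1" "n \<ge> real d + 1" using n(2) by (auto simp: n_def)
  have NN0: "NN > 0" using n(2) by (simp add: NN_def)
  have pV: "proper V (labels NN)" using finV NN0 by (rule proper_labels)
  have t: "real d / real NN \<le> 1 / (2 * n)"
  proof -
    have "real d / real NN = (real d / (real d + 1)) * (1 / (2 * n))" by (simp add: NN_def n_def algebra_simps)
    also have "\<dots> \<le> 1 * (1 / (2 * n))" using n1 by (intro mult_right_mono) auto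
    finally show ?thesis by simp
  qed
  have p01: "0 < p" "p \<le> 1" by (auto simp: p_def)
  define P where "P = (\<lambda>k v. avg V (labels NN) (\<lambda>f. of_bool (thr NN 0 f (N v) v = k)))"
  have Pb: "\<bar>P k v - p\<bar> \<le> 1 / n" if "v \<in> V" "k \<le> d" for k v
  proof -
    have b: "\<bar>avg V (labels NN) (\<lambda>f. of_bool (thr NN 0 f (N v) v < j)) - real j / (real d + 1)\<bar> \<le> 1 / (2*n)" if "j \<le> d + 1" for j
    proof -
      have Nv: "insert v (N v) \<subseteq> V" "v \<notin> N v" using N_sub[OF \<open>v\<in>V\<close>] \<open>v\<in>V\<close> by auto
      have "\<bar>avg V (labels NN) (\<lambda>f. of_bool (thr NN 0 f (N v) v < j)) - real j / (real d + 1)\<bar> \<le> real d / real NN"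
        using avg_thr[OF finV Nv NN0, of 0 j] that unfolding N_card[OF \<open>v\<in>V\<close>] by simp
      thus ?thesis using t by linarith
    qed
    have "P k v = avg V (labels NN) (\<lambda>f. of_bool (thr NN 0 f (N v) v < k + 1) - of_bool (thr NN 0 f (N v) v < k))"
      unfolding P_def by (rule avg_cong) auto
    also have "\<dots> = avg V (labels NN) (\<lambda>f. of_bool (thr NN 0 f (N v) v < k + 1)) - avg V (labels NN) (\<lambda>f. of_bool (thr NN 0 f (N v) v < k))"
      by (rule avg_diff)
    finally have "P k v = \<dots>" .
    moreover have "real (k+1) / (real d + 1) = real k / (real d + 1) + p" by (simp add: p_def add_divide_distrib)
    moreover have "1 / (2 * n) + 1 / (2 * n) = 1 / n" by simp
    ultimately show ?thesis using b[of "k+1"] b[of k] that(2) unfolding abs_le_iff by linarith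
  qed
  have dep: "dep_on (insert v (N v)) (\<lambda>f. of_bool (thr NN 0 f (N v) v = k) :: real)" for v k
    by (rule thr_dep_on[of v "N v" "\<lambda>x. x = k"])
  have var: "avg V (labels NN) (\<lambda>f. (X k f - n * p)^2) \<le> 7 * n * (real d + 1)" if k: "k \<le> d" for k
  proof -
    let ?I = "\<lambda>v f. of_bool (thr NN 0 f (N v) v = k) :: real"
    \<comment> \<open>vertices at distance at most two\<close>
    let ?near = "\<lambda>v. {v'\<in>V. insert v (N v) \<inter> insert v' (N v') \<noteq> {}}"
    have pair: "avg V (labels NN) (\<lambda>f. ?I v f * ?I v' f) \<le> (p + 1/n)^2 + (if v' \<in> ?near v then p + 1/n else 0)"
      if v: "v \<in> V" "v' \<in> V" for v v'
    proof (cases "v' \<in> ?near v")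
      case True
      have "avg V (labels NN) (\<lambda>f. ?I v f * ?I v' f) \<le> P k v" unfolding P_def by (rule avg_mono) auto
      also have "\<dots> \<le> p + 1/n" using Pb[OF v(1) k] by linarith
      finally show ?thesis using True by (simp add: add_increasing)
    next
      case False
      hence disj: "insert v (N v) \<inter> insert v' (N v') = {}" using v by blast
      have "avg V (labels NN) (\<lambda>f. ?I v f * ?I v' f) = P k v * P k v'" unfolding P_def
        by (rule avg_indep[OF pV _ _ disj dep dep]) (use v N_sub in auto)
      also have "\<dots> \<le> (p + 1/n) * (p + 1/n)"
      proof (intro mult_mono)
        show "P k v \<le> p + 1/n" "P k v' \<le> p + 1/n" using Pb[OF v(1) k] Pb[OF v(2) k] by linarith+
        show "0 \<le> p + 1/n" using p01 n1 by simp
        show "0 \<le> P k v'" unfolding P_def by (rule avg_nonneg) auto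
      qed
      finally show ?thesis by (simp only: False if_False add_0_right power2_eq_square)
    qed
    have "avg V (labels NN) (\<lambda>f. X k f * X k f) = (\<Sum>v\<in>V. \<Sum>v'\<in>V. avg V (labels NN) (\<lambda>f. ?I v f * ?I v' f))"
      unfolding X_def sum_product avg_sum ..
    also have "\<dots> \<le> (\<Sum>v\<in>V. \<Sum>v'\<in>V. (p + 1/n)^2 + (if v' \<in> ?near v then p + 1/n else 0))"
      by (intro sum_mono pair)
    also have "\<dots> = (\<Sum>v\<in>V. n * (p + 1/n)^2 + real (card (?near v)) * (p + 1/n))"
      unfolding sum.distrib by (intro arg_cong2[where f="(+)"] sum.cong refl) (use finV in \<open>simp_all add: n_def sum.If_cases Int_def\<close>)
    also have "\<dots> \<le> (\<Sum>v\<in>V. n * (p + 1/n)^2 + (real d + 1)^2 * (p + 1/n))"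
    proof (intro sum_mono add_left_mono mult_right_mono)
      fix v assume "v \<in> V"
      hence "real (card (?near v)) \<le> real ((d+1)^2)" using card_near by (simp only: of_nat_le_iff)
      thus "real (card (?near v)) \<le> (real d + 1)^2" by (simp add: add.commute)
    qed (use p01 n1 in auto)
    also have "\<dots> = n^2 * (p + 1/n)^2 + n * ((real d + 1)^2 * (p + 1/n))"
      by (simp add: n_def power2_eq_square algebra_simps)
    finally have EXX: "avg V (labels NN) (\<lambda>f. X k f * X k f) \<le> n^2 * (p + 1/n)^2 + n * ((real d + 1)^2 * (p + 1/n))" .
    have EX: "avg V (labels NN) (X k) \<ge> n * p - 1"
    proof -
      have "n * p - 1 = (\<Sum>v\<in>V. p - 1/n)" using n1 by (simp add: n_def algebra_simps)
      also have "\<dots> \<le> (\<Sum>v\<in>V. P k v)" by (intro sum_mono) (use Pb[OF _ k] in force)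
      finally show ?thesis unfolding X_def avg_sum P_def .
    qed
    have "avg V (labels NN) (\<lambda>f. (X k f - n * p)^2) = avg V (labels NN) (\<lambda>f. X k f * X k f + ((n*p)*(n*p) - (2 * (n*p)) * X k f))"
      by (rule avg_cong) (simp add: power2_eq_square algebra_simps)
    also have "\<dots> = avg V (labels NN) (\<lambda>f. X k f * X k f) + ((n*p)*(n*p) - 2 * (n*p) * avg V (labels NN) (X k))"
      unfolding avg_add avg_diff avg_cmult using pV by simp
    also have "\<dots> \<le> n^2 * (p + 1/n)^2 + n * ((real d + 1)^2 * (p + 1/n)) + ((n*p)*(n*p) - 2 * (n*p) * (n * p - 1))"
      using EXX EX p01 n1 by (intro add_mono diff_left_mono mult_left_mono) auto
    also have "n^2 * (p + 1/n)^2 = (n * p + 1)^2" using n1 by (simp add: power_mult_distrib[symmetric] distrib_left)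
    also have "n * ((real d + 1)^2 * (p + 1/n)) = n * (real d + 1) + (real d + 1)^2"
    proof -
      have "n * (D^2 * (1 / D + 1/n)) = n * D + D^2" if "D > 0" for D :: real
        using that n1 by (simp add: field_simps power2_eq_square)
      from this[of "real d + 1"] show ?thesis by (simp add: p_def)
    qed
    also have "(n * p + 1)^2 + (n * (real d + 1) + (real d + 1)^2) + ((n*p)*(n*p) - 2 * (n*p) * (n * p - 1))
        = 4 * (n * p) + 1 + n * (real d + 1) + (real d + 1)^2"
      by (simp add: power2_eq_square algebra_simps)
    also have "\<dots> \<le> 7 * n * (real d + 1)"
    proof -
      have "n * p \<le> n * 1" using p01 n1 by (intro mult_left_mono) auto
      moreover have "n * 1 \<le> n * (real d + 1)" using n1 by (intro mult_left_mono) auto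
      moreover have "(real d + 1)^2 \<le> n * (real d + 1)" unfolding power2_eq_square using n1 by (intro mult_right_mono) auto
      ultimately show ?thesis using n1 by (simp only: mult.assoc)
    qed
    finally show ?thesis .
  qed
  define bad where "bad = (\<lambda>k f. \<bar>X k f - n * p\<bar> \<ge> \<epsilon> * (n * p))"
  have "avg V (labels NN) (\<lambda>f. of_bool (\<exists>k\<in>{..d}. bad k f)) \<le> (\<Sum>k\<in>{..d}. avg V (labels NN) (\<lambda>f. of_bool (bad k f)))"
    by (rule avg_union_bound) simp
  also have "\<dots> \<le> (\<Sum>k\<in>{..d}. 7 * n * (real d + 1) / (\<epsilon> * (n * p))^2)"
  proof (rule sum_mono)
    fix k assume k: "k \<in> {..d}"
    have "avg V (labels NN) (\<lambda>f. of_bool (bad k f)) \<le> avg V (labels NN) (\<lambda>f. (X k f - n * p)^2) / (\<epsilon> * (n * p))^2"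
      unfolding bad_def by (rule avg_chebyshev) (use \<epsilon> n1 p01 in auto)
    also have "\<dots> \<le> 7 * n * (real d + 1) / (\<epsilon> * (n * p))^2"
      using var k by (intro divide_right_mono) auto
    finally show "avg V (labels NN) (\<lambda>f. of_bool (bad k f)) \<le> 7 * n * (real d + 1) / (\<epsilon> * (n * p))^2" .
  qed
  also have "\<dots> = 7 * (real d + 1)^4 / (\<epsilon>^2 * n)"
    using n1 \<epsilon> by (simp add: p_def field_simps power2_eq_square power4_eq_xxxx)
  also have "\<dots> < 1" using n(1) n1 \<epsilon> by (simp add: n_def divide_less_eq)
  finally obtain f where "of_bool (\<exists>k\<in>{..d}. bad k f) < (1::real)" using avg_exists[OF pV] by blast
  hence f: "\<not> bad k f" if "k \<le> d" for k using that by (auto split: if_splits simp: of_bool_def)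
  have "X k f = real (card {v\<in>V. thr NN 0 f (N v) v = k})" for k unfolding X_def using finV by (simp add: Int_def)
  hence "\<bar>real (card {v\<in>V. thr NN 0 f (N v) v = k}) - n * p\<bar> < \<epsilon> * (n * p)" if "k \<le> d" for k
    using f[OF that] unfolding bad_def by simp
  thus ?thesis unfolding n_def p_def by (intro exI[of _ NN] exI[of _ f]) simp
qed

end

section \<open>Rankings, evenly filled levels, and clumps\<close>

lemma ranking_exists:
  fixes f :: "'a \<Rightarrow> nat"
  assumes "finite S"
  shows "\<exists>r. bij_betw r S {..<card S} \<and> (\<forall>u\<in>S. \<forall>v\<in>S. f u < f v \<longrightarrow> r u < r v)"
  using assms
proof (induction S rule: finite_ranking_induct[where f=f])
  case empty
  show ?case by (auto simp: bij_betw_def)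
next
  case (insert x S)
  show ?case
  proof (cases "x \<in> S")
    case True
    thus ?thesis using insert.IH by (simp add: insert_absorb)
  next
    case False
    obtain r where r: "bij_betw r S {..<card S}" "\<forall>u\<in>S. \<forall>v\<in>S. f u < f v \<longrightarrow> r u < r v" using insert.IH by blast
    define r' where "r' = r(x := card S)"
    have rS: "r u < card S" if "u \<in> S" for u using r(1) that by (auto simp: bij_betw_def)
    have "bij_betw r' S {..<card S}"
      by (rule bij_betw_cong[THEN iffD1, OF _ r(1)]) (use False in \<open>auto simp: r'_def\<close>)
    moreover have "bij_betw r' {x} {card S}" by (auto simp: bij_betw_def r'_def)
    ultimately have "bij_betw r' ({x} \<union> S) ({card S} \<union> {..<card S})"
      by (intro bij_betw_combine) auto
    hence "bij_betw r' (insert x S) (insert (card S) {..<card S})" by simp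
    moreover have "insert (card S) {..<card S} = {..<card (insert x S)}" using False insert.hyps by auto
    moreover have "r' u < r' v" if "u \<in> insert x S" "v \<in> insert x S" "f u < f v" for u v
    proof -
      have ux: "u \<noteq> x" using that insert.hyps(2)[of v] by auto
      hence "u \<in> S" using that by auto
      show ?thesis
        using that ux \<open>u \<in> S\<close> rS[of u] r(2) by (cases "v = x") (auto simp: r'_def)
    qed
    ultimately show ?thesis by metis
  qed
qed

text \<open>
These bounds do not depend on how the ranking breaks ties.
\<close>

lemma ranking_bounds:
  fixes f :: "'a \<Rightarrow> nat"
  assumes fin: "finite S" and r: "bij_betw r S {..<card S}" "\<forall>u\<in>S. \<forall>v\<in>S. f u < f v \<longrightarrow> r u < r v" and v: "v \<in> S"
  shows "card {u\<in>S. f u < f v} \<le> r v" "r v < card {u\<in>S. f u \<le> f v}"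
proof -
  have inj: "inj_on r S" and im: "r ` S = {..<card S}" using r(1) by (auto simp: bij_betw_def)
  have "card {u\<in>S. f u < f v} = card (r ` {u\<in>S. f u < f v})"
    by (rule card_image[symmetric], rule inj_on_subset[OF inj]) auto
  also have "\<dots> \<le> card {..<r v}" by (rule card_mono) (use r(2) v in auto)
  finally show "card {u\<in>S. f u < f v} \<le> r v" by simp
  have "{..r v} \<subseteq> r ` {u\<in>S. f u \<le> f v}"
  proof
    fix i assume i: "i \<in> {..r v}"
    have "r v < card S" using im v by blast
    hence "i \<in> r ` S" using i im by auto
    then obtain u where u: "u \<in> S" "i = r u" by auto
    have "f u \<le> f v" using r(2) u v i by (meson atMost_iff leD not_le_imp_less)
    thus "i \<in> r ` {u\<in>S. f u \<le> f v}" using u by auto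
  qed
  hence "card {..r v} \<le> card (r ` {u\<in>S. f u \<le> f v})" by (rule card_mono[rotated]) (use fin in auto)
  also have "\<dots> \<le> card {u\<in>S. f u \<le> f v}" by (rule card_image_le) (use fin in auto)
  finally show "r v < card {u\<in>S. f u \<le> f v}" by simp
qed

lemma card_rank_less:
  assumes r: "bij_betw r S {..<card S}"
  shows "card {v\<in>S. r v < j} = min j (card S)"
proof -
  have inj: "inj_on r S" and im: "r ` S = {..<card S}" using r by (auto simp: bij_betw_def)
  have "card {v\<in>S. r v < j} = card (r ` {v\<in>S. r v < j})"
    by (rule card_image[symmetric], rule inj_on_subset[OF inj]) auto
  also have "r ` {v\<in>S. r v < j} = {..<card S} \<inter> {..<j}" unfolding im[symmetric] by auto
  also have "\<dots> = {..<min j (card S)}" by auto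
  finally show ?thesis by simp
qed

text \<open>
Cutting a ranking of \<open>S\<close> into \<open>K\<close> consecutive blocks of almost equal size.
\<close>

lemma level_counts:
  assumes r: "bij_betw r S {..<card S}" and i: "i < K"
  shows "\<bar>real (card {v\<in>S. (r v * K) div card S = i}) - real (card S) / real K\<bar> \<le> 1"
proof (cases "card S = 0")
  case True
  have "r ` S = {}" using r True by (simp add: bij_betw_def)
  hence "{v\<in>S. (r v * K) div card S = i} = {}" by auto
  hence "card {v\<in>S. (r v * K) div card S = i} = 0" by (simp only: card.empty)
  thus ?thesis using True by (simp only:)
next
  case False
  define m where "m = card S"
  have m0: "m > 0" using False by (simp add: m_def)
  have K0: "K > 0" using i by simp
  have inj: "inj_on r S" and im: "r ` S = {..<m}" using r by (auto simp: bij_betw_def m_def)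
  define y1 where "y1 = real i * real m / real K"
  define y2 where "y2 = (real i + 1) * real m / real K"
  define Y where "Y = (\<lambda>y::real. {x \<in> {..<m}. real x < y})"
  have "card {v\<in>S. (r v * K) div m = i} = card (r ` {v\<in>S. (r v * K) div m = i})"
    by (rule card_image[symmetric], rule inj_on_subset[OF inj]) auto
  also have "r ` {v\<in>S. (r v * K) div m = i} = {x\<in>{..<m}. (x * K) div m = i}" unfolding im[symmetric] by auto
  also have "\<dots> = Y y2 - Y y1"
  proof -
    have "(x * K) div m = i \<longleftrightarrow> real x < y2 \<and> \<not> real x < y1" for x
    proof -
      have "(x * K) div m = i \<longleftrightarrow> i * m \<le> x * K \<and> x * K < (i + 1) * m"
        using m0 by (auto simp: div_nat_eqI dividend_less_times_div mult.commute
            intro: div_times_less_eq_dividend order.strict_trans2[OF dividend_less_div_times[OF m0]])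
      also have "\<dots> \<longleftrightarrow> real (i * m) \<le> real (x * K) \<and> real (x * K) < real ((i + 1) * m)"
        by (simp only: of_nat_le_iff of_nat_less_iff)
      also have "\<dots> \<longleftrightarrow> real x < y2 \<and> \<not> real x < y1"
        using K0 by (auto simp: y1_def y2_def less_divide_eq divide_less_eq not_less divide_le_eq le_divide_eq algebra_simps)
      finally show ?thesis .
    qed
    thus ?thesis unfolding Y_def by auto
  qed
  also have "card \<dots> = card (Y y2) - card (Y y1)"
  proof (rule card_Diff_subset)
    have "y1 \<le> y2" unfolding y1_def y2_def by (intro divide_right_mono mult_right_mono) auto
    thus "Y y1 \<subseteq> Y y2" by (auto simp: Y_def)
  qed (auto simp: Y_def)
  finally have c: "card {v\<in>S. (r v * K) div m = i} = card (Y y2) - card (Y y1)" .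
  have y12: "0 \<le> y1" "y1 \<le> y2" "y2 \<le> real m"
  proof -
    show "0 \<le> y1" by (simp add: y1_def)
    show "y1 \<le> y2" unfolding y1_def y2_def by (intro divide_right_mono mult_right_mono) auto
    have "(real i + 1) * real m \<le> real K * real m" using i by (intro mult_right_mono) auto
    thus "y2 \<le> real m" using K0 by (simp add: y2_def divide_le_eq mult.commute)
  qed
  have "y2 - y1 = real m / real K" by (simp add: y1_def y2_def add_divide_distrib distrib_right)
  moreover have "card (Y y1) \<le> card (Y y2)" using y12 by (intro card_mono) (auto simp: Y_def)
  moreover have "y1 \<le> real (card (Y y1))" "real (card (Y y1)) \<le> y1 + 1" "y2 \<le> real (card (Y y2))" "real (card (Y y2)) \<le> y2 + 1"
    unfolding Y_def using card_less_real_bounds[of y1 m] card_less_real_bounds[of y2 m] y12 by auto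
  ultimately have "\<bar>real (card {v\<in>S. (r v * K) div m = i}) - real m / real K\<bar> \<le> 1"
    unfolding c by (simp add: of_nat_diff abs_le_iff)
  thus ?thesis by (simp only: m_def)
qed

text \<open>
\<open>g j w\<close> is the part of the degree of \<open>w\<close> that is decided by the coordinates outside \<open>S\<close>. Once these
are fixed, each \<open>w \<in> S\<close> hits a given degree \<open>k\<close> with probability at most \<open>1/Dm\<close>, independently of
the others.
\<close>

lemma clump_bound:
  fixes g :: "('a \<Rightarrow> nat) \<Rightarrow> 'a \<Rightarrow> nat" and Dm J \<theta> :: real
  assumes pr: "finite S" "finite S'" and disj: "S \<inter> S' = {}" and C: "\<And>w. w \<in> S \<union> S' \<Longrightarrow> C w = {0..D w}"
    and D: "\<And>w. w \<in> S \<Longrightarrow> Dm \<le> real (D w) + 1" "Dm > 0"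
    and g: "\<And>i j w. (\<And>a. a \<in> S' \<Longrightarrow> i a = j a) \<Longrightarrow> g i w = g j w" and \<theta>: "\<theta> \<ge> 0"
  shows "avg (S \<union> S') C (\<lambda>j. of_bool (\<exists>k\<in>{..d}. J \<le> real (card {w\<in>S. j w + g j w = k})))
       \<le> (real d + 1) * exp (- \<theta> * J + (exp \<theta> - 1) * (real (card S) / Dm))"
proof -
  have pS: "proper S C" "proper S' C" using pr C by (auto simp: proper_def)
  have inner: "avg S C (\<lambda>i. of_bool (\<exists>k\<in>{..d}. J \<le> real (card {w\<in>S. i w + h w = k})))
       \<le> (real d + 1) * exp (- \<theta> * J + (exp \<theta> - 1) * (real (card S) / Dm))" for h
  proof -
    have "avg S C (\<lambda>i. of_bool (\<exists>k\<in>{..d}. J \<le> real (card {w\<in>S. i w + h w = k})))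
       \<le> (\<Sum>k\<in>{..d}. avg S C (\<lambda>i. of_bool (J \<le> real (card {w\<in>S. i w + h w = k}))))"
      by (rule avg_union_bound) simp
    also have "\<dots> \<le> (\<Sum>k\<in>{..d}. exp (- \<theta> * J + (exp \<theta> - 1) * (real (card S) / Dm)))"
    proof (rule sum_mono)
      fix k
      let ?Q = "\<lambda>w x. x + h w = k"
      have "(\<Sum>w\<in>S. freq C ?Q w) \<le> (\<Sum>w\<in>S. 1 / Dm)"
      proof (rule sum_mono)
        fix w assume w: "w \<in> S"
        have "card {c\<in>C w. ?Q w c} \<le> card {k - h w}" by (rule card_mono) auto
        hence "freq C ?Q w \<le> 1 / (real (D w) + 1)"
          unfolding freq_def using C[of w] w by (simp add: divide_right_mono add.commute)
        also have "\<dots> \<le> 1 / Dm" using D w by (intro divide_left_mono) auto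
        finally show "freq C ?Q w \<le> 1 / Dm" .
      qed
      hence s: "(\<Sum>w\<in>S. freq C ?Q w) \<le> real (card S) / Dm" by simp
      have "avg S C (\<lambda>i. of_bool (J \<le> (\<Sum>w\<in>S. of_bool (?Q w (i w))))) \<le> exp (- \<theta> * J + (exp \<theta> - 1) * (real (card S) / Dm))"
        by (rule count_upper_tail[OF pS(1) order.refl \<theta> s])
      thus "avg S C (\<lambda>i. of_bool (J \<le> real (card {w\<in>S. i w + h w = k}))) \<le> exp (- \<theta> * J + (exp \<theta> - 1) * (real (card S) / Dm))"
        using pr(1) by (simp add: Int_def)
    qed
    also have "\<dots> = (real d + 1) * exp (- \<theta> * J + (exp \<theta> - 1) * (real (card S) / Dm))"
      by (simp add: add.commute)
    finally show ?thesis .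
  qed
  have "avg (S \<union> S') C (\<lambda>j. of_bool (\<exists>k\<in>{..d}. J \<le> real (card {w\<in>S. j w + g j w = k})))
     = avg S' C (\<lambda>f. avg S C (\<lambda>i. of_bool (\<exists>k\<in>{..d}. J \<le> real (card {w\<in>S. (\<lambda>a. if a \<in> S' then f a else i a) w + g (\<lambda>a. if a \<in> S' then f a else i a) w = k}))))"
    by (subst Un_commute, rule avg_split) (use disj pr in auto)
  also have "\<dots> = avg S' C (\<lambda>f. avg S C (\<lambda>i. of_bool (\<exists>k\<in>{..d}. J \<le> real (card {w\<in>S. i w + g f w = k}))))"
  proof (intro avg_cong)
    fix f i :: "'a \<Rightarrow> nat"
    have 1: "g (\<lambda>a. if a \<in> S' then f a else i a) w = g f w" for w by (rule g) simp
    have "w \<notin> S'" if "w \<in> S" for w using that disj by auto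
    hence "{w\<in>S. (\<lambda>a. if a \<in> S' then f a else i a) w + g (\<lambda>a. if a \<in> S' then f a else i a) w = k} = {w\<in>S. i w + g f w = k}" for k
      unfolding 1 by auto
    thus "of_bool (\<exists>k\<in>{..d}. J \<le> real (card {w\<in>S. (\<lambda>a. if a \<in> S' then f a else i a) w + g (\<lambda>a. if a \<in> S' then f a else i a) w = k})) =
       (of_bool (\<exists>k\<in>{..d}. J \<le> real (card {w\<in>S. i w + g f w = k})) :: real)" by simp
  qed
  also have "\<dots> \<le> (real d + 1) * exp (- \<theta> * J + (exp \<theta> - 1) * (real (card S) / Dm))"
    by (rule avg_le_const[OF pS(2)]) (rule inner)
  finally show ?thesis .
qed

section \<open>Random roles and random labels\<close>

context regular_nbhds
begin

text \<open>
A label 0 puts a vertex into \<open>B\<close> and a label from 1 to \<open>q\<close> puts it into \<open>P\<close>, out of \<open>q\<^sup>2\<close> labels.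
\<close>

lemma roles_exist:
  fixes q :: nat
  assumes q: "q \<ge> 2" and small: "4 * real (card V) * exp (- (real d / (16 * real q^4))) < 1" and d0: "d > 0"
  shows "\<exists>P B. P \<subseteq> V \<and> B \<subseteq> V \<and> P \<inter> B = {} \<and> (\<forall>v\<in>V. real d / (2 * real q) \<le> real (card (N v \<inter> P)) \<and> real (card (N v \<inter> P)) \<le> 2 * real d / real q
     \<and> real d / (2 * real q^2) \<le> real (card (N v \<inter> B)) \<and> real (card (N v \<inter> B)) \<le> 2 * real d / real q^2)"
proof -
  define C where "C = (labels (q^2) :: 'a \<Rightarrow> nat set)"
  define QB where "QB = (\<lambda>(v::'a) (c::nat). c = 0)"
  define QP where "QP = (\<lambda>(v::'a) (c::nat). 1 \<le> c \<and> c \<le> q)"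
  have qq: "real q \<ge> 2" using q by simp
  have pr: "proper V C" unfolding C_def using finV q by (intro proper_labels) auto
  have frB: "freq C QB v = 1 / real q^2" for v
  proof -
    have "{c \<in> {..<q^2}. c = 0} = {0}" using q by auto
    thus ?thesis by (simp add: freq_def C_def QB_def)
  qed
  have frP: "freq C QP v = 1 / real q" for v
  proof -
    have "q < q^2" using q by (simp add: power2_eq_square)
    hence "{c \<in> {..<q^2}. 1 \<le> c \<and> c \<le> q} = {1..q}" by auto
    thus ?thesis using q by (simp add: freq_def C_def QP_def power2_eq_square)
  qed
  define dev where "dev = (\<lambda>(Q :: 'a \<Rightarrow> nat \<Rightarrow> bool) (p::real) f v. real d * p / 2 \<le> \<bar>(\<Sum>a\<in>N v. of_bool (Q a (f a))) - real d * p\<bar>)"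
  have dv: "avg V C (\<lambda>f. of_bool (dev Q p f v)) \<le> 2 * exp (- (real d / (16 * real q^4)))"
    if fr: "\<And>a. freq C Q a = p" and p: "p \<ge> 1 / real q^2" "p \<le> 1" and v: "v \<in> V" for Q p v
  proof -
    have s: "(\<Sum>a\<in>N v. freq C Q a) = real d * p" using fr N_card[OF v] by simp
    have p0: "p \<ge> 0" using p by (smt (verit) divide_nonneg_nonneg zero_le_power2)
    have dp: "real d * p \<le> real d" using p by (simp add: mult_left_le)
    have "avg V C (\<lambda>f. of_bool (dev Q p f v)) \<le> 2 * exp (- ((real d * p / 2)^2) / (4 * real d))"
      unfolding dev_def s[symmetric]
      by (rule count_deviation[OF pr]) (use N_sub[OF v] p0 dp d0 in \<open>auto simp: s\<close>)
    also have "\<dots> \<le> 2 * exp (- (real d / (16 * real q^4)))"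
    proof -
      have "(1 / real q^2)^2 \<le> p^2" using p by (intro power_mono) auto
      hence "1 / real q^4 \<le> p^2" by (simp add: power_divide)
      hence "real d / 16 * (1 / real q^4) \<le> real d / 16 * p^2" by (intro mult_left_mono) auto
      moreover have "(real d * p / 2)^2 / (4 * real d) = real d / 16 * p^2" using d0 by (simp add: power2_eq_square)
      ultimately show ?thesis by simp
    qed
    finally show ?thesis .
  qed
  have "avg V C (\<lambda>f. of_bool (\<exists>v\<in>V. dev QP (1 / real q) f v \<or> dev QB (1 / real q^2) f v))
      \<le> (\<Sum>v\<in>V. avg V C (\<lambda>f. of_bool (dev QP (1 / real q) f v \<or> dev QB (1 / real q^2) f v)))"
    by (rule avg_union_bound[OF finV])
  also have "\<dots> \<le> (\<Sum>v\<in>V. 2 * exp (- (real d / (16 * real q^4))) + 2 * exp (- (real d / (16 * real q^4))))"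
  proof (rule sum_mono)
    fix v assume v: "v \<in> V"
    have q2: "1 / real q^2 \<le> 1 / real q" "1 / real q \<le> 1" "1 / real q ^ 2 \<le> 1" using qq mult_mono[of 1 "real q" 1 "real q"] by (auto simp: power2_eq_square field_simps)
    show "avg V C (\<lambda>f. of_bool (dev QP (1 / real q) f v \<or> dev QB (1 / real q^2) f v)) \<le> 2 * exp (- (real d / (16 * real q^4))) + 2 * exp (- (real d / (16 * real q^4)))"
      by (rule order.trans[OF avg_disj add_mono[OF dv[OF frP] dv[OF frB]]]) (use q2 v in auto)
  qed
  also have "\<dots> = 4 * real (card V) * exp (- (real d / (16 * real q^4)))" by simp
  also note small
  finally obtain f where "of_bool (\<exists>v\<in>V. dev QP (1 / real q) f v \<or> dev QB (1 / real q^2) f v) < (1::real)"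
    using avg_exists[OF pr] by blast
  hence f: "\<not> dev QP (1 / real q) f v" "\<not> dev QB (1 / real q^2) f v" if "v \<in> V" for v
    using that by (auto split: if_splits simp: of_bool_def)
  define P where "P = {v\<in>V. QP v (f v)}"
  define B where "B = {v\<in>V. QB v (f v)}"
  have cnt: "(\<Sum>a\<in>N v. of_bool (Q a (f a)) :: real) = real (card (N v \<inter> {v\<in>V. Q v (f v)}))" if v: "v \<in> V" for Q v
  proof -
    have "N v \<inter> {a. Q a (f a)} = N v \<inter> {v\<in>V. Q v (f v)}" using N_sub[OF v] by auto
    thus ?thesis using finN[OF v] by simp
  qed
  have "real d / (2 * real q) \<le> real (card (N v \<inter> P)) \<and> real (card (N v \<inter> P)) \<le> 2 * real d / real q
     \<and> real d / (2 * real q^2) \<le> real (card (N v \<inter> B)) \<and> real (card (N v \<inter> B)) \<le> 2 * real d / real q^2" if v: "v \<in> V" for v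
  proof -
    have a: "\<bar>real (card (N v \<inter> P)) - real d / real q\<bar> < real d / real q / 2"
      using f(1)[OF v] unfolding dev_def P_def cnt[OF v, symmetric] by simp
    have b: "\<bar>real (card (N v \<inter> B)) - real d / real q^2\<bar> < real d / real q^2 / 2"
      using f(2)[OF v] unfolding dev_def B_def cnt[OF v, symmetric] by simp
    define x y where "x = real d / real q" and "y = real d / real q^2"
    have "x \<ge> 0" "y \<ge> 0" by (auto simp: x_def y_def)
    moreover have e: "real d / (2 * real q) = x / 2" "real d / (2 * real q^2) = y / 2"
      "2 * real d / real q = 2 * x" "2 * real d / real q^2 = 2 * y" by (auto simp: x_def y_def)
    moreover have "c \<le> 2 * z \<and> z / 2 \<le> c" if "\<bar>c - z\<bar> < z / 2" for c z :: real
      using that by (auto simp: abs_if split: if_splits)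
    ultimately show ?thesis using a b unfolding e x_def[symmetric] y_def[symmetric] by blast
  qed
  moreover have "P \<subseteq> V" "B \<subseteq> V" "P \<inter> B = {}" by (auto simp: P_def B_def QP_def QB_def)
  ultimately show ?thesis by blast
qed

text \<open>
Three random events, each failing with probability at most 1/4: all neighbourhoods see the labels
equidistributed, and the cumulative counts are large enough both for the labels (\<open>\<tau> = 0\<close>) and for
the reflected labels (\<open>\<tau> = 1\<close>).
\<close>

lemma labels_exist:
  fixes \<eta> s :: real
  defines "r \<equiv> exp (- (\<eta>^2) / 256)"
  assumes A: "A \<subseteq> V" and dn: "dense_nbhds A (\<lambda>u. N u \<inter> A) d NN"
    and \<eta>: "0 < \<eta>" "\<eta> \<le> 1" and K: "8 \<le> \<eta> * real K" "2 * K \<le> d" and Ad: "d \<le> card A"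
    and s: "0 \<le> s" "s \<le> 2 * real d"
    and small: "real (card V) * (real NN + 1) * (2 * exp (- (s^2) / (4 * real d))) \<le> 1/4"
      "real K * (183 * real d / (\<eta>^2 * real (card A)) + 200 / (\<eta>^2 * real d)) + 9 / \<eta> * (r ^ K / (1 - r)) \<le> 1/4"
  shows "\<exists>f\<in>Pi\<^sub>E A (labels NN).
     (\<forall>v\<in>V. \<forall>c\<le>NN. \<bar>real (card {u\<in>N v \<inter> A. c \<le> f u}) - (1 - real c / real NN) * real (card (N v \<inter> A))\<bar> < s) \<and>
     (\<forall>\<tau>\<le>1. \<forall>g. g = (if \<tau> = 0 then f else (\<lambda>a. NN - 1 - f a)) \<longrightarrow> (\<forall>k\<in>{1..d}. (1 - \<eta>) * real k * real (card A) / real d \<le>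
        real (card {u \<in> A. thr NN \<tau> g (N u \<inter> A) u < k \<and> (k < K \<or> real (g u) * real d < (1 - \<eta>/4) * real k * real NN)})))"
proof -
  note finNv = finN
  interpret dense_nbhds A "\<lambda>u. N u \<inter> A" d NN by (rule dn)
  define low where "low = (\<lambda>\<tau> f. \<exists>k\<in>{1..d}. real (card {u \<in> A. thr NN \<tau> f (N u \<inter> A) u < k \<and>
            (k < K \<or> real (f u) * real d < (1 - \<eta>/4) * real k * real NN)}) < (1 - \<eta>) * real k * real (card A) / real d)"
  have lowb: "avg A (labels NN) (\<lambda>f. of_bool (low \<tau> f)) \<le> 1/4" if "\<tau> \<le> 1" for \<tau>
    using low_counts[OF that \<eta> K Ad] small(2) unfolding low_def r_def by linarith
  define refl where "refl = (\<lambda>f::'a\<Rightarrow>nat. restrict (\<lambda>a. NN - 1 - f a) A)"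
  have refl: "refl f \<in> Pi\<^sub>E A (labels NN)" for f unfolding refl_def using NN_pos by (auto simp: PiE_def Pi_def)
  have rr: "refl (refl f) = f" if "f \<in> Pi\<^sub>E A (labels NN)" for f
  proof
    fix a
    show "refl (refl f) a = f a"
    proof (cases "a \<in> A")
      case True
      hence "f a < NN" using that by auto
      thus ?thesis using True by (simp add: refl_def)
    next
      case False
      thus ?thesis using that by (auto simp: refl_def PiE_def extensional_def)
    qed
  qed
  have "bij_betw refl (Pi\<^sub>E A (labels NN)) (Pi\<^sub>E A (labels NN))"
    by (rule bij_betwI[where g=refl]) (use refl rr in auto)
  hence topb: "avg A (labels NN) (\<lambda>f. of_bool (low 1 (refl f))) \<le> 1/4"
    using avg_reindex[of refl A "labels NN" "\<lambda>f. of_bool (low 1 f)"] lowb[of 1] by simp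
  define dev where "dev = (\<lambda>f v c. s \<le> \<bar>real (card {u\<in>N v \<inter> A. c \<le> f u}) - (1 - real c / real NN) * real (card (N v \<inter> A))\<bar>)"
  have devb: "avg A (labels NN) (\<lambda>f. of_bool (dev f v c)) \<le> 2 * exp (- (s^2) / (4 * real d))" if v: "v \<in> V" and c: "c \<le> NN" for v c
  proof -
    let ?Q = "\<lambda>u x. c \<le> x"
    have "freq (labels NN) ?Q u = 1 - real c / real NN" for u :: 'a
    proof -
      have "{x\<in>{..<NN}. c \<le> x} = {c..<NN}" by auto
      thus ?thesis using c NN_pos by (simp add: freq_def of_nat_diff diff_divide_distrib)
    qed
    hence sm: "(\<Sum>u\<in>N v \<inter> A. freq (labels NN) ?Q u) = (1 - real c / real NN) * real (card (N v \<inter> A))" by simp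
    have cN: "card (N v \<inter> A) \<le> d" using card_mono[OF finNv[OF v], of "N v \<inter> A"] N_card[OF v] by simp
    have fin: "finite (N v \<inter> A)" using finNv[OF v] by simp
    have "(1 - real c / real NN) * real (card (N v \<inter> A)) \<le> 1 * real d" using cN c NN_pos by (intro mult_mono) auto
    hence "avg A (labels NN) (\<lambda>f. of_bool (s \<le> \<bar>(\<Sum>u\<in>N v \<inter> A. of_bool (?Q u (f u))) - (\<Sum>u\<in>N v \<inter> A. freq (labels NN) ?Q u)\<bar>)) \<le> 2 * exp (- (s^2) / (4 * real d))"
      by (intro count_deviation[OF pA]) (use s d8 in \<open>auto simp: sm\<close>)
    moreover have "(\<Sum>u\<in>N v \<inter> A. of_bool (?Q u (f u)) :: real) = real (card {u\<in>N v \<inter> A. c \<le> f u})" for f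
      using fin by (simp add: Int_def)
    ultimately show ?thesis unfolding dev_def sm by simp
  qed
  have disc: "avg A (labels NN) (\<lambda>f. of_bool (\<exists>x\<in>V \<times> {..NN}. dev f (fst x) (snd x))) \<le> 1/4"
  proof -
    have "avg A (labels NN) (\<lambda>f. of_bool (\<exists>x\<in>V \<times> {..NN}. dev f (fst x) (snd x)))
      \<le> (\<Sum>x\<in>V \<times> {..NN}. avg A (labels NN) (\<lambda>f. of_bool (dev f (fst x) (snd x))))"
      by (rule avg_union_bound) (use finV in simp)
    also have "\<dots> \<le> (\<Sum>x\<in>V \<times> {..NN}. 2 * exp (- (s^2) / (4 * real d)))"
      by (intro sum_mono devb) auto
    also have "\<dots> = real (card V) * (real NN + 1) * (2 * exp (- (s^2) / (4 * real d)))"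
      by (simp add: card_cartesian_product algebra_simps)
    finally show ?thesis using small(1) by linarith
  qed
  have "avg A (labels NN) (\<lambda>f. of_bool ((\<exists>x\<in>V \<times> {..NN}. dev f (fst x) (snd x)) \<or> (low 0 f \<or> low 1 (refl f)))) < 1"
  proof -
    have "avg A (labels NN) (\<lambda>f. of_bool (low 0 f \<or> low 1 (refl f))) \<le> 1/4 + 1/4"
      by (rule order.trans[OF avg_disj add_mono[OF lowb topb]]) simp
    from order.trans[OF avg_disj add_mono[OF disc this]] show ?thesis by (rule le_less_trans) simp
  qed
  then obtain f where f: "f \<in> Pi\<^sub>E A (labels NN)" "of_bool ((\<exists>x\<in>V \<times> {..NN}. dev f (fst x) (snd x)) \<or> (low 0 f \<or> low 1 (refl f))) < (1::real)"
    using avg_exists[OF pA] by blast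
  have g: "\<not> dev f v c" if "v \<in> V" "c \<le> NN" for v c
  proof
    assume "dev f v c"
    hence "\<exists>x\<in>V \<times> {..NN}. dev f (fst x) (snd x)" using that by (intro bexI[of _ "(v, c)"]) auto
    thus False using f(2) by simp
  qed
  have l: "\<not> low 0 f" "\<not> low 1 (refl f)" using f(2) by (auto simp: of_bool_def split: if_splits)
  have eq: "low 1 (refl f) = low 1 (\<lambda>a. NN - 1 - f a)"
  proof -
    have "thr NN 1 (refl f) (N u \<inter> A) u = thr NN 1 (\<lambda>a. NN - 1 - f a) (N u \<inter> A) u" if "u \<in> A" for u
      unfolding thr_def by (rule arg_cong[where f=card]) (use that in \<open>auto simp: refl_def\<close>)
    hence "{u \<in> A. thr NN 1 (refl f) (N u \<inter> A) u < k \<and> (k < K \<or> real (refl f u) * real d < (1 - \<eta>/4) * real k * real NN)} =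
      {u \<in> A. thr NN 1 (\<lambda>a. NN - 1 - f a) (N u \<inter> A) u < k \<and> (k < K \<or> real (NN - 1 - f u) * real d < (1 - \<eta>/4) * real k * real NN)}" for k
      by (auto simp: refl_def)
    thus ?thesis by (simp only: low_def)
  qed
  have "\<not> low \<tau> g" if "\<tau> \<le> 1" "g = (if \<tau> = 0 then f else (\<lambda>a. NN - 1 - f a))" for \<tau> g
    using l that unfolding eq by (cases "\<tau> = 0") (auto simp: le_Suc_eq)
  hence "\<forall>\<tau>\<le>1. \<forall>g. g = (if \<tau> = 0 then f else (\<lambda>a. NN - 1 - f a)) \<longrightarrow> (\<forall>k\<in>{1..d}. (1 - \<eta>) * real k * real (card A) / real d \<le>
        real (card {u \<in> A. thr NN \<tau> g (N u \<inter> A) u < k \<and> (k < K \<or> real (g u) * real d < (1 - \<eta>/4) * real k * real NN)}))"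
    unfolding low_def by (auto simp only: not_less bex_simps)
  thus ?thesis using g f(1) unfolding dev_def not_le by blast
qed

end

section \<open>Configurations and their targets\<close>

context regular_nbhds
begin

lemma double_count:
  assumes "U \<subseteq> V"
  shows "(\<Sum>v\<in>V. card (N v \<inter> U)) = d * card U"
proof -
  have finU: "finite U" using assms finV finite_subset by blast
  have "(\<Sum>v\<in>V. card (N v \<inter> U)) = (\<Sum>v\<in>V. \<Sum>u\<in>U. of_bool (u \<in> N v))"
    by (intro sum.cong refl) (use finU in \<open>simp add: Int_def conj_commute\<close>)
  also have "\<dots> = (\<Sum>u\<in>U. \<Sum>v\<in>V. of_bool (u \<in> N v))" by (rule sum.swap)
  also have "\<dots> = (\<Sum>u\<in>U. d)"
  proof (rule sum.cong[OF refl])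
    fix u assume u: "u \<in> U"
    have "{v\<in>V. u \<in> N v} = N u" using N_sub N_sym u assms by blast
    hence "card {v\<in>V. u \<in> N v} = d" using N_card[of u] u assms by auto
    thus "(\<Sum>v\<in>V. of_bool (u \<in> N v)) = d" using finV by (simp add: Int_def)
  qed
  finally show ?thesis by simp
qed

end

text \<open>
The outcome of the first two random choices: the roles \<open>A\<close>, \<open>P\<close>, \<open>B\<close> of the vertices and the labels
\<open>x\<close> of the vertices in \<open>A\<close>. The labels below \<open>m0\<close> and from \<open>NN - m0\<close> on, a fraction of \<open>1/q\<^sup>3\<close> at either
end, are treated separately.
\<close>

locale configuration = regular_nbhds V N d
  for V :: "'a set" and N :: "'a \<Rightarrow> 'a set" and d :: nat +
  fixes A P B :: "'a set" and x :: "'a \<Rightarrow> nat" and NN m0 q K :: nat and \<gamma> :: real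
  assumes parts: "V = A \<union> P \<union> B" "A \<inter> P = {}" "A \<inter> B = {}" "P \<inter> B = {}"
    and NP: "v \<in> V \<Longrightarrow> real d / (2 * real q) \<le> real (card (N v \<inter> P))" "v \<in> V \<Longrightarrow> real (card (N v \<inter> P)) \<le> 2 * real d / real q"
    and NB: "v \<in> V \<Longrightarrow> real d / (2 * real q^2) \<le> real (card (N v \<inter> B))" "v \<in> V \<Longrightarrow> real (card (N v \<inter> B)) \<le> 2 * real d / real q^2"
    and NN: "NN = q^3 * m0" "q^5 \<le> NN"
    and x_less: "v \<in> A \<Longrightarrow> x v < NN"
    and disc: "v \<in> V \<Longrightarrow> c \<le> NN \<Longrightarrow> \<bar>real (card {u\<in>N v \<inter> A. c \<le> x u}) - (1 - real c / real NN) * real (card (N v \<inter> A))\<bar> < real d / real q^5"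
    and low: "\<tau> \<le> 1 \<Longrightarrow> g = (if \<tau> = 0 then x else (\<lambda>a. NN - 1 - x a)) \<Longrightarrow> k \<in> {1..d} \<Longrightarrow> (1 - \<gamma>/4) * real k * real (card A) / real d \<le>
        real (card {u \<in> A. thr NN \<tau> g (N u \<inter> A) u < k \<and> (k < K \<or> real (g u) * real d < (1 - \<gamma>/4/4) * real k * real NN)})"
    and \<gamma>: "0 < \<gamma>" "\<gamma> \<le> 1" and q: "real q * \<gamma> \<ge> 2000" "q^10 \<le> d" "K \<le> q" and Vne: "V \<noteq> {}"
begin

definition "Q = real q"
definition "dd = real d"
definition "n = real (card V)"
definition "a = real (card A)"
text \<open>
The number of levels for the vertices with labels below \<open>m0\<close>. They would occupy \<open>d/q\<^sup>3\<close> levels; the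
factor \<open>1 + \<gamma>\<close> makes room for raising their degrees.
\<close>

definition "L0 = nat \<lceil>(1 + \<gamma>) * dd / Q^3\<rceil>"

lemma Q_ge: "Q \<ge> 2000" "Q * \<gamma> \<ge> 2000" "Q > 0"
proof -
  show 1: "Q * \<gamma> \<ge> 2000" using q by (simp add: Q_def)
  have "Q * \<gamma> \<le> Q * 1" using \<gamma> by (intro mult_left_mono) (auto simp: Q_def)
  thus 2: "Q \<ge> 2000" using 1 by simp
  thus "Q > 0" by simp
qed

lemma dd_ge: "dd \<ge> Q^10"
proof -
  have "real (q^10) \<le> real d" using q(2) by (simp only: of_nat_le_iff)
  thus ?thesis by (simp add: dd_def Q_def)
qed

lemma dd_pos: "dd > 0"
  using dd_ge Q_ge by (meson less_le_trans zero_less_power)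

lemma n_pos: "n > 0" using Vne finV by (auto simp: n_def card_gt_0_iff)

lemma subs: "A \<subseteq> V" "P \<subseteq> V" "B \<subseteq> V" using parts by auto

lemma fins: "finite A" "finite P" "finite B" using parts(1) finV by auto

lemma deg_split: "v \<in> V \<Longrightarrow> dd = real (card (N v \<inter> A)) + real (card (N v \<inter> P)) + real (card (N v \<inter> B))"
proof -
  assume v: "v \<in> V"
  have "N v = (N v \<inter> A) \<union> (N v \<inter> P) \<union> (N v \<inter> B)" using N_sub[OF v] parts by auto
  hence "card (N v) = card ((N v \<inter> A) \<union> (N v \<inter> P) \<union> (N v \<inter> B))" by simp
  also have "\<dots> = card (N v \<inter> A) + card (N v \<inter> P) + card (N v \<inter> B)"
    using finN[OF v] parts by (subst card_Un_disjoint; (subst card_Un_disjoint)?) auto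
  finally have "d = card (N v \<inter> A) + card (N v \<inter> P) + card (N v \<inter> B)" unfolding N_card[OF v] .
  hence "real d = real (card (N v \<inter> A) + card (N v \<inter> P) + card (N v \<inter> B))" by (rule arg_cong)
  thus ?thesis unfolding dd_def by simp
qed

lemma Q_powers: "1 / Q^2 \<le> 1 / Q / 2000" "1 / Q^3 \<le> 1 / Q^2 / 2000" "1 / Q^4 \<le> 1 / Q^3 / 2000" "1 / Q^5 \<le> 1 / Q^4 / 2000" "1 / Q \<le> 1/2000"
proof -
  have *: "1 / Q^(Suc i) \<le> 1 / Q^i / 2000" for i
  proof -
    have "Q^i * 2000 \<le> Q^i * Q" using Q_ge by (intro mult_left_mono) auto
    hence "1 / (Q^i * Q) \<le> 1 / (Q^i * 2000)" using Q_ge by (intro divide_left_mono) auto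
    thus ?thesis by (simp add: mult.commute)
  qed
  show "1 / Q^2 \<le> 1 / Q / 2000" using *[of 1] by (simp add: numeral_2_eq_2)
  show "1 / Q^3 \<le> 1 / Q^2 / 2000" using *[of 2] by (simp add: eval_nat_numeral)
  show "1 / Q^4 \<le> 1 / Q^3 / 2000" using *[of 3] by (simp add: eval_nat_numeral)
  show "1 / Q^5 \<le> 1 / Q^4 / 2000" using *[of 4] by (simp add: eval_nat_numeral)
  show "1 / Q \<le> 1/2000" using *[of 0] by simp
qed

lemma Q_inverse_small: "k \<ge> 1 \<Longrightarrow> 1 / Q^k \<le> 1/2000"
proof -
  assume "k \<ge> 1"
  hence "Q^1 \<le> Q^k" using Q_ge by (intro power_increasing) auto
  hence "2000 \<le> Q^k" using Q_ge by simp
  thus ?thesis by (intro divide_left_mono) auto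
qed

lemma Q_powers_pos: "1 / Q > 0" "1 / Q^2 > 0" "1 / Q^3 > 0" "1 / Q^4 > 0" "1 / Q^5 > 0"
  using Q_ge by auto

lemma NA: "v \<in> V \<Longrightarrow> real (card (N v \<inter> A)) \<le> dd" "v \<in> V \<Longrightarrow> real (card (N v \<inter> A)) \<ge> dd * (1 - 3 / Q)" "v \<in> V \<Longrightarrow> real (card (N v \<inter> A)) \<ge> dd / 2"
proof -
  assume v: "v \<in> V"
  show "real (card (N v \<inter> A)) \<le> dd" using deg_split[OF v] by linarith
  define u w where "u = dd * (1/Q)" and "w = dd * (1/Q^2)"
  have "real (card (N v \<inter> P)) \<le> 2 * u" "real (card (N v \<inter> B)) \<le> 2 * w"
    using NP(2)[OF v] NB(2)[OF v] by (auto simp: dd_def Q_def u_def w_def)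
  moreover have "2000 * w \<le> u"
    using mult_left_mono[OF Q_powers(1), of "2000 * dd"] dd_pos by (simp add: u_def w_def)
  moreover have "u \<ge> 0" using Q_ge dd_pos by (simp add: u_def)
  ultimately have "real (card (N v \<inter> A)) \<ge> dd - 3 * u" using deg_split[OF v] by linarith
  thus 1: "real (card (N v \<inter> A)) \<ge> dd * (1 - 3 / Q)" by (simp add: u_def algebra_simps)
  have "dd * (1/2) \<le> dd * (1 - 3 / Q)" using Q_powers(5) dd_pos by (intro mult_left_mono) auto
  thus "real (card (N v \<inter> A)) \<ge> dd / 2" using 1 by linarith
qed

lemma double_count_real: "U \<subseteq> V \<Longrightarrow> (\<Sum>v\<in>V. real (card (N v \<inter> U))) = dd * real (card U)"
  using double_count[of U] unfolding dd_def by (metis of_nat_mult of_nat_sum)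

lemma a_bounds: "a \<le> n" "a \<ge> n * (1 - 3 / Q)" "a \<ge> n / 2"
proof -
  show "a \<le> n" using card_mono[OF finV subs(1)] by (simp add: a_def n_def)
  have "(\<Sum>v\<in>V. dd * (1 - 3 / Q)) \<le> (\<Sum>v\<in>V. real (card (N v \<inter> A)))" by (intro sum_mono NA(2))
  hence "dd * (n * (1 - 3 / Q)) \<le> dd * a" unfolding double_count_real[OF subs(1)] by (simp add: n_def a_def mult_ac)
  thus 1: "a \<ge> n * (1 - 3 / Q)" using dd_pos by simp
  have "n * (1/2) \<le> n * (1 - 3 / Q)" using Q_powers(5) n_pos by (intro mult_left_mono) auto
  thus "a \<ge> n / 2" using 1 by linarith
qed

lemma a_pos: "a > 0" using a_bounds(3) n_pos by simp

lemma card_P: "real (card P) \<le> 2 * n / Q"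
proof -
  have "dd * real (card P) = (\<Sum>v\<in>V. real (card (N v \<inter> P)))" using double_count_real[OF subs(2)] by simp
  also have "\<dots> \<le> (\<Sum>v\<in>V. 2 * dd / Q)" unfolding dd_def Q_def by (intro sum_mono NP(2))
  also have "\<dots> = dd * (2 * n / Q)" by (simp add: n_def)
  finally show ?thesis by (rule mult_left_le_imp_le[OF _ dd_pos])
qed

lemma card_B: "real (card B) \<le> 2 * n / Q^2"
proof -
  have "dd * real (card B) = (\<Sum>v\<in>V. real (card (N v \<inter> B)))" using double_count_real[OF subs(3)] by simp
  also have "\<dots> \<le> (\<Sum>v\<in>V. 2 * dd / Q^2)" unfolding dd_def Q_def by (intro sum_mono NB(2))
  also have "\<dots> = dd * (2 * n / Q^2)" by (simp add: n_def)
  finally show ?thesis by (rule mult_left_le_imp_le[OF _ dd_pos])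
qed

text \<open>
Equidistribution in every neighbourhood implies equidistribution in \<open>A\<close>, by double counting.
\<close>

lemma count_above: 
  assumes c: "c \<le> NN"
  shows "\<bar>real (card {u\<in>A. c \<le> x u}) - (1 - real c / real NN) * a\<bar> \<le> n / Q^5"
proof -
  let ?U = "{u\<in>A. c \<le> x u}"
  have "dd * (real (card ?U) - (1 - real c / real NN) * a) = (\<Sum>v\<in>V. real (card (N v \<inter> ?U)) - (1 - real c / real NN) * real (card (N v \<inter> A)))"
  proof -
    have "?U \<subseteq> V" using subs by auto
    thus ?thesis unfolding sum_subtractf sum_distrib_left[symmetric] a_def
      by (simp add: double_count_real subs algebra_simps)
  qed
  note eq = this
  have "dd * \<bar>real (card ?U) - (1 - real c / real NN) * a\<bar> = \<bar>dd * (real (card ?U) - (1 - real c / real NN) * a)\<bar>"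
    using dd_pos by (simp add: abs_mult)
  also have "\<dots> = \<bar>\<Sum>v\<in>V. real (card (N v \<inter> ?U)) - (1 - real c / real NN) * real (card (N v \<inter> A))\<bar>"
    by (simp only: eq)
  also have "\<dots> \<le> (\<Sum>v\<in>V. \<bar>real (card (N v \<inter> ?U)) - (1 - real c / real NN) * real (card (N v \<inter> A))\<bar>)"
    by (rule sum_abs)
  also have "\<dots> \<le> (\<Sum>v\<in>V. dd / Q^5)"
  proof (rule sum_mono)
    fix v assume v: "v \<in> V"
    have "N v \<inter> ?U = {u\<in>N v \<inter> A. c \<le> x u}" by auto
    thus "\<bar>real (card (N v \<inter> ?U)) - (1 - real c / real NN) * real (card (N v \<inter> A))\<bar> \<le> dd / Q^5"
      using disc[OF v c] by (simp add: dd_def Q_def)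
  qed
  also have "\<dots> = dd * (n / Q^5)" by (simp add: n_def)
  finally show ?thesis by (rule mult_left_le_imp_le[OF _ dd_pos])
qed

lemma NN_pos: "NN > 0"
proof -
  have "q > 0" using Q_ge by (simp add: Q_def)
  hence "q^5 > 0" by simp
  thus ?thesis using NN(2) by linarith
qed

lemma m0_ratio: "real m0 / real NN = 1 / Q^3" "m0 > 0" "m0 \<le> NN" "2 * m0 \<le> NN"
proof -
  show m: "m0 > 0" using NN_pos NN(1) by (cases m0) auto
  show "real m0 / real NN = 1 / Q^3" using m NN(1) by (simp add: Q_def)
  have q2: "q \<ge> 2" using Q_ge by (simp add: Q_def)
  hence "2 \<le> q^3" using self_le_power[of q 3] by linarith
  thus "2 * m0 \<le> NN" unfolding NN(1) by (rule mult_le_mono1)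
  thus "m0 \<le> NN" by simp
qed

lemma L0_bounds: "real L0 \<ge> (1 + \<gamma>) * dd / Q^3" "real L0 \<le> (1 + \<gamma>) * dd / Q^3 + 1" "L0 > 0" "real L0 \<le> 3 * dd / Q^3"
proof -
  have pos: "(1 + \<gamma>) * dd / Q^3 > 0" using \<gamma> dd_pos Q_ge by simp
  show 1: "real L0 \<ge> (1 + \<gamma>) * dd / Q^3" unfolding L0_def by (rule real_nat_ceiling_ge)
  show 2: "real L0 \<le> (1 + \<gamma>) * dd / Q^3 + 1" unfolding L0_def using pos by linarith
  show "L0 > 0" using 1 pos by linarith
  have "1 \<le> dd / Q^3"
  proof -
    have "Q^3 \<le> Q^10" using Q_ge by (intro power_increasing) auto
    hence "Q^3 \<le> dd" using dd_ge by (rule order.trans)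
    thus ?thesis using Q_ge by (simp add: le_divide_eq)
  qed
  moreover have "(1 + \<gamma>) * (dd / Q^3) \<le> 2 * (dd / Q^3)" using \<gamma> dd_pos Q_ge by (intro mult_right_mono) auto
  ultimately show "real L0 \<le> 3 * dd / Q^3" using 2 by simp
qed

text \<open>
The vertices with small labels, in the order of their threshold degrees, are cut into \<open>L0\<close> blocks of
equal size, the targets. A vertex of threshold degree \<open>k\<close> is preceded by all vertices of smaller
threshold degree, and these fill the first \<open>k\<close> blocks by the lower bound on cumulative counts.
\<close>

lemma low_assignment:
  assumes \<tau>: "\<tau> \<le> 1" and g: "g = (if \<tau> = 0 then x else (\<lambda>a. NN - 1 - x a))"
    and i: "\<And>v. v \<in> A \<Longrightarrow> g v < m0 \<Longrightarrow> real (thr NN \<tau> g (N v \<inter> A) v) \<le> dd / Q^3 + dd / Q^5"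
    and ii: "\<And>v. v \<in> A \<Longrightarrow> m0 \<le> g v \<Longrightarrow> K \<le> thr NN \<tau> g (N v \<inter> A) v"
    and iv: "real (card {v\<in>A. g v < m0}) \<le> a / Q^3 * (1 + 2 / Q^2)"
  shows "\<exists>t. (\<forall>v\<in>A. g v < m0 \<longrightarrow> thr NN \<tau> g (N v \<inter> A) v \<le> t v \<and> t v < L0) \<and>
     (\<forall>k<L0. \<bar>real (card {v\<in>A. g v < m0 \<and> t v = k}) - real (card {v\<in>A. g v < m0}) / real L0\<bar> \<le> 1)"
proof -
  define b where "b = (\<lambda>v. thr NN \<tau> g (N v \<inter> A) v)"
  define S where "S = {v\<in>A. g v < m0}"
  have finS: "finite S" using fins by (simp add: S_def)
  obtain r where r: "bij_betw r S {..<card S}" "\<forall>u\<in>S. \<forall>v\<in>S. b u < b v \<longrightarrow> r u < r v"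
    using ranking_exists[OF finS, of b] by blast
  define t where "t = (\<lambda>v. (r v * L0) div card S)"
  have tb: "b v \<le> t v \<and> t v < L0" if v: "v \<in> S" for v
  proof
    have cS: "card S > 0" using v finS card_gt_0_iff by blast
    have rv: "r v < card S" using r(1) v by (auto simp: bij_betw_def)
    show "t v < L0" unfolding t_def
      using rv L0_bounds(3) by (intro less_mult_imp_div_less) (simp add: mult.commute)
    show "b v \<le> t v"
    proof (cases "b v = 0")
      case False
      define k where "k = b v"
      have k1: "k \<ge> 1" using False by (simp add: k_def)
      have kr: "real k \<le> dd * (1 / Q^3 + 1 / Q^5)"
        using i[of v] v unfolding k_def b_def S_def by (simp add: distrib_left)
      have "1 / Q^3 + 1 / Q^5 \<le> 1" using Q_inverse_small[of 3] Q_inverse_small[of 5] by simp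
      hence "dd * (1 / Q^3 + 1 / Q^5) \<le> dd * 1" using dd_pos by (intro mult_left_mono) auto
      hence kd: "k \<le> d" using kr by (simp add: dd_def)
      let ?X = "{u \<in> A. thr NN \<tau> g (N u \<inter> A) u < k \<and> (k < K \<or> real (g u) * real d < (1 - \<gamma>/4/4) * real k * real NN)}"
      have "?X \<subseteq> {u\<in>S. b u < b v}"
      proof
        fix u assume u: "u \<in> ?X"
        have "g u < m0"
        proof (cases "k < K")
          case True
          thus ?thesis using ii[of u] u by force
        next
          case False
          hence "real (g u) * dd < (1 - \<gamma>/4/4) * real k * real NN" using u by (auto simp: dd_def)
          also have "\<dots> \<le> (1 - \<gamma>/4/4) * (dd * (1 / Q^3 + 1 / Q^5)) * real NN"
            using \<gamma> kr by (intro mult_right_mono mult_left_mono) auto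
          also have "\<dots> = dd * (real NN * ((1 - \<gamma>/4/4) * (1 / Q^3 + 1 / Q^5)))" by simp
          also have "\<dots> \<le> dd * (real NN * (1 / Q^3))"
          proof (intro mult_left_mono)
            have "1 / Q^5 = 1 / Q^3 * (1/Q^2)" by (simp add: power_add[symmetric])
            moreover have "(1 - \<gamma>/4/4) * (1 + 1 / Q^2) \<le> 1"
            proof -
              have "1 / Q^2 \<le> \<gamma> / 16"
              proof -
                have "2000 * 1 \<le> (Q * \<gamma>) * Q" using Q_ge by (intro mult_mono) auto
                thus ?thesis using Q_ge by (simp add: field_simps power2_eq_square)
              qed
              hence "(1 - \<gamma>/4/4) * (1 + 1 / Q^2) \<le> (1 - \<gamma>/4/4) * (1 + \<gamma>/16)" using \<gamma> by (intro mult_left_mono) auto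
              also have "\<dots> = 1 - (\<gamma>/16) * (\<gamma>/16)" by (simp add: algebra_simps)
              also have "\<dots> \<le> 1" by simp
              finally show ?thesis .
            qed
            ultimately show "(1 - \<gamma>/4/4) * (1 / Q^3 + 1 / Q^5) \<le> 1 / Q^3"
              using mult_left_mono[of "(1 - \<gamma>/4/4) * (1 + 1 / Q^2)" 1 "1 / Q^3"] Q_powers_pos
              by (simp add: algebra_simps)
          qed (use dd_pos in auto)
          also have "real NN * (1 / Q^3) = real m0" using m0_ratio(1) NN_pos by (simp add: field_simps)
          finally have "dd * real (g u) < dd * real m0" by (simp add: mult.commute)
          thus ?thesis using dd_pos by simp
        qed
        thus "u \<in> {u\<in>S. b u < b v}" using u by (simp add: S_def b_def k_def)
      qed
      hence "card ?X \<le> card {u\<in>S. b u < b v}" by (rule card_mono[rotated]) (use finS in auto)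
      also have "\<dots> \<le> r v" by (rule ranking_bounds(1)[OF finS r v])
      finally have "real (card ?X) \<le> real (r v)" by simp
      moreover have "(1 - \<gamma>/4) * real k * a / dd \<le> real (card ?X)"
        unfolding a_def dd_def by (rule low[OF \<tau> g]) (use k1 kd in simp)
      ultimately have rv_ge: "real (r v) \<ge> (1 - \<gamma>/4) * real k * a / dd" by linarith
      have "real k * real (card S) \<le> real k * (a / Q^3 * (1 + 2 / Q^2))"
        using iv unfolding S_def by (intro mult_left_mono) auto
      also have "\<dots> \<le> real k * (a / Q^3 * ((1 - \<gamma>/4) * (1 + \<gamma>)))"
      proof -
        have "2 / Q^2 \<le> \<gamma>/2"
        proof -
          have "2000 * 1 \<le> (Q * \<gamma>) * Q" using Q_ge by (intro mult_mono) auto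
          thus ?thesis using Q_ge by (simp add: field_simps power2_eq_square)
        qed
        moreover have "\<gamma> * \<gamma> \<le> \<gamma> * 1" using \<gamma> by (intro mult_left_mono) auto
        moreover have "(1 - \<gamma>/4) * (1 + \<gamma>) = 1 + 3/4 * \<gamma> - (\<gamma> * \<gamma>) / 4" by (simp add: algebra_simps add_divide_distrib)
        moreover have "1 + w \<le> rhs" if "w \<le> \<gamma>/2" "\<gamma> * \<gamma> \<le> \<gamma> * 1" "rhs = 1 + 3/4 * \<gamma> - (\<gamma> * \<gamma>) / 4" for w rhs
          using that by linarith
        ultimately have "1 + 2 / Q^2 \<le> (1 - \<gamma>/4) * (1 + \<gamma>)" by blast
        thus ?thesis using a_pos Q_ge by (intro mult_left_mono) auto
      qed
      also have "\<dots> = ((1 - \<gamma>/4) * real k * a / dd) * ((1 + \<gamma>) * dd / Q^3)" using dd_pos by simp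
      also have "\<dots> \<le> real (r v) * real L0"
        using rv_ge L0_bounds(1) \<gamma> a_pos dd_pos Q_ge by (intro mult_mono) auto
      finally have "real (k * card S) \<le> real (r v * L0)" by simp
      hence "k * card S \<le> r v * L0" by (simp only: of_nat_le_iff)
      thus ?thesis unfolding t_def k_def[symmetric] using cS by (simp add: less_eq_div_iff_mult_less_eq)
    qed simp
  qed
  have lv: "\<bar>real (card {v\<in>S. t v = k}) - real (card S) / real L0\<bar> \<le> 1" if "k < L0" for k
    unfolding t_def by (rule level_counts[OF r(1) that])
  have e: "{v\<in>A. g v < m0 \<and> t v = k} = {v\<in>S. t v = k}" for k by (auto simp: S_def)
  show ?thesis
  proof (intro exI[of _ t] conjI ballI allI impI)
    fix v assume "v \<in> A" "g v < m0"
    hence "v \<in> S" by (simp add: S_def)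
    from tb[OF this] show "thr NN \<tau> g (N v \<inter> A) v \<le> t v" "t v < L0" by (simp_all add: b_def)
  next
    fix k assume "k < L0"
    from lv[OF this] show "\<bar>real (card {v\<in>A. g v < m0 \<and> t v = k}) - real (card {v\<in>A. g v < m0}) / real L0\<bar> \<le> 1"
      unfolding e S_def .
  qed
qed

definition "Low = {v\<in>A. x v < m0}"
definition "Top = {v\<in>A. NN - m0 \<le> x v}"
definition "Mid = {v\<in>A. m0 \<le> x v \<and> x v < NN - m0}"
text \<open>
The number of neighbours of \<open>v\<close> inside \<open>A\<close> in the subgraph.
\<close>

definition "h v = thr NN 0 x (N v \<inter> A) v"
definition "\<delta> = 1 / Q^3"
text \<open>
The error unit: labels are equidistributed in neighbourhoods up to \<open>\<omega>\<close>.
\<close>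

definition "\<omega> = dd / Q^5"
text \<open>
The label of \<open>v\<close>, rescaled to the unit interval.
\<close>

definition "\<xi> v = real (x v) / real NN"

lemma \<delta>_facts: "0 < \<delta>" "\<delta> \<le> 1/2000" "real m0 / real NN = \<delta>" "real (NN - m0) / real NN = 1 - \<delta>"
proof -
  show "0 < \<delta>" using Q_ge by (simp add: \<delta>_def)
  show "\<delta> \<le> 1/2000" using Q_inverse_small[of 3] by (simp add: \<delta>_def)
  show 1: "real m0 / real NN = \<delta>" using m0_ratio(1) by (simp add: \<delta>_def)
  have "real (NN - m0) / real NN = (real NN - real m0) / real NN" using m0_ratio(3) by (simp add: of_nat_diff)
  also have "\<dots> = 1 - \<delta>" using NN_pos 1 by (simp add: diff_divide_distrib)
  finally show "real (NN - m0) / real NN = 1 - \<delta>" .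
qed

lemma \<omega>_facts: "1 \<le> \<omega>" "dd = Q^5 * \<omega>" "dd / Q^4 = Q * \<omega>" "dd / Q^3 = Q^2 * \<omega>" "dd / Q^2 = Q^3 * \<omega>" "\<delta> * dd = Q^2 * \<omega>"
proof -
  have "Q^5 \<le> Q^10" using Q_ge by (intro power_increasing) auto
  hence "Q^5 \<le> dd" using dd_ge by (rule order.trans)
  thus "1 \<le> \<omega>" using Q_ge by (simp add: \<omega>_def)
  show "dd = Q^5 * \<omega>" "dd / Q^4 = Q * \<omega>" "dd / Q^3 = Q^2 * \<omega>" "dd / Q^2 = Q^3 * \<omega>" "\<delta> * dd = Q^2 * \<omega>"
    using Q_ge by (auto simp: \<omega>_def \<delta>_def field_simps power_numeral_reduce power2_eq_square)
qed

lemma A_partition: "A = Low \<union> Top \<union> Mid" "Low \<inter> Top = {}" "Low \<inter> Mid = {}" "Top \<inter> Mid = {}"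
  using m0_ratio(4) by (auto simp: Low_def Top_def Mid_def)

lemma \<xi>_range: "v \<in> A \<Longrightarrow> 0 \<le> \<xi> v \<and> \<xi> v \<le> 1"
  using x_less[of v] by (auto simp: \<xi>_def divide_le_eq)

lemma \<xi>_low: "v \<in> Low \<Longrightarrow> \<xi> v \<le> \<delta>" "v \<in> A \<Longrightarrow> v \<notin> Low \<Longrightarrow> \<delta> \<le> \<xi> v"
  unfolding \<delta>_facts(3)[symmetric] \<xi>_def by (auto simp: Low_def intro!: divide_right_mono)

lemma \<xi>_top: "v \<in> Top \<Longrightarrow> 1 - \<delta> \<le> \<xi> v" "v \<in> A \<Longrightarrow> v \<notin> Top \<Longrightarrow> \<xi> v \<le> 1 - \<delta>"
  unfolding \<delta>_facts(4)[symmetric] \<xi>_def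
  by (rule divide_right_mono; simp add: Top_def)+

lemma h_alt: "v \<in> A \<Longrightarrow> h v = card {u\<in>N v \<inter> A. NN - x v \<le> x u}"
  unfolding h_def thr_def by (rule arg_cong[where f=card]) auto

lemma h_approx: "v \<in> A \<Longrightarrow> \<bar>real (h v) - \<xi> v * real (card (N v \<inter> A))\<bar> < \<omega>"
proof -
  assume v: "v \<in> A"
  have "1 - real (NN - x v) / real NN = \<xi> v"
    using x_less[OF v] NN_pos by (simp add: \<xi>_def of_nat_diff diff_divide_distrib)
  moreover have "\<bar>real (card {u\<in>N v \<inter> A. NN - x v \<le> x u}) - (1 - real (NN - x v) / real NN) * real (card (N v \<inter> A))\<bar> < real d / real q^5"
    by (rule disc) (use v subs in auto)
  ultimately show ?thesis unfolding h_alt[OF v] by (simp add: \<omega>_def dd_def Q_def)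
qed

lemma h_le: "v \<in> A \<Longrightarrow> h v \<le> card (N v \<inter> A)"
  unfolding h_def thr_def by (intro card_mono) (use finN subs in auto)

lemma thr_reflected: "v \<in> A \<Longrightarrow> thr NN 1 (\<lambda>a. NN - 1 - x a) (N v \<inter> A) v = card (N v \<inter> A) - h v"
proof -
  assume v: "v \<in> A"
  let ?H = "{u\<in>N v \<inter> A. NN - x v \<le> x u}"
  have fin: "finite (N v \<inter> A)" using finN v subs by auto
  have "{w\<in>N v \<inter> A. NN \<le> (NN - 1 - x w) + (NN - 1 - x v) + 1} = (N v \<inter> A) - ?H"
  proof -
    have "NN \<le> (NN - 1 - x w) + (NN - 1 - x v) + 1 \<longleftrightarrow> \<not> NN - x v \<le> x w" if "w \<in> A" for w
      using x_less[OF that] x_less[OF v] by linarith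
    thus ?thesis by blast
  qed
  hence "thr NN 1 (\<lambda>a. NN - 1 - x a) (N v \<inter> A) v = card ((N v \<inter> A) - ?H)" unfolding thr_def by simp
  also have "\<dots> = card (N v \<inter> A) - card ?H" by (rule card_Diff_subset) (auto intro: rev_finite_subset[OF fin])
  finally show ?thesis using h_alt[OF v] by simp
qed

lemma card_Low: "\<bar>real (card Low) - \<delta> * a\<bar> \<le> n / Q^5"
proof -
  have "Low = A - {u\<in>A. m0 \<le> x u}" by (auto simp: Low_def)
  hence "card Low = card A - card {u\<in>A. m0 \<le> x u}" using fins by (simp add: card_Diff_subset)
  moreover have "card {u\<in>A. m0 \<le> x u} \<le> card A" using fins by (intro card_mono) auto
  ultimately have "real (card Low) = a - real (card {u\<in>A. m0 \<le> x u})" by (simp add: of_nat_diff a_def)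
  moreover have "\<bar>real (card {u\<in>A. m0 \<le> x u}) - (1 - \<delta>) * a\<bar> \<le> n / Q^5"
    using count_above[OF m0_ratio(3)] by (simp add: \<delta>_facts(3))
  ultimately show ?thesis by (simp add: algebra_simps abs_le_iff)
qed

lemma card_Top: "\<bar>real (card Top) - \<delta> * a\<bar> \<le> n / Q^5"
proof -
  have "\<bar>real (card {u\<in>A. NN - m0 \<le> x u}) - (1 - (1 - \<delta>)) * a\<bar> \<le> n / Q^5"
    using count_above[of "NN - m0"] unfolding \<delta>_facts(4) by simp
  thus ?thesis by (simp add: Top_def)
qed

lemma card_Mid: "\<bar>real (card Mid) - (1 - 2 * \<delta>) * a\<bar> \<le> 2 * (n / Q^5)"
proof -
  have "finite Low" "finite Top" "finite Mid" using fins by (auto simp: Low_def Top_def Mid_def)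
  hence "card (Low \<union> Top \<union> Mid) = card Low + card Top + card Mid"
    using A_partition(2-4) by (simp add: card_Un_disjoint Int_Un_distrib2)
  hence "card A = card Low + card Top + card Mid" unfolding A_partition(1)[symmetric] .
  hence "real (card A) = real (card Low + card Top + card Mid)" by (rule arg_cong)
  hence "a = real (card Low) + real (card Top) + real (card Mid)" unfolding a_def by simp
  moreover have "(1 - 2 * \<delta>) * a = a - 2 * (\<delta> * a)" by (simp add: algebra_simps)
  ultimately show ?thesis using card_Low card_Top by (simp only: abs_le_iff) linarith
qed

lemma small_part: "\<bar>c - \<delta> * a\<bar> \<le> n / Q^5 \<Longrightarrow> c \<le> a / Q^3 * (1 + 2 / Q^2)"
proof -
  assume c: "\<bar>c - \<delta> * a\<bar> \<le> n / Q^5"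
  have "n / Q^5 \<le> (2 * a) / Q^5" using a_bounds(3) Q_ge by (intro divide_right_mono) auto
  moreover have "a / Q^3 * (1 + 2 / Q^2) = \<delta> * a + (2 * a) / Q^5"
    using Q_ge by (simp add: \<delta>_def field_simps power_numeral_reduce)
  ultimately show ?thesis using c by linarith
qed

lemma K_small: "real K \<le> \<delta> * (dd/2) - \<omega>"
proof -
  have "real K \<le> Q" using q(3) by (simp add: Q_def)
  moreover have "Q^5 \<le> \<omega>"
  proof -
    have "Q^5 * Q^5 \<le> Q^5 * \<omega>" using dd_ge unfolding \<omega>_facts(2) by (simp flip: power_add)
    thus ?thesis by (rule mult_left_le_imp_le) (use Q_ge in auto)
  qed
  moreover have "Q \<le> Q^5" using self_le_power[of Q 5] Q_ge by simp
  moreover have "2000 * 2000 * \<omega> \<le> Q^2 * \<omega>"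
    unfolding power2_eq_square using Q_ge \<omega>_facts(1) by (intro mult_right_mono mult_mono) auto
  moreover have "\<delta> * (dd/2) = Q^2 * \<omega> / 2" using \<omega>_facts(6) by simp
  ultimately show ?thesis using \<omega>_facts(1) by linarith
qed

lemma low_targets:
  "\<exists>t. (\<forall>v\<in>Low. h v \<le> t v \<and> t v < L0) \<and> (\<forall>k<L0. \<bar>real (card {v\<in>Low. t v = k}) - real (card Low) / real L0\<bar> \<le> 1)"
proof -
  have "\<exists>t. (\<forall>v\<in>A. x v < m0 \<longrightarrow> thr NN 0 x (N v \<inter> A) v \<le> t v \<and> t v < L0) \<and>
     (\<forall>k<L0. \<bar>real (card {v\<in>A. x v < m0 \<and> t v = k}) - real (card {v\<in>A. x v < m0}) / real L0\<bar> \<le> 1)"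
  proof (rule low_assignment)
    fix v assume v: "v \<in> A" "x v < m0"
    have "\<xi> v * real (card (N v \<inter> A)) \<le> \<delta> * dd"
      using \<xi>_low(1)[of v] v NA(1)[of v] subs \<delta>_facts \<xi>_range[of v] by (intro mult_mono) (auto simp: Low_def)
    thus "real (thr NN 0 x (N v \<inter> A) v) \<le> dd / Q^3 + dd / Q^5"
      using h_approx[OF v(1)] unfolding h_def \<delta>_def \<omega>_def by simp
  next
    fix v assume v: "v \<in> A" "m0 \<le> x v"
    have "\<delta> * (dd/2) \<le> \<xi> v * real (card (N v \<inter> A))"
      using \<xi>_low(2)[of v] v NA(3)[of v] subs \<delta>_facts \<xi>_range[of v] dd_pos by (intro mult_mono) (auto simp: Low_def)
    hence "real K \<le> real (h v)" using K_small h_approx[OF v(1)] by linarith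
    thus "K \<le> thr NN 0 x (N v \<inter> A) v" by (simp add: h_def)
  next
    show "real (card {v\<in>A. x v < m0}) \<le> a / Q^3 * (1 + 2 / Q^2)"
      using small_part[OF card_Low] by (simp add: Low_def)
  qed auto
  then obtain t where t: "\<forall>v\<in>A. x v < m0 \<longrightarrow> thr NN 0 x (N v \<inter> A) v \<le> t v \<and> t v < L0"
    "\<forall>k<L0. \<bar>real (card {v\<in>A. x v < m0 \<and> t v = k}) - real (card {v\<in>A. x v < m0}) / real L0\<bar> \<le> 1" by blast
  have e: "{v\<in>A. x v < m0} = Low" "\<And>k. {v\<in>A. x v < m0 \<and> t v = k} = {v\<in>Low. t v = k}" by (auto simp: Low_def)
  show ?thesis
  proof (intro exI[of _ t] conjI ballI)
    fix v assume "v \<in> Low"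
    thus "h v \<le> t v" "t v < L0" using t(1) by (auto simp: Low_def h_def)
  next
    show "\<forall>k<L0. \<bar>real (card {v\<in>Low. t v = k}) - real (card Low) / real L0\<bar> \<le> 1"
      using t(2) unfolding e .
  qed
qed

text \<open>
Here \<open>t\<close> is the distance of the target from \<open>d\<close>; the statement is \<open>low_targets\<close> for the reflected
labels.
\<close>

lemma top_targets:
  "\<exists>t. (\<forall>v\<in>Top. card (N v \<inter> A) - h v \<le> t v \<and> t v < L0) \<and> (\<forall>k<L0. \<bar>real (card {v\<in>Top. t v = k}) - real (card Top) / real L0\<bar> \<le> 1)"
proof -
  let ?g = "\<lambda>a. NN - 1 - x a"
  have g: "v \<in> A \<and> ?g v < m0 \<longleftrightarrow> v \<in> Top" for v using x_less[of v] m0_ratio(2,3) by (auto simp: Top_def)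
  have hr: "real (card (N v \<inter> A) - h v) = real (card (N v \<inter> A)) - real (h v)" if "v \<in> A" for v
    using h_le[OF that] by (simp add: of_nat_diff)
  have "\<exists>t. (\<forall>v\<in>A. ?g v < m0 \<longrightarrow> thr NN 1 ?g (N v \<inter> A) v \<le> t v \<and> t v < L0) \<and>
     (\<forall>k<L0. \<bar>real (card {v\<in>A. ?g v < m0 \<and> t v = k}) - real (card {v\<in>A. ?g v < m0}) / real L0\<bar> \<le> 1)"
  proof (rule low_assignment)
    fix v assume v: "v \<in> A" "?g v < m0"
    hence vT: "v \<in> Top" using g by blast
    have "(1 - \<xi> v) * real (card (N v \<inter> A)) \<le> \<delta> * dd"
      using \<xi>_top(1)[OF vT] v NA(1)[of v] subs \<delta>_facts \<xi>_range[of v] by (intro mult_mono) auto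
    hence "real (card (N v \<inter> A)) - \<xi> v * real (card (N v \<inter> A)) \<le> \<delta> * dd" by (simp add: left_diff_distrib)
    hence "real (card (N v \<inter> A) - h v) \<le> \<delta> * dd + \<omega>"
      unfolding hr[OF v(1)] using h_approx[OF v(1)] by linarith
    thus "real (thr NN 1 ?g (N v \<inter> A) v) \<le> dd / Q^3 + dd / Q^5"
      unfolding thr_reflected[OF v(1)] \<delta>_def \<omega>_def by simp
  next
    fix v assume v: "v \<in> A" "m0 \<le> ?g v"
    hence vT: "v \<notin> Top" using g[of v] by linarith
    have "\<delta> * (dd/2) \<le> (1 - \<xi> v) * real (card (N v \<inter> A))"
      using \<xi>_top(2)[OF v(1) vT] v NA(3)[of v] subs \<delta>_facts \<xi>_range[of v] dd_pos by (intro mult_mono) auto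
    hence "\<delta> * (dd/2) \<le> real (card (N v \<inter> A)) - \<xi> v * real (card (N v \<inter> A))" by (simp add: left_diff_distrib)
    hence "real K \<le> real (card (N v \<inter> A) - h v)" unfolding hr[OF v(1)] using K_small h_approx[OF v(1)] by linarith
    thus "K \<le> thr NN 1 ?g (N v \<inter> A) v" unfolding thr_reflected[OF v(1)] by simp
  next
    have "{v\<in>A. ?g v < m0} = Top" using g by blast
    thus "real (card {v\<in>A. ?g v < m0}) \<le> a / Q^3 * (1 + 2 / Q^2)"
      using small_part[OF card_Top] by simp
  qed auto
  then obtain t where t: "\<forall>v\<in>A. ?g v < m0 \<longrightarrow> thr NN 1 ?g (N v \<inter> A) v \<le> t v \<and> t v < L0"
    "\<forall>k<L0. \<bar>real (card {v\<in>A. ?g v < m0 \<and> t v = k}) - real (card {v\<in>A. ?g v < m0}) / real L0\<bar> \<le> 1" by blast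
  have e1: "{v\<in>A. ?g v < m0} = Top" using g by blast
  have e2: "{v\<in>A. ?g v < m0 \<and> t v = k} = {v\<in>Top. t v = k}" for k using g by blast
  show ?thesis
  proof (intro exI[of _ t] conjI ballI)
    fix v assume "v \<in> Top"
    hence v: "v \<in> A" "?g v < m0" using g[of v] by auto
    show "card (N v \<inter> A) - h v \<le> t v" "t v < L0" using t(1) v thr_reflected[OF v(1)] by auto
  next
    show "\<forall>k<L0. \<bar>real (card {v\<in>Top. t v = k}) - real (card Top) / real L0\<bar> \<le> 1"
      using t(2) unfolding e1 e2 .
  qed
qed

lemma L0_small: "2 * L0 \<le> d" "real L0 \<le> Q^3 * \<omega> / 2"
proof -
  have 1: "real L0 \<le> 3 * (Q^2 * \<omega>)" using L0_bounds(4) \<omega>_facts(4) by simp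
  have 2: "2000 * (Q^2 * \<omega>) \<le> Q * (Q^2 * \<omega>)" using Q_ge \<omega>_facts(1) by (intro mult_right_mono) auto
  have 3: "Q * (Q^2 * \<omega>) = Q^3 * \<omega>" by (simp add: power_numeral_reduce)
  have 4: "0 \<le> Q^2 * \<omega>" using \<omega>_facts(1) by simp
  show "real L0 \<le> Q^3 * \<omega> / 2" using 1 2 3 4 by linarith
  have "Q^3 * \<omega> \<le> Q^5 * \<omega>" using Q_ge \<omega>_facts(1) by (intro mult_right_mono power_increasing) auto
  hence "2 * real L0 \<le> dd" using \<open>real L0 \<le> Q^3 * \<omega> / 2\<close> \<omega>_facts(2) by linarith
  thus "2 * L0 \<le> d" by (simp add: dd_def)
qed

text \<open>
The position of the label of \<open>v\<close> between the two cut-offs, from 0 to 1.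
\<close>

definition "mid_pos v = (\<xi> v - \<delta>) / (1 - 2 * \<delta>)"

lemma mid_pos_facts: "v \<in> Mid \<Longrightarrow> 0 \<le> mid_pos v" "v \<in> Mid \<Longrightarrow> mid_pos v \<le> 1" "\<xi> v = mid_pos v * (1 - 2 * \<delta>) + \<delta>"
proof -
  have d: "1 - 2 * \<delta> > 0" using \<delta>_facts by simp
  show "0 \<le> mid_pos v" if "v \<in> Mid" using \<xi>_low(2)[of v] that d by (auto simp: mid_pos_def Mid_def Low_def)
  show "mid_pos v \<le> 1" if "v \<in> Mid" using \<xi>_top(2)[of v] that d by (auto simp: mid_pos_def Mid_def Top_def divide_le_eq)
  show "\<xi> v = mid_pos v * (1 - 2 * \<delta>) + \<delta>" using d by (simp add: mid_pos_def)
qed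

text \<open>
A ranking by labels sends \<open>v\<close> to about \<open>L0 + mid_pos v * (d + 1 - 2 L0)\<close>, which exceeds \<open>\<xi> v * d\<close> by
\<open>\<gamma> \<delta> d (1 - 2 mid_pos v)\<close> because \<open>L0\<close> is about \<open>(1 + \<gamma>) \<delta> d\<close>.
\<close>

lemma mid_targets:
  "\<exists>t. (\<forall>v\<in>Mid. L0 \<le> t v \<and> t v + L0 \<le> d \<and> \<bar>real (t v) - (\<xi> v * dd + \<gamma> * (\<delta> * dd) * (1 - 2 * mid_pos v))\<bar> \<le> 23 * \<omega>) \<and>
     (\<forall>k. L0 \<le> k \<longrightarrow> k + L0 \<le> d \<longrightarrow> \<bar>real (card {v\<in>Mid. t v = k}) - real (card Mid) / (dd + 1 - 2 * real L0)\<bar> \<le> 1)"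
proof -
  define M where "M = d + 1 - 2 * L0"
  have Mr: "real M = dd + 1 - 2 * real L0" using L0_small(1) by (simp add: M_def of_nat_diff dd_def)
  have M_le: "real M \<le> dd" using Mr L0_bounds(3) by linarith
  define m where "m = real (card Mid)"
  define e where "e = n / Q^5"
  have finM: "finite Mid" using fins by (simp add: Mid_def)
  have e0: "e \<ge> 0" using n_pos Q_ge by (simp add: e_def)
  have e_small: "e \<le> n / 2000"
    using mult_left_mono[OF Q_inverse_small[of 5], of n] n_pos by (simp add: e_def)
  have m_ge: "m \<ge> n / 4"
  proof -
    have "(1 - 2 * \<delta>) * a \<ge> (9/10) * (n/2)" using \<delta>_facts a_bounds(3) n_pos by (intro mult_mono) auto
    thus ?thesis using card_Mid e_small n_pos unfolding m_def e_def[symmetric] by linarith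
  qed
  have m_pos: "m > 0" using m_ge n_pos by simp
  obtain r where r: "bij_betw r Mid {..<card Mid}" "\<forall>u\<in>Mid. \<forall>v\<in>Mid. x u < x v \<longrightarrow> r u < r v"
    using ranking_exists[OF finM, of x] by blast
  define t where "t = (\<lambda>v. L0 + (r v * M) div card Mid)"
  have main: "L0 \<le> t v \<and> t v + L0 \<le> d \<and> \<bar>real (t v) - (\<xi> v * dd + \<gamma> * (\<delta> * dd) * (1 - 2 * mid_pos v))\<bar> \<le> 23 * \<omega>" if v: "v \<in> Mid" for v
  proof (intro conjI)
    have vA: "v \<in> A" using v by (simp add: Mid_def)
    have cM: "card Mid > 0" using v finM card_gt_0_iff by blast
    have rv: "r v < card Mid" using r(1) v by (auto simp: bij_betw_def)
    have divM: "(r v * M) div card Mid < M"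
      using rv L0_small(1) by (intro less_mult_imp_div_less) (simp add: mult.commute M_def)
    show "L0 \<le> t v" by (simp add: t_def)
    show "t v + L0 \<le> d" using divM L0_small(1) by (simp add: t_def M_def)
    have rb: "card {u\<in>Mid. x u < x v} \<le> r v" "r v < card {u\<in>Mid. x u \<le> x v}"
      by (rule ranking_bounds[OF finM r v])+
    have cnt: "real (card {u\<in>Mid. x u < c}) = real (card {u\<in>A. m0 \<le> x u}) - real (card {u\<in>A. c \<le> x u})" if "m0 \<le> c" "c \<le> NN - m0" for c
    proof -
      have "{u\<in>Mid. x u < c} = {u\<in>A. m0 \<le> x u} - {u\<in>A. c \<le> x u}" using that by (auto simp: Mid_def)
      moreover have "{u\<in>A. c \<le> x u} \<subseteq> {u\<in>A. m0 \<le> x u}" using that by auto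
      ultimately show ?thesis using fins by (simp add: card_Diff_subset of_nat_diff card_mono)
    qed
    have xv: "m0 \<le> x v" "x v + 1 \<le> NN - m0" "x v < NN" using v x_less[OF vA] by (auto simp: Mid_def)
    have A0: "\<bar>real (card {u\<in>A. m0 \<le> x u}) - (1 - \<delta>) * a\<bar> \<le> e"
      using count_above[OF m0_ratio(3)] by (simp add: \<delta>_facts(3) e_def)
    have A1: "\<bar>real (card {u\<in>A. x v \<le> x u}) - (1 - \<xi> v) * a\<bar> \<le> e"
      using count_above[of "x v"] xv by (simp add: \<xi>_def e_def)
    have A2: "\<bar>real (card {u\<in>A. x v + 1 \<le> x u}) - (1 - (\<xi> v + 1 / real NN)) * a\<bar> \<le> e"
      using count_above[of "x v + 1"] xv by (simp add: \<xi>_def e_def add_divide_distrib add.commute)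
    have aN: "a / real NN \<le> e"
    proof -
      have "Q^5 \<le> real NN" using NN(2) by (simp add: Q_def flip: of_nat_power)
      hence "a / real NN \<le> n / Q^5" using a_bounds(1) a_pos Q_ge n_pos by (intro frac_le) auto
      thus ?thesis by (simp add: e_def)
    qed
    have "real (r v) \<ge> (\<xi> v - \<delta>) * a - 2 * e"
    proof -
      have "real (card {u\<in>Mid. x u < x v}) \<ge> (1 - \<delta>) * a - e - ((1 - \<xi> v) * a + e)"
        using cnt[of "x v"] A0 A1 xv by linarith
      hence "real (r v) \<ge> (1 - \<delta>) * a - e - ((1 - \<xi> v) * a + e)" using rb(1) by linarith
      thus ?thesis by (simp add: algebra_simps)
    qed
    moreover have "real (r v) \<le> (\<xi> v - \<delta>) * a + 3 * e"
    proof -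
      have "{u\<in>Mid. x u \<le> x v} = {u\<in>Mid. x u < x v + 1}" by auto
      hence "real (r v) \<le> (1 - \<delta>) * a + e - ((1 - (\<xi> v + 1 / real NN)) * a - e)"
        using cnt[of "x v + 1"] A0 A2 xv rb(2) by simp
      also have "\<dots> = (\<xi> v - \<delta>) * a + 2 * e + a / real NN" by (simp add: algebra_simps)
      finally show ?thesis using aN by linarith
    qed
    ultimately have r1: "\<bar>real (r v) - (\<xi> v - \<delta>) * a\<bar> \<le> 3 * e" using e0 by (simp add: abs_le_iff)
    define y where "y = mid_pos v"
    have y01: "0 \<le> y" "y \<le> 1" using mid_pos_facts(1,2)[OF v] by (auto simp: y_def)
    have xy: "\<xi> v = y * (1 - 2 * \<delta>) + \<delta>" unfolding y_def by (rule mid_pos_facts(3))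
    have "\<bar>y * (m - (1 - 2 * \<delta>) * a)\<bar> \<le> 1 * (2 * e)"
      unfolding abs_mult using card_Mid y01 by (intro mult_mono) (auto simp: m_def e_def)
    moreover have "real (r v) - y * m = (real (r v) - (\<xi> v - \<delta>) * a) - y * (m - (1 - 2 * \<delta>) * a)"
      by (simp add: xy algebra_simps)
    ultimately have "\<bar>real (r v) - y * m\<bar> \<le> 5 * e" using r1 by linarith
    also have "\<dots> \<le> 20 / Q^5 * m"
    proof -
      have "20 / Q^5 * (n/4) \<le> 20 / Q^5 * m" using m_ge Q_ge by (intro mult_left_mono) auto
      thus ?thesis by (simp add: e_def)
    qed
    finally have "\<bar>real (r v) - y * m\<bar> / m \<le> 20 / Q^5" using m_pos by (simp add: divide_le_eq)
    moreover have "\<bar>real (r v) - y * m\<bar> / m = \<bar>real (r v) / m - y\<bar>"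
    proof -
      have "\<bar>real (r v) - y * m\<bar> / m = \<bar>(real (r v) - y * m) / m\<bar>" using m_pos by simp
      also have "(real (r v) - y * m) / m = real (r v) / m - y" using m_pos by (simp add: diff_divide_distrib)
      finally show ?thesis .
    qed
    ultimately have "\<bar>real (r v) / m - y\<bar> * real M \<le> 20 / Q^5 * dd"
      using M_le Q_ge by (intro mult_mono) auto
    hence "\<bar>(real (r v) / m - y) * real M\<bar> \<le> 20 * \<omega>" by (simp add: abs_mult \<omega>_def)
    moreover have "(real (r v) / m - y) * real M = real (r v * M) / m - y * real M" by (simp add: left_diff_distrib)
    ultimately have r2: "\<bar>real (r v * M) / m - y * real M\<bar> \<le> 20 * \<omega>" by simp
    \<comment> \<open>the rank is rounded down to a level, which costs at most one more\<close>
    define z where "z = real (r v * M) / m"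
    have "\<lfloor>z\<rfloor> = int ((r v * M) div card Mid)" unfolding z_def m_def by (rule floor_divide_of_nat_eq)
    hence z: "real ((r v * M) div card Mid) \<le> z" "z \<le> real ((r v * M) div card Mid) + 1" by linarith+
    have r3: "\<bar>real (t v) - (real L0 + y * real M)\<bar> \<le> 20 * \<omega> + 1"
    proof -
      have "real (t v) = real L0 + real ((r v * M) div card Mid)" by (simp add: t_def)
      thus ?thesis using r2 z unfolding z_def[symmetric] by linarith
    qed
    define \<rho> where "\<rho> = real L0 - (1 + \<gamma>) * (\<delta> * dd)"
    have \<rho>: "0 \<le> \<rho>" "\<rho> \<le> 1" using L0_bounds(1,2) by (auto simp: \<rho>_def \<delta>_def)
    have "real L0 + y * real M - (\<xi> v * dd + \<gamma> * (\<delta> * dd) * (1 - 2 * y)) = \<rho> + y * (1 - 2 * \<rho>)"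
      unfolding Mr xy \<rho>_def by (simp add: algebra_simps)
    moreover have "\<bar>\<rho> + y * (1 - 2 * \<rho>)\<bar> \<le> 2"
    proof -
      have "\<bar>y * (1 - 2 * \<rho>)\<bar> \<le> 1 * 1" unfolding abs_mult using y01 \<rho> by (intro mult_mono) auto
      thus ?thesis using \<rho> by linarith
    qed
    ultimately show "\<bar>real (t v) - (\<xi> v * dd + \<gamma> * (\<delta> * dd) * (1 - 2 * mid_pos v))\<bar> \<le> 23 * \<omega>"
      using r3 \<omega>_facts(1) unfolding y_def by linarith
  qed
  have lev: "\<bar>real (card {v\<in>Mid. t v = k}) - real (card Mid) / (dd + 1 - 2 * real L0)\<bar> \<le> 1" if "L0 \<le> k" "k + L0 \<le> d" for k
  proof -
    have "{v\<in>Mid. t v = k} = {v\<in>Mid. (r v * M) div card Mid = k - L0}" using that by (auto simp: t_def)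
    moreover have "k - L0 < M" using that by (simp add: M_def)
    ultimately show ?thesis using level_counts[OF r(1), of "k - L0" M] by (simp add: Mr)
  qed
  show ?thesis using main lev by (intro exI[of _ t]) blast
qed

text \<open>
Without control edges the degree of \<open>v\<close> is about \<open>\<xi> v * (d - |N v \<inter> B|)\<close>. For \<open>v\<close> near the lower cut-off
the control edges alone would leave too little room below the target, but there the shift by
\<open>\<gamma> \<delta> d\<close> exceeds all errors; elsewhere \<open>\<xi> v * |N v \<inter> B|\<close> does. The upper end is symmetric.
\<close>

lemma mid_window:
  assumes v: "v \<in> Mid" and b: "\<bar>b - \<xi> v * (dd - real (card (N v \<inter> B)))\<bar> \<le> 34 * (Q * \<omega>)"
    and t: "\<bar>t - (\<xi> v * dd + \<gamma> * (\<delta> * dd) * (1 - 2 * mid_pos v))\<bar> \<le> 23 * \<omega>"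
  shows "b \<le> t" "t \<le> b + real (card (N v \<inter> B))"
proof -
  define \<beta> where "\<beta> = real (card (N v \<inter> B))"
  define y where "y = mid_pos v"
  define W where "W = Q * \<omega>"
  define G where "G = \<gamma> * (\<delta> * dd)"
  have vV: "v \<in> V" using v subs by (auto simp: Mid_def)
  have W: "W \<ge> \<omega>" "W > 0" using Q_ge \<omega>_facts(1) mult_right_mono[of 1 Q \<omega>] by (auto simp: W_def)
  have QW: "Q * W \<ge> 2000 * W" using Q_ge W by (intro mult_right_mono) auto
  have G_ge: "G \<ge> 2000 * W"
  proof -
    have "G = (Q * \<gamma>) * W" by (simp add: G_def \<omega>_facts(6) W_def power2_eq_square)
    thus ?thesis using mult_right_mono[OF Q_ge(2), of W] W by simp
  qed
  have G_le: "G \<le> Q * W"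
  proof -
    have "G \<le> 1 * (\<delta> * dd)" unfolding G_def using \<gamma> \<delta>_facts dd_pos by (intro mult_right_mono) auto
    thus ?thesis by (simp add: \<omega>_facts(6) W_def power2_eq_square)
  qed
  have \<beta>_ge: "\<beta> \<ge> 1000 * (Q * W)"
  proof -
    have "\<beta> \<ge> dd / Q^2 / 2" using NB(1)[OF vV] by (simp add: \<beta>_def dd_def Q_def)
    also have "dd / Q^2 / 2 = Q * (Q * W) / 2" unfolding \<omega>_facts(5) by (simp add: W_def power3_eq_cube)
    moreover have "2000 * (Q * W) \<le> Q * (Q * W)" using Q_ge W by (intro mult_right_mono) auto
    ultimately show ?thesis by linarith
  qed
  have y01: "0 \<le> y" "y \<le> 1" using mid_pos_facts(1,2)[OF v] by (auto simp: y_def)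
  have xy: "\<xi> v = y * (1 - 2 * \<delta>) + \<delta>" unfolding y_def by (rule mid_pos_facts(3))
  \<comment> \<open>used for the lower end with u = y and for the upper end with u = 1 - y\<close>
  have lower: "z * \<beta> + G * (1 - 2 * u) \<ge> 57 * W" if u: "0 \<le> u" "u \<le> 1" "z = u * (1 - 2 * \<delta>) + \<delta>" for u z
  proof (cases "u \<le> 1/4")
    case True
    have "z \<ge> 0" using u \<delta>_facts by simp
    moreover have "\<beta> \<ge> 0" by (simp add: \<beta>_def)
    ultimately have "z * \<beta> \<ge> 0" by simp
    moreover have "G * (1 - 2 * u) \<ge> G * (1/2)" using True G_ge W by (intro mult_left_mono) auto
    ultimately show ?thesis using G_ge W by linarith
  next
    case False
    have "u * (1 - 2 * \<delta>) \<ge> (1/4) * (1/2)" using False \<delta>_facts by (intro mult_mono) auto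
    hence "z \<ge> 1/8" using u \<delta>_facts by simp
    hence "z * \<beta> \<ge> (1/8) * \<beta>" by (intro mult_right_mono) (auto simp: \<beta>_def)
    moreover have "G * (1 - 2 * u) \<ge> G * (-1)" using u G_ge W by (intro mult_left_mono) auto
    ultimately show ?thesis using \<beta>_ge G_le QW W by linarith
  qed
  have "\<xi> v * \<beta> + G * (1 - 2 * y) \<ge> 57 * W" by (rule lower[OF y01 xy])
  moreover have "(1 - \<xi> v) * \<beta> + G * (1 - 2 * (1 - y)) \<ge> 57 * W"
    by (rule lower) (use y01 xy in \<open>auto simp: algebra_simps\<close>)
  moreover have "\<xi> v * (dd - \<beta>) = \<xi> v * dd - \<xi> v * \<beta>" "(1 - \<xi> v) * \<beta> = \<beta> - \<xi> v * \<beta>"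
    "G * (1 - 2 * (1 - y)) = - (G * (1 - 2 * y))" by (simp_all add: algebra_simps)
  ultimately show "b \<le> t" "t \<le> b + real (card (N v \<inter> B))"
    using b t W unfolding \<beta>_def[symmetric] y_def[symmetric] G_def[symmetric] W_def[symmetric] abs_le_iff by linarith+
qed

text \<open>
The left-hand fraction is the probability that \<open>v\<close> is among the first \<open>j\<close> elements for a uniformly
random \<open>j\<close>.
\<close>

lemma pick_prob:
  assumes w: "w \<in> V" and v: "v \<in> N w \<inter> Mid"
    and r: "bij_betw r (N w \<inter> Mid) {..<card (N w \<inter> Mid)}" "\<forall>u\<in>N w \<inter> Mid. \<forall>v\<in>N w \<inter> Mid. NN - x u < NN - x v \<longrightarrow> r u < r v"
  shows "\<bar>(real (card (N w \<inter> Mid)) - real (r v)) / (real (card (N w \<inter> Mid)) + 1) - \<xi> v\<bar> \<le> 16 * \<delta>" (is ?A)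
    and "real (card (N w \<inter> Mid)) + 1 \<ge> dd / 4" (is ?B)
proof -
  define S where "S = N w \<inter> Mid"
  define D where "D = real (card S)"
  define \<alpha> where "\<alpha> = real (card (N w \<inter> A))"
  define c where "c = (\<lambda>k. real (card {u\<in>N w \<inter> A. k \<le> x u}))"
  have finS: "finite S" and finA: "finite (N w \<inter> A)" using finN[OF w] by (auto simp: S_def)
  have vA: "v \<in> A" and xv: "m0 \<le> x v" "x v + 1 \<le> NN - m0" "x v < NN" using v x_less[of v] by (auto simp: Mid_def)
  have cb: "\<bar>c k - (1 - real k / real NN) * \<alpha>\<bar> \<le> \<omega>" if "k \<le> NN" for k
    using disc[OF w that] by (simp add: c_def \<alpha>_def \<omega>_def dd_def Q_def)
  have C0: "\<bar>c m0 - (1 - \<delta>) * \<alpha>\<bar> \<le> \<omega>" using cb[OF m0_ratio(3)] by (simp add: \<delta>_facts(3))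
  have C3: "\<bar>c (NN - m0) - (1 - (1 - \<delta>)) * \<alpha>\<bar> \<le> \<omega>" using cb[of "NN - m0"] unfolding \<delta>_facts(4) by simp
  have C1: "\<bar>c (x v) - (1 - \<xi> v) * \<alpha>\<bar> \<le> \<omega>" using cb[of "x v"] xv by (simp add: \<xi>_def)
  have C2: "\<bar>c (x v + 1) - (1 - (\<xi> v + 1 / real NN)) * \<alpha>\<bar> \<le> \<omega>"
    using cb[of "x v + 1"] xv by (simp add: \<xi>_def add_divide_distrib add.commute)
  have diff: "real (card {u\<in>N w \<inter> A. k1 \<le> x u \<and> x u < k2}) = c k1 - c k2" if "k1 \<le> k2" for k1 k2
  proof -
    have "{u\<in>N w \<inter> A. k1 \<le> x u \<and> x u < k2} = {u\<in>N w \<inter> A. k1 \<le> x u} - {u\<in>N w \<inter> A. k2 \<le> x u}" by auto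
    moreover have s: "{u\<in>N w \<inter> A. k2 \<le> x u} \<subseteq> {u\<in>N w \<inter> A. k1 \<le> x u}" using that by auto
    moreover have f: "finite {u\<in>N w \<inter> A. k \<le> x u}" for k by (rule rev_finite_subset[OF finA]) auto
    ultimately have "card {u\<in>N w \<inter> A. k1 \<le> x u \<and> x u < k2} = card {u\<in>N w \<inter> A. k1 \<le> x u} - card {u\<in>N w \<inter> A. k2 \<le> x u}"
      using card_Diff_subset[OF f s] by simp
    moreover have "card {u\<in>N w \<inter> A. k2 \<le> x u} \<le> card {u\<in>N w \<inter> A. k1 \<le> x u}" by (rule card_mono[OF f s])
    ultimately show ?thesis by (simp add: c_def of_nat_diff)
  qed
  have S_alt: "S = {u\<in>N w \<inter> A. m0 \<le> x u \<and> x u < NN - m0}" by (auto simp: S_def Mid_def)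
  have D_eq: "D = c m0 - c (NN - m0)" unfolding D_def S_alt by (rule diff) (use m0_ratio in linarith)
  have rb: "card {u\<in>S. NN - x u < NN - x v} \<le> r v" "r v < card {u\<in>S. NN - x u \<le> NN - x v}"
    by (rule ranking_bounds[where f="\<lambda>u. NN - x u", OF finS]; use r v in \<open>simp add: S_def\<close>)+
  have xS: "x u < NN" if "u \<in> S" for u using that x_less by (auto simp: S_def Mid_def)
  have e1: "{u\<in>S. NN - x u < NN - x v} = {u\<in>N w \<inter> A. x v + 1 \<le> x u \<and> x u < NN - m0}"
  proof -
    have "NN - x u < NN - x v \<longleftrightarrow> x v + 1 \<le> x u" if "u \<in> S" for u using xS[OF that] xv by linarith
    thus ?thesis using xv unfolding S_alt by auto
  qed
  have e2: "{u\<in>S. NN - x u \<le> NN - x v} = {u\<in>N w \<inter> A. x v \<le> x u \<and> x u < NN - m0}"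
  proof -
    have "NN - x u \<le> NN - x v \<longleftrightarrow> x v \<le> x u" if "u \<in> S" for u using xS[OF that] xv by linarith
    thus ?thesis using xv unfolding S_alt by auto
  qed
  have r1: "real (r v) \<ge> c (x v + 1) - c (NN - m0)" using rb(1) unfolding e1 using diff[of "x v + 1" "NN - m0"] xv by linarith
  have r2: "real (r v) \<le> c (x v) - c (NN - m0)" using rb(2) unfolding e2 using diff[of "x v" "NN - m0"] xv by linarith
  have \<alpha>: "0 \<le> \<alpha>" "\<alpha> \<le> dd" "dd / 2 \<le> \<alpha>" using NA[OF w] by (auto simp: \<alpha>_def)
  have aN: "\<alpha> / real NN \<le> \<omega>"
  proof -
    have "Q^5 \<le> real NN" using NN(2) by (simp add: Q_def flip: of_nat_power)
    thus ?thesis unfolding \<omega>_def using \<alpha> dd_pos Q_ge by (intro frac_le) auto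
  qed
  have big: "2000 * 2000 * \<omega> \<le> \<delta> * dd"
    unfolding \<omega>_facts(6) power2_eq_square using Q_ge \<omega>_facts(1) by (intro mult_right_mono mult_mono) auto
  have dd_big: "\<delta> * dd \<le> dd / 2000" using mult_right_mono[OF \<delta>_facts(2), of dd] dd_pos by simp
  have da: "\<delta> * \<alpha> \<le> \<delta> * dd" using \<alpha> \<delta>_facts by (intro mult_left_mono) auto
  have D1: "D \<ge> \<alpha> - 2 * (\<delta> * \<alpha>) - 2 * \<omega>" "D \<le> \<alpha> - 2 * (\<delta> * \<alpha>) + 2 * \<omega>"
    using C0 C3 unfolding D_eq by (simp_all add: algebra_simps abs_le_iff)
  have D4: "D \<ge> dd / 4" using D1(1) da dd_big big \<alpha> by linarith
  thus ?B by (simp add: D_def S_def)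
  define X where "X = D - real (r v)"
  have E0: "(1 - \<delta>) * \<alpha> = \<alpha> - \<delta> * \<alpha>" and E1: "(1 - \<xi> v) * \<alpha> = \<alpha> - \<xi> v * \<alpha>"
    and E2: "(1 - (\<xi> v + 1 / real NN)) * \<alpha> = \<alpha> - \<xi> v * \<alpha> - \<alpha> / real NN" by (simp_all add: algebra_simps)
  have X_ge: "X \<ge> \<xi> v * \<alpha> - \<delta> * \<alpha> - 2 * \<omega>"
    using r2 C0 C1 unfolding X_def D_eq E0 E1 abs_le_iff by linarith
  have X_le: "X \<le> \<xi> v * \<alpha> - \<delta> * \<alpha> + 3 * \<omega>"
    using r1 C0 C2 aN unfolding X_def D_eq E0 E2 abs_le_iff by linarith
  have \<xi>01: "0 \<le> \<xi> v" "\<xi> v \<le> 1" using \<xi>_range[OF vA] by auto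
  have "\<bar>\<xi> v * (D + 1 - (\<alpha> - 2 * (\<delta> * \<alpha>)))\<bar> \<le> 1 * (3 * \<omega>)"
    unfolding abs_mult using \<xi>01 D1 \<omega>_facts(1) by (intro mult_mono) (auto simp: abs_le_iff)
  moreover have "\<bar>\<delta> * \<alpha> * (2 * \<xi> v - 1)\<bar> \<le> (\<delta> * \<alpha>) * 1"
    unfolding abs_mult using \<xi>01 \<delta>_facts \<alpha> by (intro mult_mono) (auto simp: abs_le_iff)
  moreover have "X - \<xi> v * (D + 1) = (X - (\<xi> v * \<alpha> - \<delta> * \<alpha>)) - \<xi> v * (D + 1 - (\<alpha> - 2 * (\<delta> * \<alpha>))) + \<delta> * \<alpha> * (2 * \<xi> v - 1)"
    by (simp add: algebra_simps)
  ultimately have "\<bar>X - \<xi> v * (D + 1)\<bar> \<le> \<delta> * \<alpha> + 6 * \<omega>" using X_ge X_le by linarith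
  also have "\<dots> \<le> 2 * (\<delta> * dd)" using da big \<omega>_facts(1) by linarith
  also have "\<dots> \<le> 16 * \<delta> * (D + 1)"
  proof -
    have "16 * \<delta> * (dd/4) \<le> 16 * \<delta> * (D + 1)" using D4 \<delta>_facts by (intro mult_left_mono) auto
    thus ?thesis using dd_pos \<delta>_facts mult_pos_pos[of \<delta> dd] by linarith
  qed
  finally have "\<bar>X - \<xi> v * (D + 1)\<bar> / (D + 1) \<le> 16 * \<delta>" using D4 dd_pos by (simp add: divide_le_eq)
  moreover have "\<bar>X - \<xi> v * (D + 1)\<bar> / (D + 1) = \<bar>X / (D + 1) - \<xi> v\<bar>"
  proof -
    have "D + 1 > 0" using D4 dd_pos by linarith
    hence "\<bar>X - \<xi> v * (D + 1)\<bar> / (D + 1) = \<bar>(X - \<xi> v * (D + 1)) / (D + 1)\<bar>" by simp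
    also have "(X - \<xi> v * (D + 1)) / (D + 1) = X / (D + 1) - \<xi> v" using \<open>D + 1 > 0\<close> by (simp add: diff_divide_distrib)
    finally show ?thesis .
  qed
  ultimately show ?A by (simp add: X_def D_def S_def)
qed

section \<open>Random picks of the two auxiliary sets\<close>

lemma beta_ge: "v \<in> V \<Longrightarrow> L0 \<le> card (N v \<inter> B)"
proof -
  assume v: "v \<in> V"
  have "Q^3 * \<omega> / 2 \<le> real (card (N v \<inter> B))"
    using NB(1)[OF v] \<omega>_facts(5) by (simp add: dd_def[symmetric] Q_def[symmetric])
  hence "real L0 \<le> real (card (N v \<inter> B))" using L0_small(2) by linarith
  thus ?thesis by simp
qed

text \<open>
The average numbers of vertices per target in the three groups.
\<close>

definition "levels = {real (card Low) / real L0, real (card Top) / real L0, real (card Mid) / (dd + 1 - 2 * real L0)}"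

lemma targets_exist:
  "\<exists>t. (\<forall>v\<in>Low. h v \<le> t v \<and> t v \<le> h v + card (N v \<inter> B)) \<and>
     (\<forall>v\<in>Top. h v + card (N v \<inter> P) \<le> t v \<and> t v \<le> h v + card (N v \<inter> P) + card (N v \<inter> B)) \<and>
     (\<forall>v\<in>Mid. \<bar>real (t v) - (\<xi> v * dd + \<gamma> * (\<delta> * dd) * (1 - 2 * mid_pos v))\<bar> \<le> 23 * \<omega>) \<and>
     (\<forall>k\<le>d. \<exists>c\<in>levels. \<bar>real (card {v\<in>A. t v = k}) - c\<bar> \<le> 1)"
proof -
  obtain tL where tL: "\<And>v. v \<in> Low \<Longrightarrow> h v \<le> tL v \<and> tL v < L0"
    "\<And>k. k < L0 \<Longrightarrow> \<bar>real (card {v\<in>Low. tL v = k}) - real (card Low) / real L0\<bar> \<le> 1" using low_targets by blast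
  obtain tT where tT: "\<And>v. v \<in> Top \<Longrightarrow> card (N v \<inter> A) - h v \<le> tT v \<and> tT v < L0"
    "\<And>k. k < L0 \<Longrightarrow> \<bar>real (card {v\<in>Top. tT v = k}) - real (card Top) / real L0\<bar> \<le> 1" using top_targets by blast
  obtain tM where tM: "\<And>v. v \<in> Mid \<Longrightarrow> L0 \<le> tM v \<and> tM v + L0 \<le> d \<and> \<bar>real (tM v) - (\<xi> v * dd + \<gamma> * (\<delta> * dd) * (1 - 2 * mid_pos v))\<bar> \<le> 23 * \<omega>"
    "\<And>k. L0 \<le> k \<Longrightarrow> k + L0 \<le> d \<Longrightarrow> \<bar>real (card {v\<in>Mid. tM v = k}) - real (card Mid) / (dd + 1 - 2 * real L0)\<bar> \<le> 1"
    using mid_targets by blast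
  define t where "t = (\<lambda>v. if v \<in> Low then tL v else if v \<in> Top then d - tT v else tM v)"
  have cases: "v \<in> Low \<or> v \<in> Top \<or> v \<in> Mid" if "v \<in> A" for v using that A_partition(1) by blast
  have inA: "Low \<subseteq> A" "Top \<subseteq> A" "Mid \<subseteq> A" by (auto simp: Low_def Top_def Mid_def)
  have t_simps: "v \<in> Low \<Longrightarrow> t v = tL v" "v \<in> Top \<Longrightarrow> t v = d - tT v" "v \<in> Mid \<Longrightarrow> t v = tM v" for v
  proof -
    show "v \<in> Low \<Longrightarrow> t v = tL v" by (simp add: t_def)
    assume "v \<in> Top"
    moreover from this have "v \<notin> Low" using A_partition(2) by blast
    ultimately show "t v = d - tT v" by (simp add: t_def)
  next
    assume "v \<in> Mid"
    hence "v \<notin> Low" "v \<notin> Top" using A_partition(3,4) by blast+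
    thus "t v = tM v" by (simp add: t_def)
  qed
  have L2: "2 * L0 \<le> d" by (rule L0_small(1))
  show ?thesis
  proof (intro exI[of _ t] conjI ballI allI impI)
    fix v assume v: "v \<in> Low"
    show "h v \<le> t v" using tL(1)[OF v] t_simps(1)[OF v] by simp
    show "t v \<le> h v + card (N v \<inter> B)" using tL(1)[OF v] t_simps(1)[OF v] beta_ge[of v] v inA subs by fastforce
  next
    fix v assume v: "v \<in> Top"
    have vV: "v \<in> V" using v inA subs by blast
    have "real d = real (card (N v \<inter> A) + card (N v \<inter> P) + card (N v \<inter> B))" using deg_split[OF vV] by (simp add: dd_def)
    hence ds: "d = card (N v \<inter> A) + card (N v \<inter> P) + card (N v \<inter> B)" by (simp only: of_nat_eq_iff)
    have hA: "h v \<le> card (N v \<inter> A)" using h_le v inA by blast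
    have tt: "t v + tT v = d" using tT(1)[OF v] t_simps(2)[OF v] L2 by simp
    show "h v + card (N v \<inter> P) \<le> t v" using tt ds hA tT(1)[OF v] beta_ge[OF vV] by linarith
    show "t v \<le> h v + card (N v \<inter> P) + card (N v \<inter> B)" using tt ds hA tT(1)[OF v] by linarith
  next
    fix v assume v: "v \<in> Mid"
    show "\<bar>real (t v) - (\<xi> v * dd + \<gamma> * (\<delta> * dd) * (1 - 2 * mid_pos v))\<bar> \<le> 23 * \<omega>" using tM(1)[OF v] t_simps(3)[OF v] by simp
  next
    fix k assume k: "k \<le> d"
    have tb: "(v \<in> Low \<longrightarrow> t v < L0) \<and> (v \<in> Top \<longrightarrow> d < t v + L0) \<and> (v \<in> Mid \<longrightarrow> L0 \<le> t v \<and> t v + L0 \<le> d)" for v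
      using tL(1)[of v] tT(1)[of v] tM(1)[of v] t_simps[of v] L2 by auto
    consider "k < L0" | "L0 \<le> k" "k + L0 \<le> d" | "d < k + L0" by linarith
    thus "\<exists>c\<in>levels. \<bar>real (card {v\<in>A. t v = k}) - c\<bar> \<le> 1"
    proof cases
      case 1
      have "v \<in> A \<and> t v = k \<longleftrightarrow> v \<in> Low \<and> tL v = k" for v
        using cases[of v] tb[of v] 1 L2 t_simps(1)[of v] inA by fastforce
      hence "{v\<in>A. t v = k} = {v\<in>Low. tL v = k}" by blast
      thus ?thesis using tL(2)[OF 1] by (intro bexI[of _ "real (card Low) / real L0"]) (simp_all add: levels_def)
    next
      case 2
      have "v \<in> A \<and> t v = k \<longleftrightarrow> v \<in> Mid \<and> tM v = k" for v
        using cases[of v] tb[of v] 2 L2 t_simps(3)[of v] inA by fastforce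
      hence "{v\<in>A. t v = k} = {v\<in>Mid. tM v = k}" by blast
      thus ?thesis using tM(2)[OF 2] by (intro bexI[of _ "real (card Mid) / (dd + 1 - 2 * real L0)"]) (simp_all add: levels_def)
    next
      case 3
      have "v \<in> A \<and> t v = k \<longleftrightarrow> v \<in> Top \<and> tT v = d - k" for v
      proof
        assume a: "v \<in> A \<and> t v = k"
        hence v: "v \<in> Top" using cases[of v] tb[of v] 3 L2 by linarith
        thus "v \<in> Top \<and> tT v = d - k" using a t_simps(2)[OF v] tT(1)[OF v] L2 k by auto
      next
        assume a: "v \<in> Top \<and> tT v = d - k"
        thus "v \<in> A \<and> t v = k" using t_simps(2)[of v] inA k by auto
      qed
      hence "{v\<in>A. t v = k} = {v\<in>Top. tT v = d - k}" by blast
      moreover have "d - k < L0" using 3 k by linarith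
      ultimately show ?thesis using tT(2)[of "d - k"] by (intro bexI[of _ "real (card Top) / real L0"]) (simp_all add: levels_def)
    qed
  qed
qed

text \<open>
The vertices among which \<open>w\<close> picks its random number of neighbours.
\<close>

definition "palette w = (if w \<in> P then N w \<inter> Mid else N w \<inter> P)"
text \<open>
The order in which \<open>w\<close> picks: vertices with larger labels come first. Only for \<open>w \<in> P\<close> does this order
matter.
\<close>

definition "pick_rank w = (SOME r. bij_betw r (palette w) {..<card (palette w)} \<and> (\<forall>u\<in>palette w. \<forall>v\<in>palette w. NN - x u < NN - x v \<longrightarrow> r u < r v))"
definition "control_rank v = (SOME r. bij_betw r (N v \<inter> B) {..<card (N v \<inter> B)})"
definition "pick_range w = {0..card (palette w)}"

lemma pick_rank: "w \<in> V \<Longrightarrow> bij_betw (pick_rank w) (palette w) {..<card (palette w)} \<and> (\<forall>u\<in>palette w. \<forall>v\<in>palette w. NN - x u < NN - x v \<longrightarrow> pick_rank w u < pick_rank w v)"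
proof -
  assume w: "w \<in> V"
  have "finite (palette w)" using finN[OF w] by (simp add: palette_def)
  from ranking_exists[OF this, of "\<lambda>u. NN - x u"] show ?thesis unfolding pick_rank_def by (rule someI_ex)
qed

lemma control_rank: "v \<in> V \<Longrightarrow> bij_betw (control_rank v) (N v \<inter> B) {..<card (N v \<inter> B)}"
proof -
  assume v: "v \<in> V"
  have "finite (N v \<inter> B)" using finN[OF v] by simp
  from ranking_exists[OF this] have "\<exists>r. bij_betw r (N v \<inter> B) {..<card (N v \<inter> B)}" by blast
  thus ?thesis unfolding control_rank_def by (rule someI_ex)
qed

text \<open>
The number of neighbours of \<open>v \<in> A\<close> in \<open>P\<close> in the subgraph. Vertices with extreme labels are joined to
none or all of \<open>P\<close>, so that their degrees are not disturbed by the picks.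
\<close>

definition "picked j v = (if v \<in> Low then 0 else if v \<in> Top then card (N v \<inter> P) else card {w\<in>N v \<inter> P. pick_rank w v < j w})" for j :: "'a \<Rightarrow> nat"
text \<open>
The control edges at \<open>v\<close>, just enough of them to reach the target \<open>t v\<close>.
\<close>

definition "control t j v = {w\<in>N v \<inter> B. control_rank v w < t v - (h v + picked j v)}" for t j :: "'a \<Rightarrow> nat"
text \<open>
The degree of \<open>w \<in> P\<close> apart from the \<open>j w\<close> neighbours that \<open>w\<close> picks itself. It depends on the picks
of \<open>B\<close> only.
\<close>

definition "inflow_P j w = card (N w \<inter> Top) + card {u\<in>N w \<inter> B. pick_rank u w < j u}" for j :: "'a \<Rightarrow> nat"
text \<open>
The degree of \<open>w \<in> B\<close> apart from the \<open>j w\<close> neighbours that \<open>w\<close> picks itself. Through \<open>picked\<close> it depends on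
the picks of \<open>P\<close> only.
\<close>

definition "inflow_B t j w = card {u\<in>N w \<inter> A. w \<in> control t j u}" for t j :: "'a \<Rightarrow> nat"

lemma proper_pick_range: "proper (P \<union> B) pick_range"
  using fins by (auto simp: proper_def pick_range_def)

lemma picked_deviation:
  assumes v: "v \<in> Mid"
  shows "avg (P \<union> B) pick_range (\<lambda>j. of_bool (33 * (Q * \<omega>) < \<bar>real (card {w\<in>N v \<inter> P. pick_rank w v < j w}) - \<xi> v * real (card (N v \<inter> P))\<bar>))
     \<le> 2 * exp (- ((Q * \<omega>)^2) / (4 * dd))"
proof -
  let ?R = "\<lambda>w c. pick_rank w v < c"
  define X where "X = (\<lambda>j::'a \<Rightarrow> nat. \<Sum>w\<in>N v \<inter> P. of_bool (?R w (j w)) :: real)"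
  define F where "F = (\<Sum>w\<in>N v \<inter> P. freq pick_range ?R w)"
  define p where "p = real (card (N v \<inter> P))"
  have vA: "v \<in> A" using v by (simp add: Mid_def)
  hence vV: "v \<in> V" using subs by blast
  have fin: "finite (N v \<inter> P)" using finN[OF vV] by simp
  have fr: "\<bar>freq pick_range ?R w - \<xi> v\<bar> \<le> 16 * \<delta> \<and> freq pick_range ?R w \<le> 1" if w: "w \<in> N v \<inter> P" for w
  proof -
    have wV: "w \<in> V" using w subs by blast
    have palette: "palette w = N w \<inter> Mid" using w by (simp add: palette_def)
    have vw: "v \<in> N w \<inter> Mid" using N_sym[OF vV] w v by blast
    note r = pick_rank[OF wV, unfolded palette]
    have rv: "pick_rank w v < card (N w \<inter> Mid)" using r vw by (auto simp: bij_betw_def)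
    have "{c\<in>pick_range w. ?R w c} = {pick_rank w v + 1..card (N w \<inter> Mid)}" by (auto simp: pick_range_def palette)
    hence "card {c\<in>pick_range w. ?R w c} = card (N w \<inter> Mid) - pick_rank w v" by simp
    hence f: "freq pick_range ?R w = (real (card (N w \<inter> Mid)) - real (pick_rank w v)) / (real (card (N w \<inter> Mid)) + 1)"
      using rv by (simp add: freq_def pick_range_def palette of_nat_diff add.commute)
    have "(real (card (N w \<inter> Mid)) - real (pick_rank w v)) / (real (card (N w \<inter> Mid)) + 1) \<le> 1" by (simp add: divide_le_eq)
    thus ?thesis using pick_prob(1)[OF wV vw] r unfolding f by blast
  qed
  have "\<bar>F - \<xi> v * p\<bar> = \<bar>\<Sum>w\<in>N v \<inter> P. (freq pick_range ?R w - \<xi> v)\<bar>" unfolding F_def p_def sum_subtractf by (simp add: mult.commute)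
  also have "\<dots> \<le> (\<Sum>w\<in>N v \<inter> P. \<bar>freq pick_range ?R w - \<xi> v\<bar>)" by (rule sum_abs)
  also have "\<dots> \<le> (\<Sum>w\<in>N v \<inter> P. 16 * \<delta>)" by (intro sum_mono) (use fr in blast)
  also have "\<dots> = p * (16 * \<delta>)" by (simp add: p_def)
  also have "\<dots> \<le> (2 * dd / Q) * (16 * \<delta>)" using NP(2)[OF vV] \<delta>_facts by (intro mult_right_mono) (auto simp: p_def dd_def Q_def)
  also have "\<dots> = 32 * (dd / Q^4)" using Q_ge by (simp add: \<delta>_def power_numeral_reduce)
  finally have FX: "\<bar>F - \<xi> v * p\<bar> \<le> 32 * (Q * \<omega>)" unfolding \<omega>_facts(3) .
  have F_le: "F \<le> dd"
  proof -
    have "F \<le> (\<Sum>w\<in>N v \<inter> P. 1)" unfolding F_def by (intro sum_mono) (use fr in blast)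
    also have "\<dots> = p" by (simp add: p_def)
    also have "\<dots> \<le> dd" using deg_split[OF vV] by (simp add: p_def)
    finally show ?thesis .
  qed
  have Qw: "0 \<le> Q * \<omega>" "Q * \<omega> \<le> 2 * dd"
  proof -
    show "0 \<le> Q * \<omega>" using Q_ge \<omega>_facts(1) by simp
    have "Q * \<omega> \<le> Q^5 * \<omega>" using Q_ge \<omega>_facts(1) self_le_power[of Q 5] by (intro mult_right_mono) auto
    thus "Q * \<omega> \<le> 2 * dd" using \<omega>_facts(2) dd_pos by linarith
  qed
  have "avg (P \<union> B) pick_range (\<lambda>j. of_bool (33 * (Q * \<omega>) < \<bar>real (card {w\<in>N v \<inter> P. pick_rank w v < j w}) - \<xi> v * p\<bar>))
      \<le> avg (P \<union> B) pick_range (\<lambda>j. of_bool (Q * \<omega> \<le> \<bar>X j - F\<bar>))"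
  proof (rule avg_mono)
    fix j :: "'a \<Rightarrow> nat"
    have "X j = real (card {w\<in>N v \<inter> P. pick_rank w v < j w})" unfolding X_def using fin by (simp add: Int_def)
    thus "of_bool (33 * (Q * \<omega>) < \<bar>real (card {w\<in>N v \<inter> P. pick_rank w v < j w}) - \<xi> v * p\<bar>) \<le> (of_bool (Q * \<omega> \<le> \<bar>X j - F\<bar>) :: real)"
      using FX by auto
  qed
  also have "\<dots> \<le> 2 * exp (- ((Q * \<omega>)^2) / (4 * dd))"
    unfolding X_def F_def by (rule count_deviation[OF proper_pick_range]) (use F_le Qw dd_pos in \<open>auto simp: F_def\<close>)
  finally show ?thesis unfolding p_def .
qed

lemma inflow_P_dep: "(\<And>a. a \<in> B \<Longrightarrow> i a = j a) \<Longrightarrow> inflow_P i w = inflow_P j w"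
  unfolding inflow_P_def by (intro arg_cong2[where f="(+)"] refl arg_cong[where f=card]) auto

lemma picked_dep: "(\<And>a. a \<in> P \<Longrightarrow> i a = j a) \<Longrightarrow> picked i v = picked j v"
proof -
  assume "\<And>a. a \<in> P \<Longrightarrow> i a = j a"
  hence "{w\<in>N v \<inter> P. pick_rank w v < i w} = {w\<in>N v \<inter> P. pick_rank w v < j w}" by auto
  thus ?thesis by (simp add: picked_def)
qed

lemma inflow_B_dep: "(\<And>a. a \<in> P \<Longrightarrow> i a = j a) \<Longrightarrow> inflow_B t i w = inflow_B t j w"
  unfolding inflow_B_def control_def using picked_dep[of i j] by simp

lemma picks_exist:
  fixes J :: real
  assumes small: "n * (2 * exp (- ((Q * \<omega>)^2) / (4 * dd))) \<le> 1/4"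
    "(dd + 1) * exp (- (ln Q * J) + 8 * n / dd) \<le> 1/4"
  shows "\<exists>j\<in>Pi\<^sub>E (P \<union> B) pick_range. (\<forall>v\<in>Mid. \<bar>real (card {w\<in>N v \<inter> P. pick_rank w v < j w}) - \<xi> v * real (card (N v \<inter> P))\<bar> \<le> 33 * (Q * \<omega>)) \<and>
     (\<forall>k\<le>d. real (card {w\<in>P. j w + inflow_P j w = k}) < J) \<and> (\<forall>k\<le>d. real (card {w\<in>B. j w + inflow_B t j w = k}) < J)"
proof -
  define E1 where "E1 = (\<lambda>j. \<exists>v\<in>Mid. 33 * (Q * \<omega>) < \<bar>real (card {w\<in>N v \<inter> P. pick_rank w v < j w}) - \<xi> v * real (card (N v \<inter> P))\<bar>)"
  define E2 where "E2 = (\<lambda>j. \<exists>k\<in>{..d}. J \<le> real (card {w\<in>P. j w + inflow_P j w = k}))"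
  define E3 where "E3 = (\<lambda>j. \<exists>k\<in>{..d}. J \<le> real (card {w\<in>B. j w + inflow_B t j w = k}))"
  have lnQ: "ln Q \<ge> 0" "exp (ln Q) = Q" using Q_ge by auto
  have "avg (P \<union> B) pick_range (\<lambda>j. of_bool (E1 j)) \<le> (\<Sum>v\<in>Mid. 2 * exp (- ((Q * \<omega>)^2) / (4 * dd)))"
    unfolding E1_def by (rule order.trans[OF avg_union_bound sum_mono[OF picked_deviation]]) (use fins in \<open>auto simp: Mid_def\<close>)
  also have "\<dots> = real (card Mid) * (2 * exp (- ((Q * \<omega>)^2) / (4 * dd)))" by simp
  also have "\<dots> \<le> n * (2 * exp (- ((Q * \<omega>)^2) / (4 * dd)))"
  proof (intro mult_right_mono)
    show "real (card Mid) \<le> n" unfolding n_def using finV subs by (auto simp: Mid_def intro!: card_mono)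
  qed simp
  finally have B1: "avg (P \<union> B) pick_range (\<lambda>j. of_bool (E1 j)) \<le> 1/4" using small(1) by linarith
  \<comment> \<open>both clump bounds have this form\<close>
  have key: "(real d + 1) * exp (- ln Q * J + (exp (ln Q) - 1) * y) \<le> 1/4" if y: "0 \<le> y" "y \<le> 8 * n / (Q * dd)" for y
  proof -
    have "(exp (ln Q) - 1) * y \<le> Q * (8 * n / (Q * dd))" unfolding lnQ(2) using y Q_ge by (intro mult_mono) auto
    also have "\<dots> = 8 * n / dd" using Q_ge by simp
    finally have "exp (- ln Q * J + (exp (ln Q) - 1) * y) \<le> exp (- (ln Q * J) + 8 * n / dd)" by simp
    hence "(real d + 1) * exp (- ln Q * J + (exp (ln Q) - 1) * y) \<le> (dd + 1) * exp (- (ln Q * J) + 8 * n / dd)"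
      unfolding dd_def by (intro mult_left_mono) auto
    thus ?thesis using small(2) by linarith
  qed
  have "avg (P \<union> B) pick_range (\<lambda>j. of_bool (E2 j)) \<le> (real d + 1) * exp (- ln Q * J + (exp (ln Q) - 1) * (real (card P) / (dd/4)))"
    unfolding E2_def
  proof (rule clump_bound[where D="\<lambda>w. card (palette w)"])
    fix w assume w: "w \<in> P"
    have wV: "w \<in> V" using w subs by blast
    have palette: "palette w = N w \<inter> Mid" using w by (simp add: palette_def)
    show "dd / 4 \<le> real (card (palette w)) + 1"
    proof (cases "palette w = {}")
      case True
      have "real (card {u\<in>N w \<inter> A. m0 \<le> x u}) \<ge> (1 - \<delta>) * real (card (N w \<inter> A)) - \<omega>"
        using disc[OF wV m0_ratio(3)] unfolding \<delta>_facts(3) \<omega>_def dd_def Q_def by linarith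
      moreover have "real (card {u\<in>N w \<inter> A. NN - m0 \<le> x u}) \<le> \<delta> * real (card (N w \<inter> A)) + \<omega>"
        using disc[OF wV, of "NN - m0"] unfolding \<delta>_facts(4) \<omega>_def dd_def Q_def by simp
      moreover have "{u\<in>N w \<inter> A. m0 \<le> x u} \<subseteq> {u\<in>N w \<inter> A. NN - m0 \<le> x u}"
        using True unfolding palette by (auto simp: Mid_def)
      hence "card {u\<in>N w \<inter> A. m0 \<le> x u} \<le> card {u\<in>N w \<inter> A. NN - m0 \<le> x u}"
        by (intro card_mono finite_subset[OF _ finN[OF wV]]) auto
      ultimately have "(1 - \<delta>) * real (card (N w \<inter> A)) - \<omega> \<le> \<delta> * real (card (N w \<inter> A)) + \<omega>" by linarith
      hence "(1 - 2 * \<delta>) * real (card (N w \<inter> A)) \<le> 2 * \<omega>" by (simp add: algebra_simps)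
      moreover have "(1/2) * (dd/2) \<le> (1 - 2 * \<delta>) * real (card (N w \<inter> A))"
        using \<delta>_facts NA(3)[OF wV] dd_pos by (intro mult_mono) auto
      moreover have "2000 * \<omega> \<le> dd"
      proof -
        have "2000 \<le> Q^5" using self_le_power[of Q 5] Q_ge by simp
        thus ?thesis unfolding \<omega>_facts(2) using \<omega>_facts(1) by (intro mult_right_mono) auto
      qed
      ultimately show ?thesis using \<omega>_facts(1) by linarith
    next
      case False
      then obtain v where "v \<in> N w \<inter> Mid" unfolding palette by blast
      thus ?thesis using pick_prob(2)[OF wV, of v "pick_rank w"] pick_rank[OF wV] unfolding palette by blast
    qed
  next
    fix i j w assume "\<And>a. a \<in> B \<Longrightarrow> i a = (j a :: nat)"
    thus "inflow_P i w = inflow_P j w" by (rule inflow_P_dep)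
  qed (use fins parts dd_pos lnQ in \<open>auto simp: pick_range_def\<close>)
  also have "\<dots> \<le> 1/4"
  proof (rule key)
    have "real (card P) / (dd/4) \<le> (2 * n / Q) / (dd/4)" using card_P dd_pos by (intro divide_right_mono) auto
    thus "real (card P) / (dd/4) \<le> 8 * n / (Q * dd)" by simp
  qed (use dd_pos in auto)
  finally have B2: "avg (P \<union> B) pick_range (\<lambda>j. of_bool (E2 j)) \<le> 1/4" .
  have "avg (B \<union> P) pick_range (\<lambda>j. of_bool (E3 j)) \<le> (real d + 1) * exp (- ln Q * J + (exp (ln Q) - 1) * (real (card B) / (dd / (2 * Q))))"
    unfolding E3_def
  proof (rule clump_bound[where D="\<lambda>w. card (palette w)"])
    fix w assume w: "w \<in> B"
    have "palette w = N w \<inter> P" using w parts by (auto simp: palette_def)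
    thus "dd / (2 * Q) \<le> real (card (palette w)) + 1" using NP(1)[of w] w subs by (auto simp: dd_def Q_def)
  next
    fix i j w assume "\<And>a. a \<in> P \<Longrightarrow> i a = (j a :: nat)"
    thus "inflow_B t i w = inflow_B t j w" by (rule inflow_B_dep)
  qed (use fins parts dd_pos lnQ Q_ge in \<open>auto simp: pick_range_def\<close>)
  also have "\<dots> \<le> 1/4"
  proof (rule key)
    have "real (card B) / (dd / (2 * Q)) \<le> (2 * n / Q^2) / (dd / (2 * Q))" using card_B dd_pos Q_ge by (intro divide_right_mono) auto
    also have "\<dots> = 4 * n / (Q * dd)" using Q_ge by (simp add: power2_eq_square)
    also have "\<dots> \<le> 8 * n / (Q * dd)" using n_pos dd_pos Q_ge by (intro divide_right_mono) auto
    finally show "real (card B) / (dd / (2 * Q)) \<le> 8 * n / (Q * dd)" .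
  qed (use dd_pos Q_ge in auto)
  finally have B3: "avg (P \<union> B) pick_range (\<lambda>j. of_bool (E3 j)) \<le> 1/4" by (simp only: Un_commute)
  have "avg (P \<union> B) pick_range (\<lambda>j. of_bool (E1 j \<or> (E2 j \<or> E3 j))) \<le> 1/4 + (1/4 + 1/4)"
    by (intro order.trans[OF avg_disj] add_mono B1 B2 B3)
  also have "\<dots> < (1::real)" by simp
  finally obtain j where j: "j \<in> Pi\<^sub>E (P \<union> B) pick_range" "of_bool (E1 j \<or> (E2 j \<or> E3 j)) < (1::real)"
    using avg_exists[OF proper_pick_range] by blast
  hence "\<not> E1 j" "\<not> E2 j" "\<not> E3 j" by (auto simp: of_bool_def split: if_splits)
  thus ?thesis using j(1) unfolding E1_def E2_def E3_def by (intro bexI[of _ j]) (auto simp: not_le not_less)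
qed

section \<open>The subgraph and its degrees\<close>

lemma card_control_rank_less: "v \<in> V \<Longrightarrow> card {w\<in>N v \<inter> B. control_rank v w < m} = min m (card (N v \<inter> B))"
  by (rule card_rank_less[OF control_rank])

lemma card_pick_rank_less: "w \<in> V \<Longrightarrow> card {u\<in>palette w. pick_rank w u < m} = min m (card (palette w))"
  by (rule card_rank_less) (use pick_rank in blast)

text \<open>
Every vertex of \<open>A\<close> has exactly its target as degree, and \<open>P\<close> and \<open>B\<close> contribute at most \<open>J\<close> vertices
each to any degree.
\<close>

lemma subgraph_exists:
  fixes J :: real
  assumes small: "n * (2 * exp (- ((Q * \<omega>)^2) / (4 * dd))) \<le> 1/4"
    "(dd + 1) * exp (- (ln Q * J) + 8 * n / dd) \<le> 1/4"
  shows "\<exists>nb. (\<forall>v\<in>V. nb v \<subseteq> N v) \<and> (\<forall>v\<in>V. \<forall>u\<in>nb v. v \<in> nb u) \<and>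
     (\<forall>k\<le>d. \<exists>c\<in>levels. c - 1 \<le> real (card {v\<in>V. card (nb v) = k}) \<and> real (card {v\<in>V. card (nb v) = k}) \<le> c + 1 + 2 * J)"
proof -
  obtain t where t: "\<And>v. v \<in> Low \<Longrightarrow> h v \<le> t v \<and> t v \<le> h v + card (N v \<inter> B)"
     "\<And>v. v \<in> Top \<Longrightarrow> h v + card (N v \<inter> P) \<le> t v \<and> t v \<le> h v + card (N v \<inter> P) + card (N v \<inter> B)"
     "\<And>v. v \<in> Mid \<Longrightarrow> \<bar>real (t v) - (\<xi> v * dd + \<gamma> * (\<delta> * dd) * (1 - 2 * mid_pos v))\<bar> \<le> 23 * \<omega>"
     "\<And>k. k \<le> d \<Longrightarrow> \<exists>c\<in>levels. \<bar>real (card {v\<in>A. t v = k}) - c\<bar> \<le> 1"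
    using targets_exist by blast
  obtain j where j: "j \<in> Pi\<^sub>E (P \<union> B) pick_range"
    "\<And>v. v \<in> Mid \<Longrightarrow> \<bar>real (card {w\<in>N v \<inter> P. pick_rank w v < j w}) - \<xi> v * real (card (N v \<inter> P))\<bar> \<le> 33 * (Q * \<omega>)"
    "\<And>k. k \<le> d \<Longrightarrow> real (card {w\<in>P. j w + inflow_P j w = k}) < J" "\<And>k. k \<le> d \<Longrightarrow> real (card {w\<in>B. j w + inflow_B t j w = k}) < J"
    using picks_exist[OF small, of t] by blast
  have j_le: "j w \<le> card (palette w)" if "w \<in> P \<union> B" for w using j(1) that by (auto simp: pick_range_def)
  have AV: "v \<in> V" if "v \<in> A" for v using that subs by blast
  have inA: "Low \<subseteq> A" "Top \<subseteq> A" "Mid \<subseteq> A" by (auto simp: Low_def Top_def Mid_def)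
  have window: "h v + picked j v \<le> t v \<and> t v \<le> h v + picked j v + card (N v \<inter> B)" if v: "v \<in> A" for v
  proof -
    have "v \<in> Low \<or> v \<in> Top \<or> v \<in> Mid" using v A_partition(1) by blast
    then consider "v \<in> Low" | "v \<in> Top" | "v \<in> Mid" by blast
    thus ?thesis
    proof cases
      case 1
      thus ?thesis using t(1)[OF 1] by (simp add: picked_def)
    next
      case 2
      hence "v \<notin> Low" using A_partition(2) by blast
      thus ?thesis using t(2)[OF 2] 2 by (simp add: picked_def)
    next
      case 3
      hence "v \<notin> Low" "v \<notin> Top" using A_partition(3,4) by blast+
      hence i: "picked j v = card {w\<in>N v \<inter> P. pick_rank w v < j w}" by (simp add: picked_def)
      define \<alpha> p \<beta> where "\<alpha> = real (card (N v \<inter> A))" and "p = real (card (N v \<inter> P))" and "\<beta> = real (card (N v \<inter> B))"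
      have ds: "dd = \<alpha> + p + \<beta>" using deg_split[OF AV[OF v]] by (simp add: \<alpha>_def p_def \<beta>_def)
      have h1: "\<bar>real (h v) - \<xi> v * \<alpha>\<bar> \<le> \<omega>" using h_approx[OF v] by (simp add: \<alpha>_def)
      have h2: "\<bar>real (picked j v) - \<xi> v * p\<bar> \<le> 33 * (Q * \<omega>)" using j(2)[OF 3] i by (simp add: p_def)
      have "\<xi> v * (dd - \<beta>) = \<xi> v * \<alpha> + \<xi> v * p" using ds by (simp add: algebra_simps)
      moreover have "\<omega> \<le> Q * \<omega>" using mult_right_mono[of 1 Q \<omega>] Q_ge \<omega>_facts(1) by simp
      ultimately have "\<bar>(real (h v) + real (picked j v)) - \<xi> v * (dd - \<beta>)\<bar> \<le> 34 * (Q * \<omega>)"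
        using h1 h2 by linarith
      from mid_window[OF 3 this[unfolded \<beta>_def] t(3)[OF 3]]
      have "real (h v + picked j v) \<le> real (t v)" "real (t v) \<le> real (h v + picked j v + card (N v \<inter> B))" by simp_all
      thus ?thesis by (simp only: of_nat_le_iff)
    qed
  qed
  define incset where "incset = (\<lambda>v. {w\<in>N v \<inter> P. v \<in> Top \<or> (v \<in> Mid \<and> pick_rank w v < j w)})"
  define nb where "nb = (\<lambda>v. if v \<in> A then {u\<in>N v \<inter> A. NN \<le> x u + x v} \<union> incset v \<union> control t j v
      else if v \<in> P then (N v \<inter> Top) \<union> {u\<in>palette v. pick_rank v u < j v} \<union> {w\<in>N v \<inter> B. pick_rank w v < j w}
      else {u\<in>palette v. pick_rank v u < j v} \<union> {u\<in>N v \<inter> A. v \<in> control t j u})"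
  have nbA: "nb v = {u\<in>N v \<inter> A. NN \<le> x u + x v} \<union> incset v \<union> control t j v" if "v \<in> A" for v
    using that by (simp add: nb_def)
  have nbP: "nb v = (N v \<inter> Top) \<union> {u\<in>N v \<inter> Mid. pick_rank v u < j v} \<union> {w\<in>N v \<inter> B. pick_rank w v < j w}" if "v \<in> P" for v
  proof -
    have "v \<notin> A" using that parts by blast
    thus ?thesis using that by (simp add: nb_def palette_def)
  qed
  have nbB: "nb v = {u\<in>N v \<inter> P. pick_rank v u < j v} \<union> {u\<in>N v \<inter> A. v \<in> control t j u}" if "v \<in> B" for v
  proof -
    have "v \<notin> A" "v \<notin> P" using that parts by blast+
    thus ?thesis by (simp add: nb_def palette_def)
  qed
  have cases: "v \<in> A \<or> v \<in> P \<or> v \<in> B" if "v \<in> V" for v using that parts(1) by blast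
  have sub: "nb v \<subseteq> N v" if v: "v \<in> V" for v
    using cases[OF v] nbA[of v] nbP[of v] nbB[of v] by (auto simp: incset_def control_def)
  have symA: "v \<in> nb u" if v: "v \<in> A" and u: "u \<in> nb v" for v u
  proof -
    have vu: "v \<in> N u" using N_sym[OF AV[OF v]] sub[OF AV[OF v]] u by blast
    consider "u \<in> A" "NN \<le> x u + x v" | "u \<in> incset v" | "u \<in> control t j v" using u nbA[OF v] by blast
    thus ?thesis
    proof cases
      case 1
      thus ?thesis using nbA[OF 1(1)] vu v by (simp add: add.commute)
    next
      case 2
      hence "u \<in> P" by (simp add: incset_def)
      thus ?thesis using nbP[of u] 2 vu by (auto simp: incset_def)
    next
      case 3
      hence "u \<in> B" by (simp add: control_def)
      thus ?thesis using nbB[of u] 3 vu v by auto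
    qed
  qed
  have symP: "v \<in> nb u" if v: "v \<in> P" and u: "u \<in> nb v" for v u
  proof -
    have vV: "v \<in> V" using v subs by blast
    have vu: "v \<in> N u" using N_sym[OF vV] sub[OF vV] u by blast
    consider "u \<in> Top" | "u \<in> Mid" "pick_rank v u < j v" | "u \<in> B" "pick_rank u v < j u" using u nbP[OF v] by blast
    thus ?thesis
    proof cases
      case 1
      hence "v \<in> incset u" using vu v by (simp add: incset_def)
      thus ?thesis using nbA[of u] 1 inA by blast
    next
      case 2
      hence "v \<in> incset u" using vu v by (simp add: incset_def)
      thus ?thesis using nbA[of u] 2 inA by blast
    next
      case 3
      thus ?thesis using nbB[of u] vu v by simp
    qed
  qed
  have symB: "v \<in> nb u" if v: "v \<in> B" and u: "u \<in> nb v" for v u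
  proof -
    have vV: "v \<in> V" using v subs by blast
    have vu: "v \<in> N u" using N_sym[OF vV] sub[OF vV] u by blast
    consider "u \<in> P" "pick_rank v u < j v" | "u \<in> A" "v \<in> control t j u" using u nbB[OF v] by blast
    thus ?thesis
    proof cases
      case 1
      thus ?thesis using nbP[of u] vu v by simp
    next
      case 2
      thus ?thesis using nbA[of u] by simp
    qed
  qed
  have sym: "\<forall>v\<in>V. \<forall>u\<in>nb v. v \<in> nb u" using cases symA symP symB by blast
  have degA: "card (nb v) = t v" if v: "v \<in> A" for v
  proof -
    have fin: "finite (N v)" using finN AV[OF v] by blast
    have control: "card (control t j v) = t v - (h v + picked j v)"
      unfolding control_def card_control_rank_less[OF AV[OF v]] using window[OF v] by (intro min_absorb1) linarith
    have picked: "card (incset v) = picked j v"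
    proof -
      have "v \<in> Low \<or> v \<in> Top \<or> v \<in> Mid" using v A_partition(1) by blast
      then consider "v \<in> Low" "v \<notin> Top" "v \<notin> Mid" | "v \<in> Top" "v \<notin> Low" | "v \<in> Mid" "v \<notin> Low" "v \<notin> Top" using A_partition(2-4) by blast
      thus ?thesis
      proof cases
        case 1
        thus ?thesis by (simp add: incset_def picked_def)
      next
        case 2
        have "incset v = N v \<inter> P" using 2 by (auto simp: incset_def)
        thus ?thesis using 2 by (simp add: picked_def)
      next
        case 3
        thus ?thesis by (simp add: incset_def picked_def)
      qed
    qed
    have hh: "card {u\<in>N v \<inter> A. NN \<le> x u + x v} = h v" by (simp add: h_def thr_def)
    have f3: "finite {u\<in>N v \<inter> A. NN \<le> x u + x v}" "finite (incset v)" "finite (control t j v)"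
      by (rule finite_subset[OF _ fin]; auto simp: incset_def control_def)+
    have d1: "{u\<in>N v \<inter> A. NN \<le> x u + x v} \<inter> incset v = {}" using parts by (auto simp: incset_def)
    have d2: "({u\<in>N v \<inter> A. NN \<le> x u + x v} \<union> incset v) \<inter> control t j v = {}" using parts by (auto simp: incset_def control_def)
    have "card (nb v) = h v + picked j v + (t v - (h v + picked j v))"
      unfolding nbA[OF v] card_Un_disjoint[OF finite_UnI[OF f3(1,2)] f3(3) d2] card_Un_disjoint[OF f3(1,2) d1] hh picked control ..
    thus ?thesis using window[OF v] by simp
  qed
  have degP: "card (nb v) = j v + inflow_P j v" if v: "v \<in> P" for v
  proof -
    have vV: "v \<in> V" using v subs by blast
    have fin: "finite (N v)" using finN vV by blast
    have pv: "palette v = N v \<inter> Mid" using v by (simp add: palette_def)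
    have f3: "finite (N v \<inter> Top)" "finite {u\<in>N v \<inter> Mid. pick_rank v u < j v}" "finite {w\<in>N v \<inter> B. pick_rank w v < j w}"
      by (rule finite_subset[OF _ fin]; auto)+
    have d1: "(N v \<inter> Top) \<inter> {u\<in>N v \<inter> Mid. pick_rank v u < j v} = {}" using A_partition(4) by blast
    have d2: "((N v \<inter> Top) \<union> {u\<in>N v \<inter> Mid. pick_rank v u < j v}) \<inter> {w\<in>N v \<inter> B. pick_rank w v < j w} = {}" using inA parts(3) by blast
    have c: "card {u\<in>N v \<inter> Mid. pick_rank v u < j v} = j v"
      using card_pick_rank_less[OF vV, of "j v"] j_le[of v] v unfolding pv by simp
    show ?thesis unfolding nbP[OF v] card_Un_disjoint[OF finite_UnI[OF f3(1,2)] f3(3) d2] card_Un_disjoint[OF f3(1,2) d1] c inflow_P_def by simp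
  qed
  have degB: "card (nb v) = j v + inflow_B t j v" if v: "v \<in> B" for v
  proof -
    have vV: "v \<in> V" using v subs by blast
    have fin: "finite (N v)" using finN vV by blast
    have pv: "palette v = N v \<inter> P" using v parts(4) by (auto simp: palette_def)
    have f2: "finite {u\<in>N v \<inter> P. pick_rank v u < j v}" "finite {u\<in>N v \<inter> A. v \<in> control t j u}"
      by (rule finite_subset[OF _ fin]; auto)+
    have d: "{u\<in>N v \<inter> P. pick_rank v u < j v} \<inter> {u\<in>N v \<inter> A. v \<in> control t j u} = {}" using parts(2) by blast
    have c: "card {u\<in>N v \<inter> P. pick_rank v u < j v} = j v"
      using card_pick_rank_less[OF vV, of "j v"] j_le[of v] v unfolding pv by simp
    show ?thesis unfolding nbB[OF v] card_Un_disjoint[OF f2 d] c inflow_B_def by simp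
  qed
  have "\<exists>c\<in>levels. c - 1 \<le> real (card {v\<in>V. card (nb v) = k}) \<and> real (card {v\<in>V. card (nb v) = k}) \<le> c + 1 + 2 * J" if k: "k \<le> d" for k
  proof -
    obtain c where c: "c \<in> levels" "\<bar>real (card {v\<in>A. t v = k}) - c\<bar> \<le> 1" using t(4)[OF k] by blast
    have "{v\<in>V. card (nb v) = k} = {v\<in>A. card (nb v) = k} \<union> {v\<in>P. card (nb v) = k} \<union> {v\<in>B. card (nb v) = k}"
      unfolding parts(1) by blast
    also have "{v\<in>A. card (nb v) = k} = {v\<in>A. t v = k}" using degA by auto
    also have "{v\<in>P. card (nb v) = k} = {w\<in>P. j w + inflow_P j w = k}" using degP by auto
    also have "{v\<in>B. card (nb v) = k} = {w\<in>B. j w + inflow_B t j w = k}" using degB by auto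
    finally have eq: "{v\<in>V. card (nb v) = k} = {v\<in>A. t v = k} \<union> {w\<in>P. j w + inflow_P j w = k} \<union> {w\<in>B. j w + inflow_B t j w = k}" .
    have d1: "{v\<in>A. t v = k} \<inter> {w\<in>P. j w + inflow_P j w = k} = {}" using parts(2) by blast
    have d2: "({v\<in>A. t v = k} \<union> {w\<in>P. j w + inflow_P j w = k}) \<inter> {w\<in>B. j w + inflow_B t j w = k} = {}" using parts(3,4) by blast
    have f: "finite {v\<in>A. t v = k}" "finite {w\<in>P. j w + inflow_P j w = k}" "finite {w\<in>B. j w + inflow_B t j w = k}" using fins by simp_all
    have "card {v\<in>V. card (nb v) = k} = card {v\<in>A. t v = k} + card {w\<in>P. j w + inflow_P j w = k} + card {w\<in>B. j w + inflow_B t j w = k}"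
      unfolding eq card_Un_disjoint[OF finite_UnI[OF f(1,2)] f(3) d2] card_Un_disjoint[OF f(1,2) d1] ..
    thus ?thesis using c j(3)[OF k] j(4)[OF k] by (intro bexI[OF _ c(1)]) linarith
  qed
  thus ?thesis using sub sym by (intro exI[of _ nb]) blast
qed

section \<open>Size of the levels\<close>

lemma inverse_Q_le: "k \<ge> 1 \<Longrightarrow> c \<le> 2000 \<Longrightarrow> 0 \<le> c \<Longrightarrow> c * (1 / Q^k) \<le> \<gamma>"
proof -
  assume k: "k \<ge> 1" and c: "c \<le> 2000" "0 \<le> c"
  have "Q^1 \<le> Q^k" using k Q_ge by (intro power_increasing) auto
  hence "1 / Q^k \<le> 1 / Q" using Q_ge by (intro divide_left_mono) auto
  hence "c * (1 / Q^k) \<le> 2000 * (1 / Q)" using c Q_ge by (intro mult_mono) auto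
  also have "\<dots> \<le> \<gamma>" using Q_ge by (simp add: field_simps)
  finally show ?thesis .
qed

lemma n_dd: "n / dd \<le> n / (dd + 1) * (1 + \<gamma>)"
proof -
  have "1 \<le> \<gamma> * dd"
  proof -
    have "1 * (Q * \<gamma>) \<le> Q * (Q * \<gamma>)" using Q_ge by (intro mult_right_mono) auto
    moreover have "Q^2 * \<gamma> \<le> dd * \<gamma>"
    proof (intro mult_right_mono)
      have "Q^2 \<le> Q^10" using Q_ge by (intro power_increasing) auto
      thus "Q^2 \<le> dd" using dd_ge by (rule order.trans)
    qed (use \<gamma> in auto)
    ultimately show ?thesis using Q_ge by (simp add: power2_eq_square mult_ac)
  qed
  hence "n * (dd + 1) \<le> n * (dd * (1 + \<gamma>))" using n_pos by (intro mult_left_mono) (auto simp: algebra_simps)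
  thus ?thesis using dd_pos by (simp add: field_simps)
qed

lemma edge_level:
  assumes "\<bar>c - \<delta> * a\<bar> \<le> n / Q^5"
  shows "(1 - 3 * \<gamma>) * (n / (dd + 1)) \<le> c / real L0" "c / real L0 \<le> (1 + 3 * \<gamma>) * (n / (dd + 1))"
proof -
  define u where "u = n / Q^3"
  have u0: "u > 0" using n_pos Q_ge by (simp add: u_def)
  have s1: "n / Q^5 \<le> \<gamma>/4 * u"
  proof -
    have "n / Q^5 = u * (1 / Q^2)" by (simp add: u_def power_add[symmetric])
    also have "\<dots> \<le> u * (\<gamma>/4)" using inverse_Q_le[of 2 4] u0 by (intro mult_left_mono) auto
    finally show ?thesis by (simp add: mult.commute)
  qed
  have s2: "\<delta> * a \<le> u" "\<delta> * a \<ge> u - \<gamma>/4 * u"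
  proof -
    show "\<delta> * a \<le> u" using mult_left_mono[OF a_bounds(1), of \<delta>] \<delta>_facts by (simp add: u_def \<delta>_def)
    have "\<delta> * a \<ge> \<delta> * (n * (1 - 3 / Q))" using a_bounds(2) \<delta>_facts by (intro mult_left_mono) auto
    moreover have "\<delta> * (n * (1 - 3 / Q)) = u - u * (3 / Q)" by (simp add: u_def \<delta>_def algebra_simps)
    moreover have "u * (3 / Q) \<le> u * (\<gamma>/4)" using inverse_Q_le[of 1 12] u0 by (intro mult_left_mono) auto
    ultimately show "\<delta> * a \<ge> u - \<gamma>/4 * u" by (simp add: mult.commute)
  qed
  have c1: "c \<ge> u * (1 - \<gamma>)" "c \<le> u * (1 + \<gamma>)"
  proof -
    have g: "\<gamma> * u \<ge> 0" using u0 \<gamma> by simp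
    have e: "u * (1 - \<gamma>) = u - \<gamma> * u" "u * (1 + \<gamma>) = u + \<gamma> * u" by (simp_all add: algebra_simps)
    show "c \<ge> u * (1 - \<gamma>)" using assms s1 s2(2) g unfolding e abs_le_iff by linarith
    show "c \<le> u * (1 + \<gamma>)" using assms s1 s2(1) g unfolding e abs_le_iff by linarith
  qed
  define l where "l = dd / Q^3"
  have l0: "l > 0" using dd_pos Q_ge by (simp add: l_def)
  have ul: "u / l = n / dd" using Q_ge by (simp add: u_def l_def)
  have L0l: "real L0 \<ge> l" "real L0 \<le> l * (1 + 2 * \<gamma>)"
  proof -
    have g: "\<gamma> * l \<ge> 1"
    proof -
      have "\<gamma> * l = (Q * \<gamma>) * (Q * \<omega>)" unfolding l_def \<omega>_facts(4) by (simp add: power2_eq_square)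
      also have "\<dots> \<ge> 1 * (1 * 1)" using Q_ge \<omega>_facts(1) by (intro mult_mono) auto
      finally show ?thesis by simp
    qed
    have "(1 + \<gamma>) * dd / Q^3 = l + \<gamma> * l" by (simp add: l_def algebra_simps add_divide_distrib)
    thus "real L0 \<ge> l" "real L0 \<le> l * (1 + 2 * \<gamma>)" using L0_bounds(1,2) g by (auto simp: algebra_simps)
  qed
  have mu: "n / (dd + 1) > 0" "n / (dd+1) \<le> n / dd" using n_pos dd_pos by (auto intro!: divide_left_mono)
  show "c / real L0 \<le> (1 + 3 * \<gamma>) * (n / (dd + 1))"
  proof -
    have "c / real L0 \<le> (u * (1 + \<gamma>)) / l" using c1 L0l l0 u0 \<gamma> by (intro frac_le) auto
    also have "\<dots> = (u / l) * (1 + \<gamma>)" by simp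
    also have "\<dots> = (n / dd) * (1 + \<gamma>)" unfolding ul ..
    also have "\<dots> \<le> (n / (dd + 1) * (1 + \<gamma>)) * (1 + \<gamma>)" using n_dd \<gamma> by (intro mult_right_mono) auto
    also have "\<dots> = (1 + 2 * \<gamma> + \<gamma> * \<gamma>) * (n / (dd + 1))"
    proof -
      have "(z * (1 + \<gamma>)) * (1 + \<gamma>) = (1 + 2 * \<gamma> + \<gamma> * \<gamma>) * z" for z :: real by (simp add: algebra_simps)
      thus ?thesis .
    qed
    also have "\<dots> \<le> (1 + 3 * \<gamma>) * (n / (dd + 1))"
      using mult_left_mono[OF \<gamma>(2), of \<gamma>] \<gamma> mu by (intro mult_right_mono) auto
    finally show ?thesis .
  qed
  show "(1 - 3 * \<gamma>) * (n / (dd + 1)) \<le> c / real L0"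
  proof (cases "1 - 3 * \<gamma> \<le> 0")
    case True
    have "(1 - 3 * \<gamma>) * (n / (dd + 1)) \<le> 0" by (rule mult_nonpos_nonneg) (use True mu in auto)
    moreover have "c / real L0 \<ge> 0" using c1(1) u0 \<gamma> by (intro divide_nonneg_nonneg) (auto intro: order.trans[OF _ c1(1)])
    ultimately show ?thesis by linarith
  next
    case False
    have "(1 - 3 * \<gamma>) * (1 + 2 * \<gamma>) \<le> 1 - \<gamma>" using \<gamma> by (simp add: algebra_simps)
    hence "1 - 3 * \<gamma> \<le> (1 - \<gamma>) / (1 + 2 * \<gamma>)" using \<gamma> by (simp add: le_divide_eq)
    hence "(1 - 3 * \<gamma>) * (n / (dd + 1)) \<le> (1 - \<gamma>) / (1 + 2 * \<gamma>) * (n / dd)"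
      using mu \<gamma> by (intro mult_mono) auto
    also have "\<dots> = (u * (1 - \<gamma>)) / (l * (1 + 2 * \<gamma>))" unfolding ul[symmetric] by (simp add: mult.commute)
    also have "\<dots> \<le> c / real L0" using c1 L0l l0 u0 \<gamma> L0_bounds(3) by (intro frac_le) (auto intro: order.trans[OF _ c1(1)])
    finally show ?thesis .
  qed
qed

lemma mid_level:
  assumes g8: "\<gamma> \<le> 1/8"
  shows "(1 - 3 * \<gamma>) * (n / (dd + 1)) \<le> real (card Mid) / (dd + 1 - 2 * real L0)"
    and "real (card Mid) / (dd + 1 - 2 * real L0) \<le> (1 + 3 * \<gamma>) * (n / (dd + 1))"
proof -
  have mu: "n / (dd + 1) > 0" using n_pos dd_pos by simp
  have den: "dd + 1 - 2 * real L0 \<le> dd + 1" "dd + 1 - 2 * real L0 \<ge> (dd + 1) * (1 - \<gamma>)"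
  proof -
    show "dd + 1 - 2 * real L0 \<le> dd + 1" by simp
    have "2 * real L0 \<le> dd * (6 * (1 / Q^3))" using mult_left_mono[OF L0_bounds(4), of 2] by (simp add: mult.commute)
    also have "\<dots> \<le> dd * \<gamma>" using inverse_Q_le[of 3 6] dd_pos by (intro mult_left_mono) auto
    finally show "dd + 1 - 2 * real L0 \<ge> (dd + 1) * (1 - \<gamma>)" using \<gamma> by (simp add: algebra_simps)
  qed
  have den0: "(dd + 1) * (1 - \<gamma>) > 0" using dd_pos g8 by simp
  have "real (card Mid) \<ge> n * (1 - \<gamma>)"
  proof -
    have "a \<ge> n - n * (3 / Q)" using a_bounds(2) by (simp add: algebra_simps)
    moreover have "n * (3 / Q) \<le> n * (\<gamma>/4)" using inverse_Q_le[of 1 12] n_pos by (intro mult_left_mono) auto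
    moreover have "\<delta> * a \<le> n * (\<gamma>/8)"
    proof -
      have "\<delta> * a \<le> (\<gamma>/8) * n" using inverse_Q_le[of 3 8] a_bounds(1) a_pos \<delta>_facts \<gamma> by (intro mult_mono) (auto simp: \<delta>_def)
      thus ?thesis by (simp add: mult.commute)
    qed
    moreover have "n / Q^5 \<le> n * (\<gamma>/8)" using mult_left_mono[OF inverse_Q_le[of 5 8], of "n/8"] n_pos by simp
    moreover have "real (card Mid) \<ge> a - 2 * (\<delta> * a) - 2 * (n / Q^5)" using card_Mid by (simp add: abs_le_iff algebra_simps)
    moreover have "n * (1 - \<gamma>) = n - n * (\<gamma>/4) - 2 * (n * (\<gamma>/8)) - 2 * (n * (\<gamma>/8)) - n * (\<gamma>/4)" by (simp add: algebra_simps)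
    moreover have "n * (\<gamma>/4) \<ge> 0" using n_pos \<gamma> by simp
    ultimately show ?thesis by linarith
  qed
  hence "n * (1 - \<gamma>) / (dd + 1) \<le> real (card Mid) / (dd + 1 - 2 * real L0)"
    using den den0 n_pos \<gamma> by (intro frac_le) auto
  moreover have "(1 - 3 * \<gamma>) * (n / (dd + 1)) \<le> (1 - \<gamma>) * (n / (dd + 1))" using mu \<gamma> by (intro mult_right_mono) auto
  ultimately show "(1 - 3 * \<gamma>) * (n / (dd + 1)) \<le> real (card Mid) / (dd + 1 - 2 * real L0)" by (simp add: mult.commute)
  have "real (card Mid) \<le> n" unfolding n_def using finV subs by (auto simp: Mid_def intro!: card_mono)
  hence "real (card Mid) / (dd + 1 - 2 * real L0) \<le> n / ((dd + 1) * (1 - \<gamma>))" using den den0 n_pos by (intro frac_le) auto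
  also have "\<dots> = (1 / (1 - \<gamma>)) * (n / (dd + 1))" by simp
  also have "\<dots> \<le> (1 + 3 * \<gamma>) * (n / (dd + 1))"
  proof (intro mult_right_mono)
    have "\<gamma> * \<gamma> \<le> \<gamma> * (1/8)" using g8 \<gamma> by (intro mult_left_mono) auto
    hence "1 \<le> (1 + 3 * \<gamma>) * (1 - \<gamma>)" using \<gamma> by (simp add: algebra_simps)
    thus "1 / (1 - \<gamma>) \<le> 1 + 3 * \<gamma>" using g8 by (simp add: divide_le_eq)
  qed (use mu in auto)
  finally show "real (card Mid) / (dd + 1 - 2 * real L0) \<le> (1 + 3 * \<gamma>) * (n / (dd + 1))" .
qed

text \<open>
The clump bound with \<open>\<theta> = ln Q\<close> is at most \<open>(d + 1) Q\<^sup>-\<^sup>6\<^sup>0\<close>, which beats \<open>d \<le> (2 Q)\<^sup>4\<^sup>0\<close>; this is where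
\<open>q\<close> has to be a power of \<open>d\<close>.
\<close>

lemma near_uniform_subgraph:
  fixes \<epsilon> :: real
  assumes \<epsilon>: "0 < \<epsilon>" "\<epsilon> \<le> 1" "\<gamma> = \<epsilon> / 8" and mu: "960 / \<epsilon> * (dd + 1) \<le> n"
    and d_up: "dd \<le> (2 * Q)^40" and n_up: "n \<le> Q^200"
    and Q1: "256 / \<epsilon> \<le> ln Q" and Q2: "8 * Q^200 * exp (- (Q^30 / 4)) \<le> 1" and dQ: "Q^40 \<le> dd"
  shows "\<exists>nb. (\<forall>v\<in>V. nb v \<subseteq> N v) \<and> (\<forall>v\<in>V. \<forall>u\<in>nb v. v \<in> nb u) \<and>
     (\<forall>k\<le>d. (1 - \<epsilon>) * (n / (dd + 1)) \<le> real (card {v\<in>V. card (nb v) = k}) \<and> real (card {v\<in>V. card (nb v) = k}) \<le> (1 + \<epsilon>) * (n / (dd + 1)))"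
proof -
  define \<mu> where "\<mu> = n / (dd + 1)"
  define J where "J = \<epsilon> / 8 * \<mu>"
  have \<mu>0: "\<mu> \<ge> 960 / \<epsilon>" using mu dd_pos by (simp add: \<mu>_def le_divide_eq)
  hence \<epsilon>\<mu>: "\<epsilon> * \<mu> \<ge> 960" using \<epsilon> by (simp add: field_simps)
  have \<mu>pos: "\<mu> > 0" using n_pos dd_pos by (simp add: \<mu>_def)
  have "n * (2 * exp (- ((Q * \<omega>)^2) / (4 * dd))) \<le> 1/4"
  proof -
    have "(Q * \<omega>)^2 / (4 * dd) = \<omega> / (4 * Q^3)"
      using \<omega>_facts(1) Q_ge unfolding \<omega>_facts(2) by (simp add: field_simps power2_eq_square power_numeral_reduce)
    moreover have "Q^35 \<le> \<omega>"
    proof -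
      have "Q^5 * Q^35 \<le> Q^5 * \<omega>" using dQ unfolding \<omega>_facts(2) by (simp flip: power_add)
      thus ?thesis by (rule mult_left_le_imp_le) (use Q_ge in auto)
    qed
    hence "Q^35 / (4 * Q^3) \<le> \<omega> / (4 * Q^3)" using Q_ge by (intro divide_right_mono) auto
    moreover have "Q^35 / (4 * Q^3) = Q^32 / 4" using Q_ge by (simp add: field_simps flip: power_add)
    moreover have "Q^30 \<le> Q^32" using Q_ge by (intro power_increasing) auto
    ultimately have "Q^30 / 4 \<le> (Q * \<omega>)^2 / (4 * dd)" by linarith
    hence "exp (- ((Q * \<omega>)^2) / (4 * dd)) \<le> exp (- (Q^30 / 4))" by simp
    hence "n * (2 * exp (- ((Q * \<omega>)^2) / (4 * dd))) \<le> Q^200 * (2 * exp (- (Q^30 / 4)))"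
      using n_up n_pos Q_ge by (intro mult_mono) auto
    thus ?thesis using Q2 by simp
  qed
  moreover have "(dd + 1) * exp (- (ln Q * J) + 8 * n / dd) \<le> 1/4"
  proof -
    have "8 * n / dd \<le> 16 * \<mu>"
    proof -
      have "n / dd \<le> \<mu> * (1 + \<gamma>)" using n_dd by (simp add: \<mu>_def)
      also have "\<dots> \<le> \<mu> * 2" using \<gamma> \<mu>pos by (intro mult_left_mono) auto
      finally show ?thesis by simp
    qed
    moreover have "16 * \<mu> \<le> ln Q * J / 2"
    proof -
      have "(256 / \<epsilon>) * J \<le> ln Q * J" using Q1 \<mu>pos \<epsilon> by (intro mult_right_mono) (auto simp: J_def)
      moreover have "(256 / \<epsilon>) * J = 32 * \<mu>" using \<epsilon> by (simp add: J_def)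
      ultimately show ?thesis by simp
    qed
    moreover have "ln Q * 60 \<le> ln Q * J / 2"
    proof -
      have "J / 2 \<ge> 60" using \<epsilon>\<mu> by (simp add: J_def)
      hence "ln Q * 60 \<le> ln Q * (J / 2)" using Q_ge by (intro mult_left_mono) auto
      thus ?thesis by simp
    qed
    ultimately have "- (ln Q * J) + 8 * n / dd \<le> - (60 * ln Q)" by linarith
    hence "exp (- (ln Q * J) + 8 * n / dd) \<le> exp (- (60 * ln Q))" by simp
    also have "\<dots> = 1 / Q^60"
    proof -
      have "exp (60 * ln Q) = Q^60" using Q_ge exp_of_nat_mult[of 60 "ln Q"] by simp
      thus ?thesis by (simp add: exp_minus inverse_eq_divide)
    qed
    finally have "(dd + 1) * exp (- (ln Q * J) + 8 * n / dd) \<le> (2 * (2 * Q)^40) * (1 / Q^60)"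
    proof (rule mult_mono[rotated])
      have "1 \<le> (2 * Q)^40" using Q_ge by (intro one_le_power) auto
      thus "dd + 1 \<le> 2 * (2 * Q)^40" using d_up by linarith
    qed (use Q_ge in auto)
    also have "\<dots> \<le> 1/4"
    proof -
      have "(2::real)^43 \<le> 2000^4" by simp
      also have "\<dots> \<le> Q^4" using Q_ge by (intro power_mono) auto
      also have "\<dots> \<le> Q^20" using Q_ge by (intro power_increasing) auto
      finally have "2^43 * Q^40 \<le> Q^20 * Q^40" using Q_ge by (intro mult_right_mono) auto
      hence "8 * (2 * Q)^40 \<le> Q^60" by (simp add: power_mult_distrib flip: power_add)
      thus ?thesis using Q_ge by (simp add: divide_le_eq)
    qed
    finally show ?thesis .
  qed
  ultimately obtain nb where nb: "\<forall>v\<in>V. nb v \<subseteq> N v" "\<forall>v\<in>V. \<forall>u\<in>nb v. v \<in> nb u"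
     "\<And>k. k \<le> d \<Longrightarrow> \<exists>c\<in>levels. c - 1 \<le> real (card {v\<in>V. card (nb v) = k}) \<and> real (card {v\<in>V. card (nb v) = k}) \<le> c + 1 + 2 * J"
    using subgraph_exists[of J] by blast
  have lev: "(1 - 3 * \<gamma>) * \<mu> \<le> c \<and> c \<le> (1 + 3 * \<gamma>) * \<mu>" if "c \<in> levels" for c
  proof -
    have "\<gamma> \<le> 1/8" using \<epsilon> by simp
    thus ?thesis using that edge_level[OF card_Low] edge_level[OF card_Top] mid_level unfolding levels_def \<mu>_def by blast
  qed
  have "(1 - \<epsilon>) * \<mu> \<le> real (card {v\<in>V. card (nb v) = k}) \<and> real (card {v\<in>V. card (nb v) = k}) \<le> (1 + \<epsilon>) * \<mu>" if k: "k \<le> d" for k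
  proof -
    obtain c where c: "c \<in> levels" "c - 1 \<le> real (card {v\<in>V. card (nb v) = k})" "real (card {v\<in>V. card (nb v) = k}) \<le> c + 1 + 2 * J"
      using nb(3)[OF k] by blast
    define z where "z = \<epsilon> * \<mu>"
    have "3 * \<gamma> * \<mu> = 3/8 * z" "J = z / 8" using \<epsilon>(3) by (simp_all add: z_def J_def)
    moreover have "(1 - 3 * \<gamma>) * \<mu> = \<mu> - 3 * \<gamma> * \<mu>" "(1 + 3 * \<gamma>) * \<mu> = \<mu> + 3 * \<gamma> * \<mu>"
      "(1 - \<epsilon>) * \<mu> = \<mu> - z" "(1 + \<epsilon>) * \<mu> = \<mu> + z" by (simp_all add: algebra_simps z_def)
    ultimately show ?thesis using lev[OF c(1)] c(2,3) \<epsilon>\<mu> unfolding z_def[symmetric] by (intro conjI) linarith+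
  qed
  thus ?thesis using nb(1,2) unfolding \<mu>_def by blast
qed

end

section \<open>Existence of configurations\<close>

context regular_nbhds
begin

text \<open>
The union bounds over vertices and labels need \<open>n\<close> to be polynomial in \<open>d\<close>; the cumulative counts need
\<open>n/(d+1)\<close> to exceed a constant \<open>M\<close> depending on \<open>\<epsilon>\<close>.
\<close>

lemma dense_regular_subgraph:
  fixes \<epsilon> M :: real and q K :: nat
  defines "Q \<equiv> real q" and "n \<equiv> real (card V)" and "\<eta> \<equiv> \<epsilon> / 32"
  defines "r \<equiv> exp (- (\<eta>^2) / 256)"
  assumes \<epsilon>: "0 < \<epsilon>" "\<epsilon> \<le> 1" and d_q: "q^40 \<le> d" "d \<le> (2 * q)^40" and n_q: "n \<le> Q^200"
    and Mn: "M * (real d + 1) \<le> n" and M: "960 / \<epsilon> \<le> M" "5856 * real K / \<eta>^2 \<le> M"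
    and q_large: "16000 / \<epsilon> \<le> Q" "3200 * real K / \<eta>^2 \<le> Q" "K \<le> q" "256 / \<epsilon> \<le> ln Q"
      "8 * Q^450 * exp (- (Q^30 / 4)) \<le> 1"
    and K: "8 \<le> \<eta> * real K" "9 / \<eta> * (r ^ K / (1 - r)) \<le> 1/8"
  shows "\<exists>nb. (\<forall>v\<in>V. nb v \<subseteq> N v) \<and> (\<forall>v\<in>V. \<forall>u\<in>nb v. v \<in> nb u) \<and>
     (\<forall>k\<le>d. (1 - \<epsilon>) * (n / (real d + 1)) \<le> real (card {v\<in>V. card (nb v) = k}) \<and> real (card {v\<in>V. card (nb v) = k}) \<le> (1 + \<epsilon>) * (n / (real d + 1)))"
proof -
  define dd where "dd = real d"
  define E where "E = exp (- (Q^30 / 4))"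
  have \<eta>: "0 < \<eta>" "\<eta> \<le> 1" using \<epsilon> by (auto simp: \<eta>_def)
  have Q16: "Q \<ge> 16000"
  proof -
    have "16000 / 1 \<le> 16000 / \<epsilon>" using \<epsilon> by (intro divide_left_mono) auto
    thus ?thesis using q_large(1) by linarith
  qed
  have M960: "M \<ge> 960"
  proof -
    have "960 / 1 \<le> 960 / \<epsilon>" using \<epsilon> by (intro divide_left_mono) auto
    thus ?thesis using M(1) by linarith
  qed
  have q2: "q \<ge> 2" using Q16 by (simp add: Q_def)
  have dQ: "Q^40 \<le> dd" "dd \<le> (2 * Q)^40"
  proof -
    have "real (q^40) \<le> real d" "real d \<le> real ((2 * q)^40)" using d_q by (simp_all only: of_nat_le_iff)
    thus "Q^40 \<le> dd" "dd \<le> (2 * Q)^40" by (simp_all add: Q_def dd_def)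
  qed
  have dpow: "Q^k \<le> dd" if "k \<le> 40" for k
  proof -
    have "Q^k \<le> Q^40" using that Q16 by (intro power_increasing) auto
    thus ?thesis using dQ(1) by (rule order.trans)
  qed
  have dd0: "dd > 0" using dpow[of 0] by simp
  have d0: "d > 0" using dd0 by (simp add: dd_def)
  have E0: "E > 0" by (simp add: E_def)
  have E_small: "8 * Q^k * E \<le> 1" if "k \<le> 450" for k
  proof -
    have "Q^k \<le> Q^450" using that Q16 by (intro power_increasing) auto
    hence "8 * Q^k * E \<le> 8 * Q^450 * E" using E0 by (intro mult_right_mono mult_left_mono) auto
    thus ?thesis using q_large(5) unfolding E_def by (rule order.trans)
  qed
  have exp_E: "exp (- z) \<le> E" if "z \<ge> Q^30 / 4" for z using that by (simp add: E_def)
  have "4 * real (card V) * exp (- (real d / (16 * real q^4))) < 1"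
  proof -
    have "Q^30 / 4 \<le> dd / (16 * Q^4)"
    proof -
      have "4 \<le> Q^1" using Q16 by simp
      hence "4 * Q^34 \<le> Q^1 * Q^34" using Q16 by (intro mult_right_mono) auto
      also have "Q^1 * Q^34 = Q^35" using power_add[of Q 1 34] by simp
      finally have "4 * Q^34 \<le> dd" using dpow[of 35] by simp
      thus ?thesis using Q16 by (simp add: divide_simps power_add[symmetric] mult.commute flip: power_add)
    qed
    hence "exp (- (dd / (16 * Q^4))) \<le> E" by (rule exp_E)
    hence "4 * n * exp (- (dd / (16 * Q^4))) \<le> 4 * Q^200 * E" using n_q Q16 by (intro mult_mono) (auto simp: n_def)
    also have "\<dots> < 1" using E_small[of 200] by simp
    finally show ?thesis by (simp add: n_def dd_def Q_def)
  qed
  from roles_exist[OF q2 this d0] obtain P B where PB: "P \<subseteq> V" "B \<subseteq> V" "P \<inter> B = {}"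
    and NPB: "\<And>v. v \<in> V \<Longrightarrow> real d / (2 * real q) \<le> real (card (N v \<inter> P)) \<and> real (card (N v \<inter> P)) \<le> 2 * real d / real q
     \<and> real d / (2 * real q^2) \<le> real (card (N v \<inter> B)) \<and> real (card (N v \<inter> B)) \<le> 2 * real d / real q^2" by blast
  define A where "A = V - P - B"
  have AV: "A \<subseteq> V" by (auto simp: A_def)
  have NA: "real (card (N v \<inter> A)) \<ge> dd / 2" "card (N v \<inter> A) \<le> d" if v: "v \<in> V" for v
  proof -
    have fN: "finite (N v)" using finN[OF v] .
    have "N v \<subseteq> (N v \<inter> A) \<union> (N v \<inter> P) \<union> (N v \<inter> B)" using N_sub[OF v] by (auto simp: A_def)
    hence "card (N v) \<le> card ((N v \<inter> A) \<union> (N v \<inter> P) \<union> (N v \<inter> B))" using fN by (intro card_mono) auto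
    also have "\<dots> \<le> card (N v \<inter> A) + card (N v \<inter> P) + card (N v \<inter> B)"
      by (rule order.trans[OF card_Un_le]) (simp add: card_Un_le)
    finally have "dd \<le> real (card (N v \<inter> A)) + real (card (N v \<inter> P)) + real (card (N v \<inter> B))"
      unfolding N_card[OF v] dd_def by linarith
    moreover have "2 * real d / real q \<le> dd / 4"
    proof -
      have "2 * dd / Q \<le> 2 * dd / 8" using Q16 dd0 by (intro divide_left_mono) auto
      thus ?thesis by (simp add: dd_def Q_def)
    qed
    moreover have "2 * real d / real q^2 \<le> dd / 4"
    proof -
      have "8 \<le> Q^1" using Q16 by simp
      also have "\<dots> \<le> Q^2" using Q16 by (intro power_increasing) auto
      finally have "2 * dd / Q^2 \<le> 2 * dd / 8" using dd0 by (intro divide_left_mono) auto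
      thus ?thesis by (simp add: dd_def Q_def)
    qed
    ultimately show "real (card (N v \<inter> A)) \<ge> dd / 2" using NPB[OF v] by linarith
    show "card (N v \<inter> A) \<le> d" using card_mono[OF fN, of "N v \<inter> A"] N_card[OF v] by simp
  qed
  have cA: "real (card A) \<ge> n / 2"
  proof -
    have "(\<Sum>v\<in>V. dd / 2) \<le> (\<Sum>v\<in>V. real (card (N v \<inter> A)))" by (intro sum_mono NA)
    also have "\<dots> = real (\<Sum>v\<in>V. card (N v \<inter> A))" by simp
    also have "\<dots> = dd * real (card A)" unfolding double_count[OF AV] by (simp add: dd_def)
    finally have "dd * (n / 2) \<le> dd * real (card A)" by (simp add: n_def mult.commute)
    thus ?thesis using dd0 by (rule mult_left_le_imp_le)
  qed
  have cA2: "real (card A) \<ge> M / 2 * dd"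
  proof -
    have "M * dd \<le> M * (dd + 1)" using M960 by (intro mult_left_mono) auto
    thus ?thesis using cA Mn by (simp add: dd_def)
  qed
  have Ad: "d \<le> card A"
  proof -
    have "1 * dd \<le> M / 2 * dd" using M960 dd0 by (intro mult_right_mono) auto
    hence "dd \<le> real (card A)" using cA2 by linarith
    thus ?thesis by (simp add: dd_def)
  qed
  \<comment> \<open>the fraction 1/q^3 of the labels is an integer, and NN is at least d^4, so ties are rare\<close>
  define NN where "NN = q^3 * d^5"
  have NNd: "d^4 \<le> NN"
  proof -
    have "1 * (d^4 * 1) \<le> q^3 * (d^4 * d)" using d0 q2 by (intro mult_mono) auto
    thus ?thesis by (simp add: NN_def power_numeral_reduce mult_ac)
  qed
  have d8: "d \<ge> 8" using dpow[of 1] Q16 by (simp add: dd_def)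
  have dn: "dense_nbhds A (\<lambda>u. N u \<inter> A) d NN"
  proof
    show "finite A" using AV finV finite_subset by blast
    fix u assume u: "u \<in> A"
    hence uV: "u \<in> V" using AV by blast
    show "N u \<inter> A \<subseteq> A - {u}" using N_sub[OF uV] by auto
    show "card (N u \<inter> A) \<le> d" by (rule NA(2)[OF uV])
    show "d \<le> 2 * card (N u \<inter> A)" using NA(1)[OF uV] by (simp add: dd_def)
    fix w assume "w \<in> N u \<inter> A"
    thus "u \<in> N w \<inter> A" using N_sym[OF uV] u by blast
  qed (use d8 NNd in auto)
  define s where "s = real d / real q^5"
  have s_eq: "s = dd / Q^5" by (simp add: s_def dd_def Q_def)
  have s_ge: "Q^35 \<le> s"
  proof -
    have "Q^35 * Q^5 \<le> dd" using dQ(1) by (simp flip: power_add)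
    thus ?thesis using Q16 by (simp add: s_eq le_divide_eq)
  qed
  have Kq: "2 * K \<le> d"
  proof -
    have "2 * Q \<le> Q^2" unfolding power2_eq_square using Q16 by (intro mult_right_mono) auto
    hence "2 * Q \<le> dd" using dpow[of 2] by linarith
    moreover have "real K \<le> Q" using q_large(3) by (simp add: Q_def)
    ultimately have "2 * real K \<le> real d" by (simp add: dd_def)
    thus ?thesis by linarith
  qed
  have small1: "real (card V) * (real NN + 1) * (2 * exp (- (s^2) / (4 * real d))) \<le> 1/4"
  proof -
    have "Q^30 / 4 \<le> s^2 / (4 * dd)"
    proof -
      have "s^2 / (4 * dd) = s / (4 * Q^5)" unfolding s_eq using dd0 Q16 by (simp add: power2_eq_square)
      moreover have "Q^35 / (4 * Q^5) \<le> s / (4 * Q^5)" using s_ge Q16 by (intro divide_right_mono) auto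
      moreover have "Q^35 / (4 * Q^5) = Q^30 / 4" using Q16 by (simp add: field_simps flip: power_add)
      ultimately show ?thesis by linarith
    qed
    from exp_E[OF this] have e: "exp (- (s^2) / (4 * real d)) \<le> E" by (simp add: dd_def)
    have "real NN + 1 \<le> Q^224"
    proof -
      have "dd^5 \<le> ((2 * Q)^40)^5" using dQ dd0 by (intro power_mono) auto
      also have "\<dots> = 2^200 * Q^200" by (simp add: power_mult_distrib flip: power_mult)
      also have "\<dots> \<le> Q^20 * Q^200"
      proof (intro mult_right_mono)
        have "(2::real)^200 = (2^10)^20" by (simp flip: power_mult)
        also have "\<dots> \<le> Q^20" using Q16 by (intro power_mono) auto
        finally show "2^200 \<le> Q^20" .
      qed (use Q16 in auto)
      finally have "dd^5 \<le> Q^220" by (simp flip: power_add)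
      hence "Q^3 * dd^5 \<le> Q^3 * Q^220" using Q16 by (intro mult_left_mono) auto
      hence "real NN \<le> Q^223" by (simp add: NN_def Q_def dd_def flip: power_add)
      moreover have "1 \<le> Q^223" using Q16 by (intro one_le_power) auto
      moreover have "2 * Q^223 \<le> Q * Q^223" using Q16 by (intro mult_right_mono) auto
      moreover have "Q * Q^223 = Q^224" by (simp flip: power_Suc)
      ultimately show ?thesis by linarith
    qed
    hence "n * (real NN + 1) * (2 * exp (- (s^2) / (4 * real d))) \<le> Q^200 * Q^224 * (2 * E)"
      using n_q e Q16 by (intro mult_mono) (auto simp: n_def)
    also have "\<dots> = 2 * Q^424 * E" by (simp flip: power_add)
    also have "\<dots> \<le> 1/4" using E_small[of 424] by simp
    finally show ?thesis by (simp add: n_def)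
  qed
  have small2: "real K * (183 * real d / (\<eta>^2 * real (card A)) + 200 / (\<eta>^2 * real d)) + 9 / \<eta> * (r ^ K / (1 - r)) \<le> 1/4"
  proof -
    have \<eta>2: "\<eta>^2 > 0" using \<eta> by simp
    have "0 < M / 2 * dd" using M960 dd0 by (intro mult_pos_pos) auto
    hence cA0: "real (card A) > 0" using cA2 by linarith
    have "183 * dd / (\<eta>^2 * real (card A)) \<le> 183 * dd / (\<eta>^2 * (M / 2 * dd))"
      using cA2 cA0 \<eta>2 M960 dd0 by (intro divide_left_mono mult_left_mono mult_pos_pos) auto
    also have "\<dots> = 366 / (\<eta>^2 * M)" using dd0 M960 \<eta> by (simp add: field_simps)
    finally have "real K * (183 * dd / (\<eta>^2 * real (card A))) \<le> real K * (366 / (\<eta>^2 * M))" by (intro mult_left_mono) auto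
    also have "\<dots> \<le> 1/16"
    proof -
      have "5856 * real K \<le> \<eta>^2 * M" using M(2) \<eta>2 by (simp add: divide_le_eq mult.commute)
      thus ?thesis using \<eta>2 M960 by (simp add: divide_le_eq)
    qed
    finally have 1: "real K * (183 * dd / (\<eta>^2 * real (card A))) \<le> 1/16" .
    have "real K * (200 / (\<eta>^2 * dd)) \<le> 1/16"
    proof -
      have "3200 * real K \<le> \<eta>^2 * Q" using q_large(2) \<eta>2 by (simp add: divide_le_eq mult.commute)
      also have "\<dots> \<le> \<eta>^2 * dd" using dpow[of 1] \<eta>2 by (intro mult_left_mono) auto
      finally show ?thesis using \<eta>2 dd0 by (simp add: divide_le_eq)
    qed
    thus ?thesis using 1 K(2) unfolding distrib_left dd_def by linarith
  qed
  have s2: "0 \<le> s" "s \<le> 2 * real d"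
  proof -
    show "0 \<le> s" by (simp add: s_def)
    have "1 \<le> Q^5" using Q16 by (intro one_le_power) auto
    hence "dd / Q^5 \<le> dd / 1" using dd0 Q16 by (intro divide_left_mono) auto
    hence "s \<le> dd" by (simp add: s_eq)
    thus "s \<le> 2 * real d" by (simp add: dd_def)
  qed
  obtain f where f: "f \<in> Pi\<^sub>E A (labels NN)"
    and disc: "\<forall>v\<in>V. \<forall>c\<le>NN. \<bar>real (card {u\<in>N v \<inter> A. c \<le> f u}) - (1 - real c / real NN) * real (card (N v \<inter> A))\<bar> < s"
    and low: "\<forall>\<tau>\<le>1. \<forall>g. g = (if \<tau> = 0 then f else (\<lambda>a. NN - 1 - f a)) \<longrightarrow> (\<forall>k\<in>{1..d}. (1 - \<eta>) * real k * real (card A) / real d \<le>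
        real (card {u \<in> A. thr NN \<tau> g (N u \<inter> A) u < k \<and> (k < K \<or> real (g u) * real d < (1 - \<eta>/4) * real k * real NN)}))"
    using labels_exist[OF AV dn \<eta> K(1) Kq Ad s2 small1 small2[unfolded r_def]] by blast
  have conf: "configuration V N d A P B f NN (d^5) q K (\<epsilon> / 8)"
  proof
    show "V = A \<union> P \<union> B" "A \<inter> P = {}" "A \<inter> B = {}" "P \<inter> B = {}" using PB by (auto simp: A_def)
    show "NN = q^3 * d^5" by (rule NN_def)
    show "q^5 \<le> NN"
    proof -
      have "q^2 \<le> q^40" using q2 by (intro power_increasing) auto
      also have "\<dots> \<le> d" by (rule d_q)
      also have "\<dots> \<le> d^5" using d0 by (intro self_le_power) auto
      finally have "q^3 * q^2 \<le> q^3 * d^5" by (rule mult_le_mono2)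
      thus ?thesis by (simp add: NN_def flip: power_add)
    qed
    show "0 < \<epsilon> / 8" "\<epsilon> / 8 \<le> 1" using \<epsilon> by auto
    show "2000 \<le> real q * (\<epsilon> / 8)" using q_large(1) \<epsilon> by (simp add: Q_def divide_le_eq)
    show "q^10 \<le> d"
    proof -
      have "q^10 \<le> q^40" using q2 by (intro power_increasing) auto
      thus ?thesis using d_q(1) by (rule order.trans)
    qed
    show "K \<le> q" by (rule q_large)
    show "V \<noteq> {}"
    proof
      assume "V = {}"
      hence "n = 0" by (simp add: n_def)
      moreover have "M * (real d + 1) > 0" using M960 by (intro mult_pos_pos) auto
      ultimately show False using Mn by linarith
    qed
  next
    fix v assume v: "v \<in> V"
    show "real d / (2 * real q) \<le> real (card (N v \<inter> P))" "real (card (N v \<inter> P)) \<le> 2 * real d / real q"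
      "real d / (2 * real q^2) \<le> real (card (N v \<inter> B))" "real (card (N v \<inter> B)) \<le> 2 * real d / real q^2"
      using NPB[OF v] by auto
    fix c assume "c \<le> NN"
    thus "\<bar>real (card {u\<in>N v \<inter> A. c \<le> f u}) - (1 - real c / real NN) * real (card (N v \<inter> A))\<bar> < real d / real q^5"
      using disc v unfolding s_def by blast
  next
    fix v assume "v \<in> A"
    thus "f v < NN" using f by auto
  next
    fix \<tau> k :: nat and g assume "\<tau> \<le> 1" "g = (if \<tau> = 0 then f else (\<lambda>a. NN - 1 - f a))" "k \<in> {1..d}"
    moreover have "\<epsilon> / 8 / 4 = \<eta>" by (simp add: \<eta>_def)
    ultimately show "(1 - \<epsilon> / 8 / 4) * real k * real (card A) / real d \<le>
        real (card {u \<in> A. thr NN \<tau> g (N u \<inter> A) u < k \<and> (k < K \<or> real (g u) * real d < (1 - \<epsilon> / 8 / 4 / 4) * real k * real NN)})"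
      using low by simp
  qed
  note defs = configuration.n_def[OF conf] configuration.dd_def[OF conf] configuration.Q_def[OF conf]
  show ?thesis
  proof (rule configuration.near_uniform_subgraph[OF conf \<epsilon> refl, unfolded defs, folded n_def Q_def])
    have "960 / \<epsilon> * (real d + 1) \<le> M * (real d + 1)" using M(1) by (intro mult_right_mono) auto
    thus "960 / \<epsilon> * (real d + 1) \<le> n" using Mn by linarith
    show "real d \<le> (2 * Q)^40" "Q^40 \<le> real d" using dQ by (simp_all add: dd_def)
    show "n \<le> Q^200" by (rule n_q)
    show "256 / \<epsilon> \<le> ln Q" by (rule q_large(4))
    show "8 * Q^200 * exp (- (Q^30 / 4)) \<le> 1" using E_small[of 200] by (simp add: E_def)
  qed
qed

end

section \<open>Regular graphs\<close>

lemma real_root_bracket: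
  fixes d p q0 :: nat
  assumes "p > 0" "q0^p \<le> d"
  shows "\<exists>q. q0 \<le> q \<and> q^p \<le> d \<and> d < (q+1)^p"
proof -
  define q where "q = (LEAST k. d < (k+1)^p)"
  have "d < (d+1)^p" using self_le_power[of "d+1" p] assms(1) by simp
  hence up: "d < (q+1)^p" unfolding q_def by (rule LeastI)
  have lo: "q^p \<le> d"
  proof (cases q)
    case 0
    thus ?thesis using assms(1) by (simp add: zero_power)
  next
    case (Suc k)
    hence "\<not> d < (k+1)^p" unfolding q_def by (intro not_less_Least) simp
    thus ?thesis using Suc by simp
  qed
  have "q0^p < (q+1)^p" using assms(2) up by linarith
  hence "q0 < q + 1" by (rule power_less_imp_less_base) simp
  thus ?thesis using lo up by (intro exI[of _ q]) simp
qed

lemma graph_of_nbhds: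
  fixes G :: "'a pair_pre_digraph"
  assumes G: "pair_graph G" and sub: "\<And>v. v \<in> pverts G \<Longrightarrow> nb v \<subseteq> {w. (v, w) \<in> parcs G}"
    and sym: "\<And>v u. v \<in> pverts G \<Longrightarrow> u \<in> nb v \<Longrightarrow> v \<in> nb u"
  shows "\<exists>H. pair_graph H \<and> spanning (with_proj H) (with_proj G) \<and> pverts H = pverts G \<and>
    (\<forall>v\<in>pverts G. out_degree (with_proj H) v = card (nb v))"
proof -
  interpret G: pair_graph G by (rule G)
  define H where "H = \<lparr>pverts = pverts G, parcs = {(v, u). v \<in> pverts G \<and> u \<in> nb v}\<rparr>"
  have HV: "pverts H = pverts G" and HE: "parcs H = {(v, u). v \<in> pverts G \<and> u \<in> nb v}" by (simp_all add: H_def)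
  have HG: "parcs H \<subseteq> parcs G" using sub by (auto simp: HE)
  have inV: "u \<in> pverts G" if "v \<in> pverts G" "u \<in> nb v" for v u using sub that G.in_arcsD2 by blast
  interpret H: pair_graph H
  proof
    show "fst e \<in> pverts H" "snd e \<in> pverts H" if "e \<in> parcs H" for e using that inV by (auto simp: HE HV)
    show "finite (pverts H)" by (simp add: HV)
    show "finite (parcs H)" using HG by (rule finite_subset) simp
    show "fst e \<noteq> snd e" if "e \<in> parcs H" for e using that HG G.pair_no_loops by blast
    show "symmetric (with_proj H)" unfolding symmetric_def
      by (rule symI) (use sym inV in \<open>auto simp: HE\<close>)
  qed
  have "spanning (with_proj H) (with_proj G)"
    unfolding spanning_def subgraph_def compatible_def
    using HG HV G.wf_digraph H.wf_digraph by simp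
  moreover have "out_degree (with_proj H) v = card (nb v)" if v: "v \<in> pverts G" for v
  proof -
    have "out_arcs (with_proj H) v = Pair v ` nb v" using v by (auto simp: out_arcs_def HE)
    thus ?thesis unfolding out_degree_def by (simp add: card_image inj_on_def)
  qed
  ultimately show ?thesis using H.pair_graph_axioms HV by (intro exI[of _ H]) blast
qed

lemma nbhds_of_graph:
  fixes G :: "'a pair_pre_digraph"
  assumes G: "pair_graph G" "regular_graph d G"
  shows "regular_nbhds (pverts G) (\<lambda>v. {w. (v, w) \<in> parcs G}) d"
proof -
  interpret G: pair_graph G by (rule G)
  show ?thesis
  proof
    show "finite (pverts G)" by simp
    fix v assume v: "v \<in> pverts G"
    show "{w. (v, w) \<in> parcs G} \<subseteq> pverts G - {v}" using G.in_arcsD2 G.pair_no_loops by fastforce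
    have "out_arcs (with_proj G) v = Pair v ` {w. (v, w) \<in> parcs G}" by (auto simp: out_arcs_def)
    hence "out_degree (with_proj G) v = card {w. (v, w) \<in> parcs G}" unfolding out_degree_def by (simp add: card_image inj_on_def)
    thus "card {w. (v, w) \<in> parcs G} = d" using G(2) v by (simp add: regular_graph_def)
    fix w assume "w \<in> {w. (v, w) \<in> parcs G}"
    thus "v \<in> {x. (w, x) \<in> parcs G}" using G.pair_sym_arcs by (auto simp: symmetric_def dest: symD)
  qed
qed

lemma parameters_exist:
  fixes \<epsilon> :: real
  assumes \<epsilon>: "0 < \<epsilon>" "\<epsilon> \<le> 1"
  defines "\<eta> \<equiv> \<epsilon> / 32"
  defines "r \<equiv> exp (- (\<eta>^2) / 256)"
  shows "\<exists>K::nat. 8 \<le> \<eta> * real K \<and> 9 / \<eta> * (r ^ K / (1 - r)) \<le> 1/8"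
proof -
  have \<eta>: "\<eta> > 0" using \<epsilon> by (simp add: \<eta>_def)
  have r: "0 \<le> r" "r < 1" using \<eta> by (auto simp: r_def)
  have "(\<lambda>K. r ^ K) \<longlonglongrightarrow> 0" using r by (intro LIMSEQ_realpow_zero)
  hence "(\<lambda>K. 9 / \<eta> * (r ^ K / (1 - r))) \<longlonglongrightarrow> 9 / \<eta> * (0 / (1 - r))" by (intro tendsto_intros) (use r in auto)
  hence "eventually (\<lambda>K. 9 / \<eta> * (r ^ K / (1 - r)) < 1/8) sequentially" by (rule order_tendstoD) simp
  moreover have "eventually (\<lambda>K. real K \<ge> 8 / \<eta>) sequentially" by (rule eventually_ge_at_top[THEN filterlim_real_sequentially[unfolded filterlim_iff, rule_format]])
  ultimately have "eventually (\<lambda>K. 9 / \<eta> * (r ^ K / (1 - r)) < 1/8 \<and> real K \<ge> 8 / \<eta>) sequentially" by (rule eventually_conj)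
  then obtain K where "9 / \<eta> * (r ^ K / (1 - r)) < 1/8" "real K \<ge> 8 / \<eta>" by (auto simp: eventually_sequentially)
  thus ?thesis using \<eta> by (intro exI[of _ K]) (auto simp: divide_le_eq mult.commute)
qed

lemma eventually_large:
  fixes c :: real
  shows "\<exists>q0::nat. \<forall>q\<ge>q0. c \<le> real q \<and> c \<le> ln (real q) \<and> 8 * real q^450 * exp (- (real q^30 / 4)) \<le> 1"
proof -
  have "eventually (\<lambda>q::nat. c \<le> real q) at_top" by real_asymp
  moreover have "eventually (\<lambda>q::nat. c \<le> ln (real q)) at_top" by real_asymp
  moreover have "eventually (\<lambda>q::nat. 8 * real q^450 * exp (- (real q^30 / 4)) \<le> 1) at_top" by real_asymp
  ultimately have "eventually (\<lambda>q::nat. c \<le> real q \<and> c \<le> ln (real q) \<and> 8 * real q^450 * exp (- (real q^30 / 4)) \<le> 1) at_top"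
    by eventually_elim auto
  thus ?thesis by (simp add: eventually_at_top_linorder)
qed

text \<open>
If \<open>n\<close> exceeds a multiple of \<open>(d+1)\<^sup>4\<close>, plain threshold labels suffice. Otherwise \<open>(d+1)\<^sup>3\<close> is at least a
multiple of \<open>n/(d+1)\<close>, so that \<open>d\<close> is as large as desired.
\<close>

lemma regular_subgraph_small_eps:
  fixes \<epsilon> :: real
  assumes \<epsilon>: "0 < \<epsilon>" "\<epsilon> \<le> 1"
  shows "\<exists>lam>0. \<forall>V N d. regular_nbhds (V :: 'a set) N d \<longrightarrow> V \<noteq> {} \<longrightarrow> real d \<le> lam * real (card V) \<longrightarrow>
    (\<exists>nb. (\<forall>v\<in>V. nb v \<subseteq> N v) \<and> (\<forall>v\<in>V. \<forall>u\<in>nb v. v \<in> nb u) \<and>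
     (\<forall>k\<le>d. (1 - \<epsilon>) * (real (card V) / (real d + 1)) \<le> real (card {v\<in>V. card (nb v) = k}) \<and>
        real (card {v\<in>V. card (nb v) = k}) \<le> (1 + \<epsilon>) * (real (card V) / (real d + 1))))"
proof -
  define \<eta> where "\<eta> = \<epsilon> / 32"
  obtain K :: nat where K: "8 \<le> \<eta> * real K" "9 / \<eta> * (exp (- (\<eta>^2) / 256) ^ K / (1 - exp (- (\<eta>^2) / 256))) \<le> 1/8"
    using parameters_exist[OF \<epsilon>] unfolding \<eta>_def by blast
  define c where "c = Max {16000 / \<epsilon>, 3200 * real K / \<eta>^2, real K, 256 / \<epsilon>, 7 / \<epsilon>^2}"
  have c: "16000 / \<epsilon> \<le> c" "3200 * real K / \<eta>^2 \<le> c" "real K \<le> c" "256 / \<epsilon> \<le> c" "7 / \<epsilon>^2 \<le> c"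
    unfolding c_def by (rule Max_ge; simp)+
  obtain q0 :: nat where q0: "\<And>q. q0 \<le> q \<Longrightarrow> c \<le> real q \<and> c \<le> ln (real q) \<and> 8 * real q^450 * exp (- (real q^30 / 4)) \<le> 1"
    using eventually_large[of c] by blast
  define M where "M = Max {960 / \<epsilon>, 5856 * real K / \<eta>^2, 7 / \<epsilon>^2 * (real q0^40 + 1)^3}"
  have M: "960 / \<epsilon> \<le> M" "5856 * real K / \<eta>^2 \<le> M" "7 / \<epsilon>^2 * (real q0^40 + 1)^3 \<le> M"
    unfolding M_def by (rule Max_ge; simp)+
  have M960: "M \<ge> 960"
  proof -
    have "960 / 1 \<le> 960 / \<epsilon>" using \<epsilon> by (intro divide_left_mono) auto
    thus ?thesis using M(1) by linarith
  qed
  show ?thesis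
  proof (intro exI[of _ "1 / (2 * M)"] conjI allI impI)
    show "1 / (2 * M) > 0" using M960 by simp
    fix V :: "'a set" and N d
    assume reg: "regular_nbhds V N d" and ne: "V \<noteq> {}" and dl: "real d \<le> 1 / (2 * M) * real (card V)"
    interpret regular_nbhds V N d by (rule reg)
    define n where "n = real (card V)"
    have n1: "n \<ge> 1" using ne finV by (simp add: n_def Suc_le_eq card_gt_0_iff)
    let ?goal = "\<lambda>nb. (\<forall>v\<in>V. nb v \<subseteq> N v) \<and> (\<forall>v\<in>V. \<forall>u\<in>nb v. v \<in> nb u) \<and>
     (\<forall>k\<le>d. (1 - \<epsilon>) * (n / (real d + 1)) \<le> real (card {v\<in>V. card (nb v) = k}) \<and>
        real (card {v\<in>V. card (nb v) = k}) \<le> (1 + \<epsilon>) * (n / (real d + 1)))"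
    have "\<exists>nb. ?goal nb"
    proof (cases "d = 0")
      case True
      thus ?thesis using \<epsilon> n1 by (intro exI[of _ "\<lambda>_. {}"]) (auto simp: n_def mult_le_cancel_right1)
    next
      case False
      hence d1: "real d \<ge> 1" by simp
      have dn: "2 * M * real d \<le> n" using dl M960 by (simp add: n_def field_simps)
      have "M * (real d + 1) \<le> M * (2 * real d)" using d1 M960 by (intro mult_left_mono) auto
      hence Mn: "M * (real d + 1) \<le> n" using dn by simp
      show ?thesis
      proof (cases "\<epsilon>^2 * n > 7 * (real d + 1)^4")
        case True
        have "1 * (real d + 1) \<le> M * (real d + 1)" using M960 by (intro mult_right_mono) auto
        also note Mn
        finally have "real d + 1 \<le> n" by simp
        hence "real (d + 1) \<le> real (card V)" by (simp add: n_def)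
        hence d1n: "d + 1 \<le> card V" by (simp only: of_nat_le_iff)
        obtain NN f where f: "\<And>k. k \<le> d \<Longrightarrow> \<bar>real (card {v\<in>V. thr NN 0 f (N v) v = k}) - n / (real d + 1)\<bar> < \<epsilon> * (n / (real d + 1))"
          using sparse_regular_labels[OF \<epsilon>(1) _ d1n] True unfolding n_def by blast
        define nb where "nb = (\<lambda>v. {w\<in>N v. NN \<le> f w + f v + 0})"
        have "card (nb v) = thr NN 0 f (N v) v" for v by (simp add: nb_def thr_def)
        hence eq: "{v\<in>V. card (nb v) = k} = {v\<in>V. thr NN 0 f (N v) v = k}" for k by simp
        have "(1 - \<epsilon>) * y \<le> z \<and> z \<le> (1 + \<epsilon>) * y" if "\<bar>z - y\<bar> < \<epsilon> * y" for y z
          using that by (auto simp: algebra_simps abs_if split: if_splits)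
        hence "\<forall>k\<le>d. (1 - \<epsilon>) * (n / (real d + 1)) \<le> real (card {v\<in>V. card (nb v) = k}) \<and>
          real (card {v\<in>V. card (nb v) = k}) \<le> (1 + \<epsilon>) * (n / (real d + 1))"
          using f unfolding eq by blast
        moreover have "\<forall>v\<in>V. nb v \<subseteq> N v" "\<forall>v\<in>V. \<forall>u\<in>nb v. v \<in> nb u"
          using N_sym by (auto simp: nb_def add.commute)
        ultimately show ?thesis by blast
      next
        case False
        have "7 / \<epsilon>^2 * (real q0^40 + 1)^3 * (real d + 1) \<le> M * (real d + 1)" using M(3) by (intro mult_right_mono) auto
        hence "7 / \<epsilon>^2 * (real q0^40 + 1)^3 * (real d + 1) \<le> n" using Mn by linarith
        moreover have n_up: "n \<le> 7 / \<epsilon>^2 * (real d + 1)^4" using False \<epsilon> by (simp add: field_simps)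
        ultimately have "7 / \<epsilon>^2 * (real q0^40 + 1)^3 * (real d + 1) \<le> 7 / \<epsilon>^2 * (real d + 1)^3 * (real d + 1)"
          by (simp add: power_numeral_reduce mult_ac)
        hence "7 / \<epsilon>^2 * (real q0^40 + 1)^3 \<le> 7 / \<epsilon>^2 * (real d + 1)^3" by (rule mult_right_le_imp_le) simp
        hence "(real q0^40 + 1)^3 \<le> (real d + 1)^3" by (rule mult_left_le_imp_le) (use \<epsilon> in simp)
        hence "real q0^40 + 1 \<le> real d + 1" by (rule power_le_imp_le_base[of _ 2, simplified]) simp
        hence "real (q0^40) \<le> real d" by simp
        hence "q0^40 \<le> d" by (simp only: of_nat_le_iff)
        then obtain q where q: "q0 \<le> q" "q^40 \<le> d" "d < (q+1)^40" using real_root_bracket[of 40 q0 d] by auto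
        define Q where "Q = real q"
        have Q: "c \<le> Q" "c \<le> ln Q" "8 * Q^450 * exp (- (Q^30 / 4)) \<le> 1" using q0[OF q(1)] by (auto simp: Q_def)
        have Q16: "Q \<ge> 16000"
        proof -
          have "16000 / 1 \<le> 16000 / \<epsilon>" using \<epsilon> by (intro divide_left_mono) auto
          thus ?thesis using c(1) Q(1) by linarith
        qed
        have "q + 1 \<le> 2 * q" using Q16 by (simp add: Q_def)
        hence "(q+1)^40 \<le> (2*q)^40" by (rule power_mono) simp
        hence d_up: "d \<le> (2*q)^40" using q(3) by linarith
        have "n \<le> Q^200"
        proof -
          have "real d \<le> real ((2*q)^40)" using d_up by (simp only: of_nat_le_iff)
          hence "real d \<le> (2*Q)^40" by (simp add: Q_def)
          moreover have "1 \<le> (2*Q)^40" using Q16 by (intro one_le_power) auto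
          ultimately have "real d + 1 \<le> 2 * (2*Q)^40" by linarith
          hence "(real d + 1)^4 \<le> (2 * (2*Q)^40)^4" by (intro power_mono) auto
          also have "\<dots> = 2^164 * Q^160" by (simp add: power_mult_distrib flip: power_mult power_add)
          also have "\<dots> \<le> Q^20 * Q^160"
          proof (intro mult_right_mono)
            have "(2::real)^164 \<le> 2^200" by (intro power_increasing) auto
            also have "\<dots> = (2^10)^20" by (simp flip: power_mult)
            also have "\<dots> \<le> Q^20" using Q16 by (intro power_mono) auto
            finally show "2^164 \<le> Q^20" .
          qed (use Q16 in auto)
          finally have "(real d + 1)^4 \<le> Q^180" by (simp flip: power_add)
          hence "7 / \<epsilon>^2 * (real d + 1)^4 \<le> Q * Q^180" using c(5) Q(1) Q16 by (intro mult_mono) auto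
          also have "\<dots> = Q^181" by (simp flip: power_Suc)
          also have "\<dots> \<le> Q^200" using Q16 by (intro power_increasing) auto
          finally show ?thesis using n_up by linarith
        qed
        moreover have "K \<le> q" using c(3) Q(1) by (simp add: Q_def)
        ultimately show ?thesis
          using dense_regular_subgraph[OF \<epsilon> q(2) d_up, of M K] Mn M(1,2) c Q K unfolding n_def Q_def \<eta>_def by auto
      qed
    qed
    thus "\<exists>nb. (\<forall>v\<in>V. nb v \<subseteq> N v) \<and> (\<forall>v\<in>V. \<forall>u\<in>nb v. v \<in> nb u) \<and>
     (\<forall>k\<le>d. (1 - \<epsilon>) * (real (card V) / (real d + 1)) \<le> real (card {v\<in>V. card (nb v) = k}) \<and>
        real (card {v\<in>V. card (nb v) = k}) \<le> (1 + \<epsilon>) * (real (card V) / (real d + 1)))" unfolding n_def .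
  qed
qed

theorem theorem1p3:
  shows "\<forall>\<epsilon>::real. \<epsilon> > 0 \<longrightarrow> (\<exists>lam::real. lam > 0 \<and>
    (\<forall>(n::nat) (d::nat) (G :: 'a pair_pre_digraph).
       n \<ge> 1 \<longrightarrow> real d \<le> lam * real n \<longrightarrow>
       pair_graph G \<longrightarrow> card (pverts G) = n \<longrightarrow> regular_graph d G \<longrightarrow>
       (\<exists>H :: 'a pair_pre_digraph.
          pair_graph H \<and> spanning (with_proj H) (with_proj G) \<and>
          (\<forall>k::nat. k \<le> d \<longrightarrow>
             (1 - \<epsilon>) * (real n / (real d + 1))
               \<le> real (card {v \<in> pverts H. out_degree (with_proj H) v = k}) \<and>
             real (card {v \<in> pverts H. out_degree (with_proj H) v = k})
               \<le> (1 + \<epsilon>) * (real n / (real d + 1))))))"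
proof (intro allI impI)
  fix \<epsilon> :: real assume \<epsilon>: "\<epsilon> > 0"
  define e where "e = min \<epsilon> 1"
  have e: "0 < e" "e \<le> 1" "e \<le> \<epsilon>" using \<epsilon> by (auto simp: e_def)
  obtain lam :: real where lam: "lam > 0"
    and "\<forall>V N d. regular_nbhds (V :: 'a set) N d \<longrightarrow> V \<noteq> {} \<longrightarrow> real d \<le> lam * real (card V) \<longrightarrow>
    (\<exists>nb. (\<forall>v\<in>V. nb v \<subseteq> N v) \<and> (\<forall>v\<in>V. \<forall>u\<in>nb v. v \<in> nb u) \<and>
     (\<forall>k\<le>d. (1 - e) * (real (card V) / (real d + 1)) \<le> real (card {v\<in>V. card (nb v) = k}) \<and>
        real (card {v\<in>V. card (nb v) = k}) \<le> (1 + e) * (real (card V) / (real d + 1))))"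
    using regular_subgraph_small_eps[OF e(1,2), where 'a='a] by (elim exE conjE) (rule that)
  note nbs = this(2)[rule_format]
  show "\<exists>lam::real. lam > 0 \<and>
    (\<forall>(n::nat) (d::nat) (G :: 'a pair_pre_digraph).
       n \<ge> 1 \<longrightarrow> real d \<le> lam * real n \<longrightarrow>
       pair_graph G \<longrightarrow> card (pverts G) = n \<longrightarrow> regular_graph d G \<longrightarrow>
       (\<exists>H :: 'a pair_pre_digraph.
          pair_graph H \<and> spanning (with_proj H) (with_proj G) \<and>
          (\<forall>k::nat. k \<le> d \<longrightarrow>
             (1 - \<epsilon>) * (real n / (real d + 1))
               \<le> real (card {v \<in> pverts H. out_degree (with_proj H) v = k}) \<and>
             real (card {v \<in> pverts H. out_degree (with_proj H) v = k})
               \<le> (1 + \<epsilon>) * (real n / (real d + 1)))))"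
  proof (intro exI[of _ lam] conjI allI impI lam)
    fix n d :: nat and G :: "'a pair_pre_digraph"
    assume n: "n \<ge> 1" "real d \<le> lam * real n" and G: "pair_graph G" "card (pverts G) = n" "regular_graph d G"
    have ne: "pverts G \<noteq> {}" using n G(2) by auto
    have dl: "real d \<le> lam * real (card (pverts G))" using n(2) G(2) by simp
    obtain nb where nb: "\<forall>v\<in>pverts G. nb v \<subseteq> {w. (v, w) \<in> parcs G}" "\<forall>v\<in>pverts G. \<forall>u\<in>nb v. v \<in> nb u"
      "\<forall>k\<le>d. (1 - e) * (real n / (real d + 1)) \<le> real (card {v\<in>pverts G. card (nb v) = k}) \<and>
        real (card {v\<in>pverts G. card (nb v) = k}) \<le> (1 + e) * (real n / (real d + 1))"
      using nbs[OF nbhds_of_graph[OF G(1,3)] ne dl] unfolding G(2) by (elim exE conjE) (rule that)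
    obtain H where H: "pair_graph H" "spanning (with_proj H) (with_proj G)" "pverts H = pverts G"
      "\<And>v. v \<in> pverts G \<Longrightarrow> out_degree (with_proj H) v = card (nb v)"
      using graph_of_nbhds[OF G(1) nb(1)[rule_format] nb(2)[rule_format]] by blast
    have eq: "{v \<in> pverts H. out_degree (with_proj H) v = k} = {v\<in>pverts G. card (nb v) = k}" for k
      using H(3,4) by auto
    have y: "real n / (real d + 1) \<ge> 0" by simp
    have weaken: "(1 - \<epsilon>) * y \<le> (1 - e) * y \<and> (1 + e) * y \<le> (1 + \<epsilon>) * y" if "y \<ge> 0" for y :: real
      using e(3) that by (intro conjI mult_right_mono) simp_all
    show "\<exists>H. pair_graph H \<and> spanning (with_proj H) (with_proj G) \<and>
          (\<forall>k::nat. k \<le> d \<longrightarrow>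
             (1 - \<epsilon>) * (real n / (real d + 1))
               \<le> real (card {v \<in> pverts H. out_degree (with_proj H) v = k}) \<and>
             real (card {v \<in> pverts H. out_degree (with_proj H) v = k})
               \<le> (1 + \<epsilon>) * (real n / (real d + 1)))"
    proof (intro exI[of _ H] conjI allI impI H(1,2))
      fix k assume "k \<le> d"
      from nb(3)[rule_format, OF this] weaken[OF y]
      show "(1 - \<epsilon>) * (real n / (real d + 1)) \<le> real (card {v \<in> pverts H. out_degree (with_proj H) v = k})"
        "real (card {v \<in> pverts H. out_degree (with_proj H) v = k}) \<le> (1 + \<epsilon>) * (real n / (real d + 1))"
        unfolding eq by linarith+
    qed
  qed
qed

end
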